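(* Let $0<s<1$ and let $(X,d,\mu)$ be a complete, connected metric measure space equipped with a doubling measure. Let $Q>s$ be a doubling dimension. Let $\Omega\subset X$ be a nonempty open set. Let $x_0\in\Omega$, $0<r<R$ with $B(x_0,R)\subset\Omega$, and $k_0\in\mathbb R$. Assume that either (a) $u$ is an $s$-subminimizer in $\Omega$; or (b) $u$ is a $\mathcal K_{\psi,0}(\Omega)$-solution where $\psi:\Omega\to[-\infty,\infty)$ is a function such that $\psi\le k_0$ a.e. on $B(x_0,R)$. Then there exists a constant $C_3>0$ depending on $s$ and the doubling constant such that $$\operatorname*{ess\,sup}_{y\in B(x_0,r)}(u(y)-k_0)\le C_3\left(\frac{R}{R-r}\right)^Q\frac{1}{\mu(B(x_0,R))}\int_{B(x_0,R)}(u-k_0)_+\,d\mu .$$ Moreover, if we additionally assume that $\mu$ supports a $1$-Poincaré inequality, then the constant $C_3$ can be chosen as $$C_3=\left(\frac{C_3'}{s}\right)^{Q/s},$$ where $C_3'>0$ depends only on the doubling and Poincaré constants.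
   Context: A metric measure space $(X,d,\mu)$ is a nonempty separable metric space $(X,d)$ with a locally finite Borel-regular outer measure $\mu$ on $X$. $B(x,r)$ is the open ball with center $x$ and radius $r>0$. It is equipped with a doubling measure if there is a doubling constant $C_\mu>0$ such that $0<\mu(B(x,r))<\infty$ and $\mu(B(x,2r))\le C_\mu\mu(B(x,r))$ for all balls $B(x,r)$. A number $Q>0$ is a doubling dimension if there is a constant $c>0$ such that $\mu(B(x,r))/\mu(B(x,R))\ge c\,(r/R)^Q$ for all $0<r<R$ and $x\in X$. A Borel function $g:X\to[0,\infty]$ is an upper gradient of $u$ if $|u(\gamma(0))-u(\gamma(1))|\le\int_\gamma g\,ds$ for every rectifiable curve $\gamma:[0,1]\to X$. $\mu$ supports a $1$-Poincaré inequality if there are Poincaré constants $C_P>0$, $\lambda\ge1$ such that $$\frac1{\mu(B(x,r))}\int_{B(x,r)}|u-u_{B(x,r)}|\,d\mu\le C_P\,r\,\frac1{\mu(B(x,\lambda r))}\int_{B(x,\lambda r)}g\,d\mu$$ for every ball $B(x,r)$, every function $u$ integrable on balls and every upper gradient $g$ of $u$, where $u_B:=\mu(B)^{-1}\int_Bu\,d\mu$. Write $B_{x,y}:=B(x,d(x,y))\cup B(y,d(x,y))$, $\Omega^c:=X\setminus\Omega$ and $a_+:=\max\{a,0\}$. For an open set $\Omega\subset X$ and measurable $u:\Omega\to[-\infty,\infty]$ let $$\|u\|_{\dot W^{s,1}(\Omega)}:=\int_\Omega\int_\Omega\frac{|u(x)-u(y)|}{\mu(B_{x,y})d(x,y)^s}\,d\mu(x)\,d\mu(y),\qquad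 \|u\|_{W^{s,1}(\Omega)}:=\|u\|_{L^1(\Omega)}+\|u\|_{\dot W^{s,1}(\Omega)};$$ $\dot W^{s,1}(\Omega)$ and $W^{s,1}(\Omega)$ are the spaces of measurable functions on $\Omega$ for which the respective quantity is finite. $W^{s,1}_0(\Omega)$ is the set of $u\in W^{s,1}(X)$ with $u=0$ a.e. on $\Omega^c$. For measurable functions $u,v$ on $X$ let $$F(u,v):=\left(\int_\Omega\int_\Omega+2\int_\Omega\int_{\Omega^c}\right)\frac{|u(x)-u(y)|-|v(x)-v(y)|}{\mu(B_{x,y})d(x,y)^s}\,d\mu(x)\,d\mu(y).$$ A measurable function $u:X\to[-\infty,\infty]$ is an $s$-subminimizer in $\Omega$ if $u\in\dot W^{s,1}(\Omega)$ and $F(u,u+\eta)\le 0$ for every nonpositive $\eta\in W^{s,1}_0(\Omega)$. For $\psi:\Omega\to[-\infty,\infty)$ and $f\in\dot W^{s,1}(X)$ let $\mathcal K_{\psi,f}(\Omega):=\{u\in\dot W^{s,1}(X):u\ge\psi\text{ a.e. on }\Omega,\ u=f\text{ a.e. on }X\setminus\Omega\}$. A $\mathcal K_{\psi,f}(\Omega)$-solution is a function $u\in\mathcal K_{\psi,f}(\Omega)$ with $\|u\|_{\dot W^{s,1}(X)}\le\|v\|_{\dot W^{s,1}(X)}$ for all $v\in\mathcal K_{\psi,f}(\Omega)$.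
   Formalization: The constants C_3 and C_3' may also depend on the constant c in the definition of the doubling dimension Q; with dependence on s and the doubling constant C_mu alone the estimate fails when c tends to 0 for fixed Q. *)

theory Defs
  imports "HOL-Analysis.Analysis" "HOL-Probability.Essential_Supremum"
begin

text \<open>
  A metric measure space is given by \<open>m :: 'a metric\<close> and an outer measure
  \<open>\<mu> :: 'a set \<Rightarrow> ennreal\<close>, of which only the values on subsets of \<open>mspace m\<close> matter.
  Spaces are objects rather than type class instances, so that a constant can be chosen uniformly
  over all spaces on \<open>'a\<close>. A nonempty complete separable metric space has at most continuum
  cardinality, so \<open>'a = real\<close> covers all of them up to isometry.
\<close>

definition mborel :: "'a metric \<Rightarrow> 'a measure" where
  "mborel m = sigma (mspace m) {U. openin (mtopology_of m) U}"

text \<open>The (complete) measure space of Caratheodory-measurable sets.\<close>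

definition meas :: "'a metric \<Rightarrow> ('a set \<Rightarrow> ennreal) \<Rightarrow> 'a measure" where
  "meas m \<mu> = measure_of (mspace m) (lambda_system (mspace m) (Pow (mspace m)) \<mu>) \<mu>"

definition metric_measure_space :: "'a metric \<Rightarrow> ('a set \<Rightarrow> ennreal) \<Rightarrow> bool" where
  "metric_measure_space m \<mu> \<longleftrightarrow>
     mspace m \<noteq> {} \<and> separable_space (mtopology_of m) \<and>
     outer_measure_space (Pow (mspace m)) \<mu> \<and>
     sets (mborel m) \<subseteq> lambda_system (mspace m) (Pow (mspace m)) \<mu> \<and>
     (\<forall>A \<subseteq> mspace m. \<exists>B \<in> sets (mborel m). A \<subseteq> B \<and> \<mu> B = \<mu> A) \<and>
     (\<forall>x \<in> mspace m. \<exists>r>0. \<mu> (mball_of m x r) < \<infinity>)"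

definition doubling :: "'a metric \<Rightarrow> ('a set \<Rightarrow> ennreal) \<Rightarrow> real \<Rightarrow> bool" where
  "doubling m \<mu> C \<longleftrightarrow> C > 0 \<and>
     (\<forall>x \<in> mspace m. \<forall>r>0. 0 < \<mu> (mball_of m x r) \<and> \<mu> (mball_of m x r) < \<infinity> \<and>
        \<mu> (mball_of m x (2 * r)) \<le> ennreal C * \<mu> (mball_of m x r))"

definition doubling_dimension :: "'a metric \<Rightarrow> ('a set \<Rightarrow> ennreal) \<Rightarrow> real \<Rightarrow> real \<Rightarrow> bool" where
  "doubling_dimension m \<mu> Q c \<longleftrightarrow> Q > 0 \<and> c > 0 \<and>
     (\<forall>x \<in> mspace m. \<forall>r R. 0 < r \<and> r < R \<longrightarrow>
        \<mu> (mball_of m x r) / \<mu> (mball_of m x R) \<ge> ennreal (c * (r / R) powr Q))"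

definition curve_length :: "'a metric \<Rightarrow> (real \<Rightarrow> 'a) \<Rightarrow> real \<Rightarrow> real \<Rightarrow> ennreal" where
  "curve_length m \<gamma> a b =
     (SUP (n, t) \<in> {(n::nat, t). (\<forall>i\<le>n. t i \<in> {a..b}) \<and> (\<forall>i<n. t i \<le> t (Suc i))}.
        \<Sum>i<n. ennreal (mdist m (\<gamma> (t i)) (\<gamma> (t (Suc i)))))"

definition rectifiable :: "'a metric \<Rightarrow> (real \<Rightarrow> 'a) \<Rightarrow> bool" where
  "rectifiable m \<gamma> \<longleftrightarrow> pathin (mtopology_of m) \<gamma> \<and> curve_length m \<gamma> 0 1 < \<infinity>"

text \<open>
  The arc-length parametrization takes \<open>\<tau>\<close> to \<open>\<gamma> t\<close> for any \<open>t\<close> such that \<open>\<gamma>\<close> has length \<open>\<tau>\<close> on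
  \<open>{0..t}\<close>; for a rectifiable curve such a \<open>t\<close> exists for each \<open>\<tau>\<close> up to the total length, and
  \<open>\<gamma> t\<close> does not depend on its choice.
\<close>

definition arc_length_param :: "'a metric \<Rightarrow> (real \<Rightarrow> 'a) \<Rightarrow> real \<Rightarrow> 'a" where
  "arc_length_param m \<gamma> \<tau> = \<gamma> (SOME t. t \<in> {0..1} \<and> curve_length m \<gamma> 0 t = ennreal \<tau>)"

definition curve_integral :: "'a metric \<Rightarrow> (real \<Rightarrow> 'a) \<Rightarrow> ('a \<Rightarrow> ennreal) \<Rightarrow> ennreal" where
  "curve_integral m \<gamma> g =
     (\<integral>\<^sup>+\<tau>\<in>{0..enn2real (curve_length m \<gamma> 0 1)}. g (arc_length_param m \<gamma> \<tau>) \<partial>lborel)"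

definition upper_gradient :: "'a metric \<Rightarrow> ('a \<Rightarrow> real) \<Rightarrow> ('a \<Rightarrow> ennreal) \<Rightarrow> bool" where
  "upper_gradient m u g \<longleftrightarrow> g \<in> borel_measurable (mborel m) \<and>
     (\<forall>\<gamma>. rectifiable m \<gamma> \<longrightarrow> ennreal \<bar>u (\<gamma> 0) - u (\<gamma> 1)\<bar> \<le> curve_integral m \<gamma> g)"

definition ball_mean :: "'a metric \<Rightarrow> ('a set \<Rightarrow> ennreal) \<Rightarrow> 'a set \<Rightarrow> ('a \<Rightarrow> real) \<Rightarrow> real" where
  "ball_mean m \<mu> B u = (LINT y:B|meas m \<mu>. u y) / enn2real (\<mu> B)"

definition poincare :: "'a metric \<Rightarrow> ('a set \<Rightarrow> ennreal) \<Rightarrow> real \<Rightarrow> real \<Rightarrow> bool" where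
  "poincare m \<mu> C lam \<longleftrightarrow> C > 0 \<and> lam \<ge> 1 \<and>
     (\<forall>u g. (\<forall>x \<in> mspace m. \<forall>r>0. set_integrable (meas m \<mu>) (mball_of m x r) u) \<longrightarrow>
        upper_gradient m u g \<longrightarrow>
        (\<forall>x \<in> mspace m. \<forall>r>0.
           (\<integral>\<^sup>+y\<in>mball_of m x r. ennreal \<bar>u y - ball_mean m \<mu> (mball_of m x r) u\<bar> \<partial>meas m \<mu>)
             / \<mu> (mball_of m x r)
           \<le> ennreal (C * r) *
             ((\<integral>\<^sup>+y\<in>mball_of m x (lam * r). g y \<partial>meas m \<mu>) / \<mu> (mball_of m x (lam * r)))))"

definition kernel :: "'a metric \<Rightarrow> ('a set \<Rightarrow> ennreal) \<Rightarrow> real \<Rightarrow> 'a \<Rightarrow> 'a \<Rightarrow> ennreal" where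
  "kernel m \<mu> s x y =
     \<mu> (mball_of m x (mdist m x y) \<union> mball_of m y (mdist m x y)) * ennreal (mdist m x y powr s)"

text \<open>
  In \<open>ereal\<close> one has \<open>\<bar>a - b\<bar> = \<infinity>\<close> whenever \<open>a\<close> or \<open>b\<close> is infinite; on the diagonal, where the
  kernel vanishes, \<open>0 / 0 = 0\<close>.
\<close>

definition seminorm_Ws1 ::
  "'a metric \<Rightarrow> ('a set \<Rightarrow> ennreal) \<Rightarrow> real \<Rightarrow> 'a set \<Rightarrow> ('a \<Rightarrow> ereal) \<Rightarrow> ennreal" where
  "seminorm_Ws1 m \<mu> s \<Omega> u =
     (\<integral>\<^sup>+y\<in>\<Omega>. (\<integral>\<^sup>+x\<in>\<Omega>. e2ennreal \<bar>u x - u y\<bar> / kernel m \<mu> s x y \<partial>meas m \<mu>) \<partial>meas m \<mu>)"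

definition norm_Ws1 ::
  "'a metric \<Rightarrow> ('a set \<Rightarrow> ennreal) \<Rightarrow> real \<Rightarrow> 'a set \<Rightarrow> ('a \<Rightarrow> ereal) \<Rightarrow> ennreal" where
  "norm_Ws1 m \<mu> s \<Omega> u = (\<integral>\<^sup>+x\<in>\<Omega>. e2ennreal \<bar>u x\<bar> \<partial>meas m \<mu>) + seminorm_Ws1 m \<mu> s \<Omega> u"

definition dot_Ws1 ::
  "'a metric \<Rightarrow> ('a set \<Rightarrow> ennreal) \<Rightarrow> real \<Rightarrow> 'a set \<Rightarrow> ('a \<Rightarrow> ereal) set" where
  "dot_Ws1 m \<mu> s \<Omega> =
     {u. u \<in> borel_measurable (restrict_space (meas m \<mu>) \<Omega>) \<and> seminorm_Ws1 m \<mu> s \<Omega> u < \<infinity>}"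

definition Ws1 ::
  "'a metric \<Rightarrow> ('a set \<Rightarrow> ennreal) \<Rightarrow> real \<Rightarrow> 'a set \<Rightarrow> ('a \<Rightarrow> ereal) set" where
  "Ws1 m \<mu> s \<Omega> =
     {u. u \<in> borel_measurable (restrict_space (meas m \<mu>) \<Omega>) \<and> norm_Ws1 m \<mu> s \<Omega> u < \<infinity>}"

definition Ws1_0 ::
  "'a metric \<Rightarrow> ('a set \<Rightarrow> ennreal) \<Rightarrow> real \<Rightarrow> 'a set \<Rightarrow> ('a \<Rightarrow> ereal) set" where
  "Ws1_0 m \<mu> s \<Omega> =
     {u \<in> Ws1 m \<mu> s (mspace m). AE x in meas m \<mu>. x \<in> mspace m - \<Omega> \<longrightarrow> u x = 0}"

text \<open>
  Integral of an extended real function as positive minus negative part. In \<open>ereal\<close>,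
  \<open>\<infinity> - \<infinity> = \<infinity>\<close>: an undefined integral, and likewise an undefined integrand below,
  counts as \<open>\<infinity>\<close> and hence never as nonpositive.
\<close>

definition ereal_integral :: "'a measure \<Rightarrow> 'a set \<Rightarrow> ('a \<Rightarrow> ereal) \<Rightarrow> ereal" where
  "ereal_integral M A f =
     enn2ereal (\<integral>\<^sup>+x\<in>A. e2ennreal (f x) \<partial>M) - enn2ereal (\<integral>\<^sup>+x\<in>A. e2ennreal (- f x) \<partial>M)"

definition F_integrand ::
  "'a metric \<Rightarrow> ('a set \<Rightarrow> ennreal) \<Rightarrow> real \<Rightarrow> ('a \<Rightarrow> ereal) \<Rightarrow> ('a \<Rightarrow> ereal) \<Rightarrow> 'a \<Rightarrow> 'a \<Rightarrow> ereal" where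
  "F_integrand m \<mu> s u v x y =
     (\<bar>u x - u y\<bar> - \<bar>v x - v y\<bar>) / enn2ereal (kernel m \<mu> s x y)"

definition F_functional ::
  "'a metric \<Rightarrow> ('a set \<Rightarrow> ennreal) \<Rightarrow> real \<Rightarrow> 'a set \<Rightarrow> ('a \<Rightarrow> ereal) \<Rightarrow> ('a \<Rightarrow> ereal) \<Rightarrow> ereal" where
  "F_functional m \<mu> s \<Omega> u v =
     ereal_integral (meas m \<mu>) \<Omega>
       (\<lambda>y. ereal_integral (meas m \<mu>) \<Omega> (\<lambda>x. F_integrand m \<mu> s u v x y)) +
     2 * ereal_integral (meas m \<mu>) \<Omega>
       (\<lambda>y. ereal_integral (meas m \<mu>) (mspace m - \<Omega>) (\<lambda>x. F_integrand m \<mu> s u v x y))"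

definition subminimizer ::
  "'a metric \<Rightarrow> ('a set \<Rightarrow> ennreal) \<Rightarrow> real \<Rightarrow> 'a set \<Rightarrow> ('a \<Rightarrow> ereal) \<Rightarrow> bool" where
  "subminimizer m \<mu> s \<Omega> u \<longleftrightarrow>
     u \<in> borel_measurable (meas m \<mu>) \<and> u \<in> dot_Ws1 m \<mu> s \<Omega> \<and>
     (\<forall>\<eta> \<in> Ws1_0 m \<mu> s \<Omega>. (\<forall>x \<in> mspace m. \<eta> x \<le> 0) \<longrightarrow>
        F_functional m \<mu> s \<Omega> u (\<lambda>x. u x + \<eta> x) \<le> 0)"

definition obstacle_class ::
  "'a metric \<Rightarrow> ('a set \<Rightarrow> ennreal) \<Rightarrow> real \<Rightarrow> 'a set \<Rightarrow> ('a \<Rightarrow> ereal) \<Rightarrow> ('a \<Rightarrow> ereal) \<Rightarrow> ('a \<Rightarrow> ereal) set"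
  where
  "obstacle_class m \<mu> s \<Omega> \<psi> f =
     {u \<in> dot_Ws1 m \<mu> s (mspace m).
        (AE x in meas m \<mu>. x \<in> \<Omega> \<longrightarrow> u x \<ge> \<psi> x) \<and>
        (AE x in meas m \<mu>. x \<in> mspace m - \<Omega> \<longrightarrow> u x = f x)}"

definition obstacle_solution ::
  "'a metric \<Rightarrow> ('a set \<Rightarrow> ennreal) \<Rightarrow> real \<Rightarrow> 'a set \<Rightarrow> ('a \<Rightarrow> ereal) \<Rightarrow> ('a \<Rightarrow> ereal) \<Rightarrow> ('a \<Rightarrow> ereal) \<Rightarrow> bool"
  where
  "obstacle_solution m \<mu> s \<Omega> \<psi> f u \<longleftrightarrow>
     u \<in> obstacle_class m \<mu> s \<Omega> \<psi> f \<and>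
     (\<forall>v \<in> obstacle_class m \<mu> s \<Omega> \<psi> f.
        seminorm_Ws1 m \<mu> s (mspace m) u \<le> seminorm_Ws1 m \<mu> s (mspace m) v)"

definition ess_sup_on ::
  "'a metric \<Rightarrow> ('a set \<Rightarrow> ennreal) \<Rightarrow> 'a set \<Rightarrow> ('a \<Rightarrow> ereal) \<Rightarrow> ereal" where
  "ess_sup_on m \<mu> A f = esssup (restrict_space (meas m \<mu>) A) f"

definition mean_pos_part ::
  "'a metric \<Rightarrow> ('a set \<Rightarrow> ennreal) \<Rightarrow> 'a set \<Rightarrow> ('a \<Rightarrow> ereal) \<Rightarrow> ennreal" where
  "mean_pos_part m \<mu> B f = (\<integral>\<^sup>+y\<in>B. e2ennreal (max (f y) 0) \<partial>meas m \<mu>) / \<mu> B"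

end

theory Submission
  imports Defs
begin

text \<open>
  De Giorgi iteration. Testing with \<open>- \<eta> * (u - k)\<^sub>+\<close> for a Lipschitz cutoff \<open>\<eta>\<close> bounds the
  fractional energy of \<open>\<Phi> = \<eta> * (u - k)\<^sub>+\<close> by \<open>C / (s * (1 - s))\<close> times a power of the width of the
  cutoff times the integral of \<open>(u - k)\<^sub>+\<close>. Conversely, if the support of \<open>\<Phi>\<close> fills at most half of
  every ball of radius \<open>\<rho>\<close> that it meets, then the integral of \<open>\<Phi>\<close> is at most
  \<open>K * (1 - s) * \<rho> powr s\<close> times its energy. Without a Poincare inequality this holds with
  \<open>K = 2 * C / (1 - s)\<close>, by looking only at pairs inside and outside the support. With it, \<open>K\<close> is
  independent of \<open>s\<close>: the Poincare inequality for averages of \<open>\<Phi>\<close> at scale \<open>\<epsilon>\<close> bounds the integral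
  of \<open>\<Phi>\<close> by \<open>\<rho> / \<epsilon>\<close> times the mean oscillation at scale \<open>\<epsilon>\<close>, and summing over dyadic \<open>\<epsilon> \<le> \<rho>\<close> gains
  the factor \<open>1 - s\<close>. The doubling dimension makes \<open>\<rho>\<close> small when the support is small, so that the
  two bounds together yield geometric decay of the integrals of \<open>(u - k)\<^sub>+\<close> along the iteration.
\<close>

section \<open>Doubling metric measure spaces\<close>

text \<open>The form \<open>(C3' / s) powr (Q / s)\<close> shapes the proof. It stays bounded as
  \<open>s\<close> tends to 1 although the cutoff costs \<open>1 / (1 - s)\<close>, so the opposite
  inequality must carry an explicit factor \<open>1 - s\<close>. No Sobolev exponent enters; each
  step gains because the next support is small, by Chebyshev between two levels. If consecutive
  radii differ by \<open>g\<close>, then \<open>\<rho> / g\<close> must be of order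
  \<open>A powr (- (1 / s))\<close> with \<open>A\<close> of order \<open>1 / s\<close>, so that
  \<open>(\<rho> / g) powr s\<close> beats the constants. Smallness of the support at scale
  \<open>\<rho>\<close> then asks for an initial mean of order \<open>(\<rho> / R) powr Q\<close>,
  whence the power \<open>Q / s\<close>. The gaps shrink like \<open>2 powr (- j)\<close>, so the
  volume available at scale \<open>\<rho>\<close> shrinks like \<open>2 powr (- Q * j)\<close>, and
  Chebyshev loses another \<open>2 ^ j\<close>; a decay by \<open>2 powr (- (Q + 1))\<close> per
  step balances both. A subminimizer is only known to have finite energy on \<open>\<Omega>\<close>;
  for it the energies of function and competitor are subtracted under the integral, never as
  integrals over the whole space.\<close>

locale doubling_mms =
  fixes m :: "'a metric" and \<mu> :: "'a set \<Rightarrow> ennreal" and C :: real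
  assumes mms: "metric_measure_space m \<mu>" and dbl: "doubling m \<mu> C"
begin

abbreviation X where "X \<equiv> mspace m"
abbreviation d where "d \<equiv> mdist m"
abbreviation B where "B \<equiv> mball_of m"
abbreviation N where "N \<equiv> meas m \<mu>"
abbreviation v where "v x r \<equiv> measure N (B x r)"

lemma caratheodory_meas: "measure_space X (lambda_system X (Pow X) \<mu>) \<mu>"
proof -
  interpret sigma_algebra X "Pow X" by (rule sigma_algebra_Pow)
  show ?thesis using mms caratheodory_lemma[of \<mu>] by (simp add: metric_measure_space_def)
qed

lemma space_N [simp]: "space N = X"
  unfolding meas_def by (rule space_measure_of) (auto simp: lambda_system_def)

lemma sets_N: "sets N = lambda_system X (Pow X) \<mu>"
proof -
  have s: "sigma_algebra X (lambda_system X (Pow X) \<mu>)"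
    using caratheodory_meas by (simp add: measure_space_def)
  show ?thesis unfolding meas_def
    by (subst sigma_algebra.sets_measure_of_eq[OF s]) simp
qed

lemma emeasure_N: "A \<in> sets N \<Longrightarrow> emeasure N A = \<mu> A"
  using caratheodory_meas unfolding sets_N unfolding meas_def measure_space_def
  by (auto intro!: emeasure_measure_of_sigma)

lemma sets_mborel_N: "sets (mborel m) \<subseteq> sets N"
  using mms by (simp add: metric_measure_space_def sets_N)

lemma space_mborel [simp]: "space (mborel m) = X"
  unfolding mborel_def by (rule space_measure_of) (use openin_subset in fastforce)

lemma sets_mborel_openin: "openin (mtopology_of m) U \<Longrightarrow> U \<in> sets (mborel m)"
  unfolding mborel_def by (subst sets_measure_of) (use openin_subset in fastforce)+

lemma sets_N_openin: "openin (mtopology_of m) U \<Longrightarrow> U \<in> sets N"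
  using sets_mborel_openin sets_mborel_N by blast

lemma openin_ball: "openin (mtopology_of m) (B x r)"
  by (simp add: Metric_space.openin_mball mball_of_def mtopology_of_def)

lemma ball_mborel [measurable]: "B x r \<in> sets (mborel m)"
  by (simp add: openin_ball sets_mborel_openin)

lemma ball_N [measurable]: "B x r \<in> sets N"
  by (simp add: openin_ball sets_N_openin)

lemma X_sets_N [measurable]: "X \<in> sets N"
  using sets.top[of N] by simp

text \<open>Two sigma-algebras coexist: \<open>upper_gradient\<close> asks for Borel measurability,
  while the functions of the theorem are only \<open>N\<close>-measurable. Composition with the
  identity turns the former into the latter.\<close>

lemma id_N_mborel: "(\<lambda>x. x) \<in> N \<rightarrow>\<^sub>M mborel m"
  using sets_mborel_N by (auto simp: measurable_def intro!: sets.Int)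

lemma C_pos: "C > 0" using dbl by (simp add: doubling_def)

lemma doublingD:
  assumes "x \<in> X" "0 < r"
  shows "0 < \<mu> (B x r)" "\<mu> (B x r) < \<infinity>" "\<mu> (B x (2 * r)) \<le> ennreal C * \<mu> (B x r)"
  using dbl assms unfolding doubling_def by blast+

lemma emeasure_ball: "x \<in> X \<Longrightarrow> 0 < r \<Longrightarrow> emeasure N (B x r) = ennreal (v x r)"
  using doublingD(2)[of x r] by (intro emeasure_eq_ennreal_measure) (auto simp: emeasure_N)

lemma ball_nonpos: "r \<le> 0 \<Longrightarrow> B x r = {}"
  by (auto simp: order.trans[OF _ mdist_nonneg] not_less) (meson leD mdist_nonneg order_less_le_trans)

lemma emeasure_ball': "x \<in> X \<Longrightarrow> emeasure N (B x r) = ennreal (v x r)"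
  by (cases "0 < r") (simp_all add: emeasure_ball ball_nonpos)

lemma v_pos: "x \<in> X \<Longrightarrow> 0 < r \<Longrightarrow> 0 < v x r"
  using doublingD(1)[of x r] emeasure_ball[of x r] by (auto simp: emeasure_N)

lemma finite_ball: "emeasure N (B x r) < \<infinity>"
proof (cases "x \<in> X")
  case False
  then have "B x r = {}" by auto
  then show ?thesis by simp
qed (simp add: emeasure_ball')

lemma fmeas_ball [simp]: "B x r \<in> fmeasurable N"
  using finite_ball by (auto intro: fmeasurableI)

lemma v_mono: "B x r \<subseteq> B y t \<Longrightarrow> v x r \<le> v y t"
  by (rule measure_mono_fmeasurable) auto

lemma ball_subset: "x \<in> X \<Longrightarrow> y \<in> X \<Longrightarrow> d x y + r \<le> t \<Longrightarrow> B x r \<subseteq> B y t"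
  by (auto) (smt (verit) mdist_commute mdist_triangle)

lemma v_le: "x \<in> X \<Longrightarrow> y \<in> X \<Longrightarrow> d x y + r \<le> t \<Longrightarrow> v x r \<le> v y t"
  by (intro v_mono ball_subset)

lemma v_double: assumes "x \<in> X" "0 < r" shows "v x (2 * r) \<le> C * v x r"
proof -
  have "ennreal (v x (2*r)) \<le> ennreal C * ennreal (v x r)"
    using doublingD(3)[of x r] assms emeasure_ball[of x r] emeasure_ball[of x "2*r"]
    by (simp add: emeasure_N)
  then show ?thesis using C_pos
    by (simp add: ennreal_mult[symmetric])
qed

lemma v_double_pow: assumes "x \<in> X" "0 < r" shows "v x (2 ^ n * r) \<le> C ^ n * v x r"
proof (induction n)
  case (Suc n)
  have "v x (2 ^ Suc n * r) \<le> C * v x (2 ^ n * r)"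
    using v_double[of x "2^n * r"] assms by (simp add: mult.assoc)
  also have "\<dots> \<le> C * (C ^ n * v x r)" using Suc C_pos by simp
  finally show ?case by (simp add: mult.assoc)
qed simp

lemma mms_nonempty: "X \<noteq> {}" using mms by (simp add: metric_measure_space_def)

lemma C_ge_1: "C \<ge> 1"
proof -
  obtain x where x: "x \<in> X" using mms_nonempty by auto
  have "v x 1 \<le> v x (2*1)" using x by (intro v_mono) auto
  also have "\<dots> \<le> C * v x 1" using x by (intro v_double) auto
  finally show ?thesis using v_pos[OF x, of 1] by simp
qed

text \<open>Most comparisons of balls with different centers reduce to this: \<open>n\<close> counts
  the doublings after which the ball around \<open>x\<close> contains the ball around
  \<open>y\<close>.\<close>

lemma v_doubling:
  assumes "x \<in> X" "y \<in> X" "0 < r" "d x y + t \<le> 2 ^ n * r"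
  shows "v y t \<le> C ^ n * v x r"
proof -
  have "v y t \<le> v x (2 ^ n * r)" using assms by (intro v_le) (auto simp: mdist_commute)
  also have "\<dots> \<le> C ^ n * v x r" using assms by (intro v_double_pow)
  finally show ?thesis .
qed

sublocale sigma_finite_measure N
proof
  obtain x where x: "x \<in> X" using mms_nonempty by auto
  have "\<exists>n::nat. d x y < real n" for y by (rule reals_Archimedean2)
  then have "(\<Union>n::nat. B x (real n)) = X"
    using x by auto
  then show "\<exists>A. countable A \<and> A \<subseteq> sets N \<and> \<Union>A = space N \<and> (\<forall>a\<in>A. emeasure N a \<noteq> \<infinity>)"
    using finite_ball by (intro exI[of _ "range (\<lambda>n::nat. B x (real n))"]) (auto simp: less_top)
qed

section \<open>Joint measurability of the distance and of ball measures\<close>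

lemma pair_sigma_finite_N: "pair_sigma_finite N N" ..

text \<open>Separability makes the sublevel sets of the distance countable unions of products of
  balls. This places them in the product sigma-algebra, not merely among the Borel sets of the
  product topology.\<close>

lemma borel_measurable_d_mborel: "(\<lambda>(x, y). d x y) \<in> borel_measurable (mborel m \<Otimes>\<^sub>M mborel m)"
proof (rule borel_measurableI_less)
  fix t :: real
  obtain D where D: "countable D" "D \<subseteq> X" "mtopology_of m closure_of D = X"
    using mms by (auto simp: metric_measure_space_def separable_space_def)
  have eq: "{p \<in> space (mborel m \<Otimes>\<^sub>M mborel m). (case p of (x, y) \<Rightarrow> d x y) < t} =
      (\<Union>z\<in>D. \<Union>q\<in>\<rat>. B z q \<times> B z (t - q))"
  proof (intro set_eqI iffI)
    fix p assume "p \<in> {p \<in> space (mborel m \<Otimes>\<^sub>M mborel m). (case p of (x, y) \<Rightarrow> d x y) < t}"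
    then obtain x y where p: "p = (x, y)" "x \<in> X" "y \<in> X" "d x y < t"
      by (auto simp: space_pair_measure)
    \<comment> \<open>A third of the slack: with \<open>d x z < e\<close> and
      \<open>e < q < 2 * e\<close> one gets
      \<open>d z y < e + d x y = t - 2 * e < t - q\<close>.\<close>
    define e where "e = (t - d x y) / 3"
    have e: "e > 0" using p by (simp add: e_def)
    have "x \<in> mtopology_of m closure_of D" using D p by simp
    then obtain z where z: "z \<in> D" "z \<in> B x e"
      using openin_ball[of x e] p e unfolding in_closure_of
      by (metis (no_types, lifting) in_mball_of mdist_zero)
    then have zX: "z \<in> X" "d x z < e" by auto
    obtain q where q: "q \<in> \<rat>" "e < q" "q < 2 * e" using Rats_dense_in_real[of e "2*e"] e by auto
    have "d z y \<le> d z x + d x y" using p zX by (intro mdist_triangle)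
    then have "d z y < t - q" using zX q by (simp add: mdist_commute e_def)
    moreover have "d z x < q" using zX q by (simp add: mdist_commute)
    ultimately show "p \<in> (\<Union>z\<in>D. \<Union>q\<in>\<rat>. B z q \<times> B z (t - q))"
      using p zX z(1) q(1) by auto
  next
    fix p assume "p \<in> (\<Union>z\<in>D. \<Union>q\<in>\<rat>. B z q \<times> B z (t - q))"
    then obtain x y z q where "p = (x, y)" "x \<in> X" "y \<in> X" "z \<in> X" "d z x < q" "d z y < t - q"
      by auto
    moreover then have "d x y \<le> d x z + d z y" by (intro mdist_triangle)
    ultimately show "p \<in> {p \<in> space (mborel m \<Otimes>\<^sub>M mborel m). (case p of (x, y) \<Rightarrow> d x y) < t}"
      by (auto simp: space_pair_measure mdist_commute)
  qed
  show "{p \<in> space (mborel m \<Otimes>\<^sub>M mborel m). (case p of (x, y) \<Rightarrow> d x y) < t} \<in> sets (mborel m \<Otimes>\<^sub>M mborel m)"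
    unfolding eq using D(1) countable_rat
    by (intro sets.countable_UN' pair_measureI ball_mborel) auto
qed

lemma measurable_d_mborel [measurable (raw)]:
  assumes "f \<in> M \<rightarrow>\<^sub>M mborel m" "g \<in> M \<rightarrow>\<^sub>M mborel m"
  shows "(\<lambda>x. d (f x) (g x)) \<in> borel_measurable M"
  using measurable_compose[OF measurable_Pair[OF assms] borel_measurable_d_mborel] by simp

lemma measurable_N_mborel: "f \<in> M \<rightarrow>\<^sub>M N \<Longrightarrow> f \<in> M \<rightarrow>\<^sub>M mborel m"
  using measurable_compose[OF _ id_N_mborel] by blast

lemma measurable_d [measurable (raw)]:
  assumes "f \<in> M \<rightarrow>\<^sub>M N" "g \<in> M \<rightarrow>\<^sub>M N"
  shows "(\<lambda>x. d (f x) (g x)) \<in> borel_measurable M"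
  using assms by (intro measurable_d_mborel measurable_N_mborel)

lemma measurable_d_mborel_N [measurable (raw)]:
  assumes "f \<in> M \<rightarrow>\<^sub>M mborel m" "g \<in> M \<rightarrow>\<^sub>M N"
  shows "(\<lambda>x. d (f x) (g x)) \<in> borel_measurable M"
  by (rule measurable_d_mborel[OF assms(1) measurable_N_mborel[OF assms(2)]])

lemma emeasure_ball_nn:
  assumes "x \<in> X" shows "emeasure N (B x r) = (\<integral>\<^sup>+y. (if d x y < r then 1 else 0) \<partial>N)"
proof -
  have "emeasure N (B x r) = (\<integral>\<^sup>+y. indicator (B x r) y \<partial>N)" by simp
  also have "\<dots> = (\<integral>\<^sup>+y. (if d x y < r then 1 else 0) \<partial>N)"
    using assms by (intro nn_integral_cong) (auto simp: indicator_def)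
  finally show ?thesis .
qed

text \<open>As an integral in the second variable of a jointly measurable function, the measure of a
  ball depends measurably on its center. The kernel is treated in the same way.\<close>

lemma borel_measurable_v [measurable]: "(\<lambda>x. v x r) \<in> borel_measurable (mborel m)"
proof -
  have "(\<lambda>x. \<integral>\<^sup>+y. (if d x y < r then 1 else 0) \<partial>N) \<in> borel_measurable (mborel m)"
    by measurable
  then have "(\<lambda>x. enn2real (\<integral>\<^sup>+y. (if d x y < r then 1 else 0) \<partial>N)) \<in> borel_measurable (mborel m)"
    by measurable
  then show ?thesis
    by (rule measurable_cong[THEN iffD1, rotated]) (simp add: emeasure_ball_nn[symmetric] measure_def)
qed

lemma borel_measurable_v_N [measurable]: "(\<lambda>x. v x r) \<in> borel_measurable N"
  using measurable_compose[OF id_N_mborel borel_measurable_v] by simp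

section \<open>The kernel of the fractional seminorm\<close>

definition kern :: "real \<Rightarrow> 'a \<Rightarrow> 'a \<Rightarrow> real" where
  "kern s x y = measure N (B x (d x y) \<union> B y (d x y)) * d x y powr s"

lemma kernel_eq: "x \<in> X \<Longrightarrow> y \<in> X \<Longrightarrow> kernel m \<mu> s x y = ennreal (kern s x y)"
  unfolding kernel_def kern_def
  by (subst emeasure_N[symmetric], measurable, subst emeasure_eq_ennreal_measure)
     (auto simp: ennreal_mult fmeasurableD2 fmeasurable.Un)

lemma kern_sym: "kern s x y = kern s y x"
  by (simp add: kern_def mdist_commute Un_commute)

lemma kern_nonneg [simp]: "0 \<le> kern s x y" by (simp add: kern_def)

lemma kern_diag: "x \<in> X \<Longrightarrow> kern s x x = 0" by (simp add: kern_def)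

text \<open>Together with \<open>kern_le\<close> and doubling, this makes the kernel comparable to
  \<open>v x (d x y) * d x y powr s\<close>, so that the union of two balls never has to be handled
  again.\<close>

lemma kern_ge: "v x (d x y) * d x y powr s \<le> kern s x y"
  unfolding kern_def by (intro mult_right_mono measure_mono_fmeasurable fmeasurable.Un) auto

lemma kern_le: "x \<in> X \<Longrightarrow> y \<in> X \<Longrightarrow> kern s x y \<le> v x (2 * d x y) * d x y powr s"
  unfolding kern_def
  by (intro mult_right_mono measure_mono_fmeasurable fmeasurable.Un)
     (auto, smt (verit) mdist_triangle mdist_nonneg, smt (verit) mdist_triangle mdist_nonneg)

lemma kern_pos: assumes "x \<in> X" "y \<in> X" "x \<noteq> y" shows "0 < kern s x y"
proof -
  have "0 < d x y" using assms by (metis mdist_nonneg mdist_zero order_le_less)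
  then show ?thesis using kern_ge[of x y s] v_pos[OF assms(1), of "d x y"]
    by (smt (verit) mult_pos_pos powr_gt_zero)
qed

lemma borel_measurable_kern: "(\<lambda>p. kern s (fst p) (snd p)) \<in> borel_measurable (N \<Otimes>\<^sub>M N)"
proof -
  have "(\<lambda>p. enn2real (\<integral>\<^sup>+z. (if d (fst p) z < d (fst p) (snd p) \<or> d (snd p) z < d (fst p) (snd p) then 1 else 0) \<partial>N)
       * d (fst p) (snd p) powr s) \<in> borel_measurable (N \<Otimes>\<^sub>M N)"
    by measurable
  then show ?thesis
  proof (rule measurable_cong[THEN iffD1, rotated])
    fix p assume "p \<in> space (N \<Otimes>\<^sub>M N)"
    then have p: "fst p \<in> X" "snd p \<in> X" by (auto simp: space_pair_measure)
    have "emeasure N (B (fst p) (d (fst p) (snd p)) \<union> B (snd p) (d (fst p) (snd p)))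
      = (\<integral>\<^sup>+z. (if d (fst p) z < d (fst p) (snd p) \<or> d (snd p) z < d (fst p) (snd p) then 1 else 0) \<partial>N)"
      (is "emeasure N ?U = ?r")
    proof -
      have "emeasure N ?U = (\<integral>\<^sup>+y. indicator ?U y \<partial>N)" by simp
      also have "\<dots> = ?r"
        using p by (intro nn_integral_cong) (auto simp: indicator_def)
      finally show ?thesis .
    qed
    then show "enn2real (\<integral>\<^sup>+z. (if d (fst p) z < d (fst p) (snd p) \<or> d (snd p) z < d (fst p) (snd p) then 1 else 0) \<partial>N)
       * d (fst p) (snd p) powr s = kern s (fst p) (snd p)"
      by (simp add: kern_def measure_def)
  qed
qed

lemma measurable_kern [measurable (raw)]:
  assumes "f \<in> M \<rightarrow>\<^sub>M N" "g \<in> M \<rightarrow>\<^sub>M N"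
  shows "(\<lambda>x. kern s (f x) (g x)) \<in> borel_measurable M"
  using measurable_compose[OF measurable_Pair[OF assms] borel_measurable_kern] by simp

end

section \<open>Curve length and upper gradients\<close>

lemma sum_le_curve_length:
  assumes "\<And>i. i \<le> n \<Longrightarrow> t i \<in> {a..b}" "\<And>i. i < n \<Longrightarrow> t i \<le> t (Suc i)"
  shows "(\<Sum>i<n. ennreal (mdist m (\<gamma> (t i)) (\<gamma> (t (Suc i))))) \<le> curve_length m \<gamma> a b"
  unfolding curve_length_def using assms by (intro SUP_upper2[of "(n, t)"]) auto

lemma curve_length_leI:
  assumes "\<And>n t. (\<And>i. i \<le> n \<Longrightarrow> t i \<in> {a..b}) \<Longrightarrow> (\<And>i. i < n \<Longrightarrow> t i \<le> t (Suc i)) \<Longrightarrow>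
    (\<Sum>i<n. ennreal (mdist m (\<gamma> (t i)) (\<gamma> (t (Suc i))))) \<le> K"
  shows "curve_length m \<gamma> a b \<le> K"
  unfolding curve_length_def using assms by (auto intro!: SUP_least)

lemma mdist_le_curve_length:
  assumes "a \<le> b" shows "ennreal (mdist m (\<gamma> a) (\<gamma> b)) \<le> curve_length m \<gamma> a b"
  using sum_le_curve_length[of 1 "\<lambda>i. if i = 0 then a else b" a b m \<gamma>] assms by auto

lemma sum_lessThan_add: "(\<Sum>i<k + l. f i) = (\<Sum>i<k. f i) + (\<Sum>i<l. f (k + i))"
  for f :: "nat \<Rightarrow> ennreal"
  by (induction l) (simp_all add: add.assoc)

lemma curve_length_superadditive:
  assumes "a \<le> b" "b \<le> c"
  shows "curve_length m \<gamma> a b + curve_length m \<gamma> b c \<le> curve_length m \<gamma> a c"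
proof -
  define S where "S a b = {(n::nat, t::nat \<Rightarrow> real). (\<forall>i\<le>n. t i \<in> {a..b}) \<and> (\<forall>i<n. t i \<le> t (Suc i))}" for a b
  define F where "F = (\<lambda>(n::nat, t::nat \<Rightarrow> real). \<Sum>i<n. ennreal (mdist m (\<gamma> (t i)) (\<gamma> (t (Suc i)))))"
  have cl: "curve_length m \<gamma> a b = (SUP p\<in>S a b. F p)" for a b
    by (simp add: curve_length_def S_def F_def case_prod_beta)
  have ne: "S a b \<noteq> {}" "S b c \<noteq> {}"
    using assms by (auto simp: S_def intro!: exI[of _ 0] exI[of _ "\<lambda>_. b"])
  have key: "F p + F q \<le> curve_length m \<gamma> a c" if "p \<in> S a b" "q \<in> S b c" for p q
  proof -
    obtain n t k u where pq: "p = (n, t)" "q = (k, u)" by (metis surj_pair)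
    have t: "\<And>i. i \<le> n \<Longrightarrow> a \<le> t i \<and> t i \<le> b" "\<And>i. i < n \<Longrightarrow> t i \<le> t (Suc i)"
      and u: "\<And>i. i \<le> k \<Longrightarrow> b \<le> u i \<and> u i \<le> c" "\<And>i. i < k \<Longrightarrow> u i \<le> u (Suc i)"
      using that by (auto simp: S_def pq)
    \<comment> \<open>The concatenation keeps both ends of the junction: index \<open>n\<close> is
      the last point of \<open>t\<close>, index \<open>Suc n\<close> the first point of
      \<open>u\<close>. The step between them adds a nonnegative term, which the estimate below may
      include for free.\<close>
    define w where "w i = (if i \<le> n then t i else u (i - Suc n))" for i
    define f where "f i = ennreal (mdist m (\<gamma> (w i)) (\<gamma> (w (Suc i))))" for i
    have w1: "w i \<in> {a..c}" if "i \<le> Suc n + k" for i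
      using t(1)[of i] u(1)[of "i - Suc n"] that assms by (force simp: w_def)
    have w2: "w i \<le> w (Suc i)" if "i < Suc n + k" for i
    proof -
      consider "i < n" | "i = n" | "i > n" by linarith
      then show ?thesis
      proof cases
        case 3
        then have "Suc i - Suc n = Suc (i - Suc n)" by simp
        then show ?thesis using 3 u(2)[of "i - Suc n"] that by (auto simp: w_def)
      qed (use t[of i] u(1)[of 0] in \<open>auto simp: w_def\<close>)
    qed
    have "F p + F q = (\<Sum>i<n. f i) + (\<Sum>i<k. f (Suc n + i))"
      by (auto simp: F_def pq f_def w_def intro!: arg_cong2[where f="(+)"] sum.cong)
    also have "\<dots> \<le> (\<Sum>i<Suc n. f i) + (\<Sum>i<k. f (Suc n + i))"
      by (intro add_right_mono sum_mono2) auto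
    also have "\<dots> = (\<Sum>i<Suc n + k. f i)" by (rule sum_lessThan_add[symmetric])
    also have "\<dots> \<le> curve_length m \<gamma> a c"
      unfolding f_def using w1 w2 by (intro sum_le_curve_length) auto
    finally show ?thesis .
  qed
  have "(SUP p\<in>S a b. F p) + (SUP q\<in>S b c. F q) = (SUP q\<in>S b c. SUP p\<in>S a b. F p + F q)"
    using ne by (simp add: ennreal_SUP_add_right ennreal_SUP_add_left)
  also have "\<dots> \<le> curve_length m \<gamma> a c" using key by (intro SUP_least) auto
  finally show ?thesis unfolding cl .
qed

text \<open>Instead of inserting \<open>b\<close> into a partition, all its points are clipped at
  \<open>b\<close> from above and from below. Only the step that crosses \<open>b\<close> needs the
  triangle inequality, and this requires the curve to stay in \<open>mspace m\<close>.\<close>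

lemma curve_length_subadditive:
  assumes "a \<le> b" "b \<le> c" "\<gamma> \<in> {a..c} \<rightarrow> mspace m"
  shows "curve_length m \<gamma> a c \<le> curve_length m \<gamma> a b + curve_length m \<gamma> b c"
proof (rule curve_length_leI)
  fix n and t :: "nat \<Rightarrow> real"
  assume t: "\<And>i. i \<le> n \<Longrightarrow> t i \<in> {a..c}" "\<And>i. i < n \<Longrightarrow> t i \<le> t (Suc i)"
  define f where "f u i = ennreal (mdist m (\<gamma> (u i)) (\<gamma> (u (Suc i))))" for u :: "nat \<Rightarrow> real" and i
  have "f t i \<le> f (\<lambda>i. min (t i) b) i + f (\<lambda>i. max (t i) b) i" if "i < n" for i
  proof -
    have X: "\<gamma> (t i) \<in> mspace m" "\<gamma> (t (Suc i)) \<in> mspace m" "\<gamma> b \<in> mspace m"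
      using t(1)[of i] t(1)[of "Suc i"] that assms by auto
    show ?thesis using t(2)[of i] that mdist_triangle[of "\<gamma> (t i)" m "\<gamma> b" "\<gamma> (t (Suc i))"] X
      by (auto simp: f_def min_def max_def ennreal_plus[symmetric] simp del: ennreal_plus intro!: ennreal_leI)
  qed
  then have "(\<Sum>i<n. f t i) \<le> (\<Sum>i<n. f (\<lambda>i. min (t i) b) i) + (\<Sum>i<n. f (\<lambda>i. max (t i) b) i)"
    unfolding sum.distrib[symmetric] by (intro sum_mono) auto
  also have "\<dots> \<le> curve_length m \<gamma> a b + curve_length m \<gamma> b c"
    unfolding f_def using t assms by (intro add_mono sum_le_curve_length) (force simp: min_def max_def)+
  finally show "(\<Sum>i<n. ennreal (mdist m (\<gamma> (t i)) (\<gamma> (t (Suc i))))) \<le> curve_length m \<gamma> a b + curve_length m \<gamma> b c"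
    by (simp add: f_def)
qed

lemma curve_length_mono:
  assumes "a \<le> a'" "b' \<le> b" shows "curve_length m \<gamma> a' b' \<le> curve_length m \<gamma> a b"
  using assms by (intro curve_length_leI sum_le_curve_length) force+

lemma continuous_on_mdist_path:
  assumes "pathin (mtopology_of m) \<gamma>"
    and "continuous_on {0..1} f" "f \<in> {0..1} \<rightarrow> {0..1}" "continuous_on {0..1} g" "g \<in> {0..1} \<rightarrow> {0..1::real}"
  shows "continuous_on {0..1} (\<lambda>s. mdist m (\<gamma> (f s)) (\<gamma> (g s)))"
proof -
  have "continuous_map (top_of_set {0..1}) (mtopology_of m) (\<gamma> \<circ> f)"
    "continuous_map (top_of_set {0..1}) (mtopology_of m) (\<gamma> \<circ> g)"
    using assms by (auto simp: pathin_def intro!: continuous_map_compose[where X'="top_of_set {0..1}"])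
  from continuous_map_mdist[OF this] show ?thesis by simp
qed

text \<open>A partition that witnesses a length above \<open>K\<close> can be clamped to the moving
  interval; its sum then varies continuously with the end point and stays above \<open>K\<close>
  nearby. Both end points are needed to obtain continuity afterwards.\<close>

lemma curve_length_lower_semicontinuous:
  assumes \<gamma>: "pathin (mtopology_of m) \<gamma>" and x: "x \<in> {0..1}"
  shows "K < curve_length m \<gamma> 0 x \<Longrightarrow> \<forall>\<^sub>F s in at x within {0..1}. K < curve_length m \<gamma> 0 s"
    and "K < curve_length m \<gamma> x 1 \<Longrightarrow> \<forall>\<^sub>F s in at x within {0..1}. K < curve_length m \<gamma> s 1"
proof -
  have *: "\<forall>\<^sub>F s in at x within {0..1}. K < curve_length m \<gamma> (a s) (b s)"
    if K: "K < curve_length m \<gamma> (a x) (b x)" and 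
      c: "\<And>y. continuous_on {0..1} (\<lambda>s. max (a s) (min (b s) y))"
      and ab: "\<And>s. s \<in> {0..1} \<Longrightarrow> 0 \<le> a s \<and> a s \<le> b s \<and> b s \<le> 1" for a b :: "real \<Rightarrow> real"
  proof -
    obtain n t where t: "\<And>i. i \<le> n \<Longrightarrow> t i \<in> {a x..b x}" "\<And>i. i < n \<Longrightarrow> t i \<le> t (Suc i)"
      and Kt: "K < (\<Sum>i<n. ennreal (mdist m (\<gamma> (t i)) (\<gamma> (t (Suc i)))))"
      using K unfolding curve_length_def less_SUP_iff by auto
    define u where "u s i = max (a s) (min (b s) (t i))" for s i
    define f where "f s = (\<Sum>i<n. mdist m (\<gamma> (u s i)) (\<gamma> (u s (Suc i))))" for s
    have u01: "u s i \<in> {0..1}" if "s \<in> {0..1}" for s i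
      using ab[OF that] by (simp add: u_def max_def min_def)
    have "continuous_on {0..1} f"
      unfolding f_def
    proof (intro continuous_on_sum continuous_on_mdist_path[OF \<gamma>])
      fix i show "continuous_on {0..1} (\<lambda>s. u s i)" "continuous_on {0..1} (\<lambda>s. u s (Suc i))"
        unfolding u_def by (rule c)+
      show "(\<lambda>s. u s i) \<in> {0..1} \<rightarrow> {0..1}" "(\<lambda>s. u s (Suc i)) \<in> {0..1} \<rightarrow> {0..1}"
        using u01 by blast+
    qed
    then have lim: "((\<lambda>s. ennreal (f s)) \<longlongrightarrow> ennreal (f x)) (at x within {0..1})"
      using x by (intro tendsto_ennrealI) (auto simp: continuous_on_def)
    have "u x i = t i" if "i \<le> n" for i using t(1)[OF that] by (auto simp: u_def)
    then have "ennreal (f x) = (\<Sum>i<n. ennreal (mdist m (\<gamma> (t i)) (\<gamma> (t (Suc i)))))"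
      by (auto simp: f_def sum_ennreal[symmetric] simp del: sum_ennreal)
    then have "\<forall>\<^sub>F s in at x within {0..1}. K < ennreal (f s)"
      using order_tendstoD(1)[OF lim] Kt by simp
    moreover have "\<forall>\<^sub>F s in at x within {0..1}. s \<in> {0..1}"
      by (auto simp: eventually_at_filter)
    ultimately show ?thesis
    proof eventually_elim
      case (elim s)
      have "u s i \<in> {a s..b s}" for i using ab[OF elim(2)] by (auto simp: u_def)
      moreover have "u s i \<le> u s (Suc i)" if "i < n" for i
        using t(2)[OF that] by (auto simp: u_def)
      ultimately have "ennreal (f s) \<le> curve_length m \<gamma> (a s) (b s)"
        unfolding f_def by (simp add: sum_ennreal[symmetric] sum_le_curve_length del: sum_ennreal)
      with elim show ?case by simp
    qed
  qed
  show "K < curve_length m \<gamma> 0 x \<Longrightarrow> \<forall>\<^sub>F s in at x within {0..1}. K < curve_length m \<gamma> 0 s"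
    by (rule *) (auto intro!: continuous_intros)
  show "K < curve_length m \<gamma> x 1 \<Longrightarrow> \<forall>\<^sub>F s in at x within {0..1}. K < curve_length m \<gamma> s 1"
    by (rule *) (auto intro!: continuous_intros)
qed

lemma pathin_in_mspace: "pathin (mtopology_of m) \<gamma> \<Longrightarrow> t \<in> {0..1} \<Longrightarrow> \<gamma> t \<in> mspace m"
  by (auto simp: pathin_def continuous_map_def Pi_iff)

text \<open>The lengths of the initial and of the final piece are both lower semicontinuous and add
  up to the constant total length, so the first is upper semicontinuous as well.\<close>

lemma continuous_on_curve_length:
  assumes "rectifiable m \<gamma>"
  shows "continuous_on {0..1} (\<lambda>s. enn2real (curve_length m \<gamma> 0 s))"
proof -
  have \<gamma>: "pathin (mtopology_of m) \<gamma>" and fin: "curve_length m \<gamma> 0 1 < \<infinity>"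
    using assms by (auto simp: rectifiable_def)
  define L R where "L s = enn2real (curve_length m \<gamma> 0 s)" and "R s = enn2real (curve_length m \<gamma> s 1)" for s
  have fin': "curve_length m \<gamma> 0 s < \<infinity>" "curve_length m \<gamma> s 1 < \<infinity>" if "s \<in> {0..1}" for s
    using that curve_length_mono[of 0 0 s 1 m \<gamma>] curve_length_mono[of 0 s 1 1 m \<gamma>] fin
    by (auto elim: le_less_trans)
  have L: "curve_length m \<gamma> 0 s = ennreal (L s)" "curve_length m \<gamma> s 1 = ennreal (R s)" if "s \<in> {0..1}" for s
    using fin'[OF that] by (auto simp: L_def R_def less_top)
  have nonneg [simp]: "0 \<le> L s" "0 \<le> R s" for s by (auto simp: L_def R_def)
  have LR: "L s + R s = L 1" if s: "s \<in> {0..1}" for s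
  proof -
    have "curve_length m \<gamma> 0 s + curve_length m \<gamma> s 1 = curve_length m \<gamma> 0 1"
      using s pathin_in_mspace[OF \<gamma>]
      by (intro antisym curve_length_superadditive curve_length_subadditive) auto
    then show ?thesis using s L[OF s] L(1)[of 1]
      by (simp add: ennreal_plus[symmetric] del: ennreal_plus)
  qed
  have "(L \<longlongrightarrow> L x) (at x within {0..1})" if x: "x \<in> {0..1}" for x
  proof (rule order_tendstoI)
    have ev: "\<forall>\<^sub>F s in at x within {0..1}. s \<in> {0..1}"
      by (auto simp: eventually_at_filter)
    fix a assume a: "a < L x"
    show "\<forall>\<^sub>F s in at x within {0..1}. a < L s"
    proof (cases "a < 0")
      case True then have "a < L s" for s using nonneg(1)[of s] by linarith
      then show ?thesis by simp
    next
      case False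
      then have "ennreal a < curve_length m \<gamma> 0 x" using a x by (simp add: L ennreal_less_iff)
      from curve_length_lower_semicontinuous(1)[OF \<gamma> x this] ev show ?thesis
        by eventually_elim (use False in \<open>simp add: L ennreal_less_iff\<close>)
    qed
  next
    have ev: "\<forall>\<^sub>F s in at x within {0..1}. s \<in> {0..1}"
      by (auto simp: eventually_at_filter)
    fix a assume a: "L x < a"
    show "\<forall>\<^sub>F s in at x within {0..1}. L s < a"
    proof (cases "L 1 < a")
      case True
      from ev show ?thesis by eventually_elim (use True LR nonneg in \<open>smt (verit)\<close>)
    next
      case False
      then have "ennreal (L 1 - a) < curve_length m \<gamma> x 1" using a x LR[OF x] by (simp add: L ennreal_less_iff)
      from curve_length_lower_semicontinuous(2)[OF \<gamma> x this] ev show ?thesis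
        by eventually_elim (use False LR in \<open>fastforce simp add: L ennreal_less_iff\<close>)
    qed
  qed
  then show ?thesis unfolding L_def[symmetric] continuous_on_def by blast
qed

text \<open>The choice in \<open>arc_length_param\<close> has a witness by the intermediate value
  theorem. It is immaterial which one is taken: the distance of two curve points is at most the
  difference of their arc lengths, so points of equal arc length coincide.\<close>

lemma arc_length_param:
  assumes "rectifiable m \<gamma>"
  defines "len \<equiv> enn2real (curve_length m \<gamma> 0 1)"
  shows "\<tau> \<in> {0..len} \<Longrightarrow> arc_length_param m \<gamma> \<tau> \<in> mspace m"
    and "\<lbrakk>0 \<le> \<sigma>; \<sigma> \<le> \<tau>; \<tau> \<le> len\<rbrakk> \<Longrightarrow>
      mdist m (arc_length_param m \<gamma> \<sigma>) (arc_length_param m \<gamma> \<tau>) \<le> \<tau> - \<sigma>"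
    and "arc_length_param m \<gamma> 0 = \<gamma> 0" and "arc_length_param m \<gamma> len = \<gamma> 1"
proof -
  have \<gamma>: "pathin (mtopology_of m) \<gamma>" and fin: "curve_length m \<gamma> 0 1 < \<infinity>"
    using assms(1) by (auto simp: rectifiable_def)
  note X = pathin_in_mspace[OF \<gamma>]
  define L where "L s = enn2real (curve_length m \<gamma> 0 s)" for s
  have L: "curve_length m \<gamma> 0 s = ennreal (L s)" if "s \<in> {0..1}" for s
    using that curve_length_mono[of 0 0 s 1 m \<gamma>] fin by (auto simp: L_def intro!: ennreal_enn2real[symmetric] elim: le_less_trans)
  have nonneg [simp]: "0 \<le> L s" for s by (auto simp: L_def)
  have dL: "mdist m (\<gamma> s) (\<gamma> t) \<le> L t - L s" if "0 \<le> s" "s \<le> t" "t \<le> 1" for s t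
  proof -
    have "ennreal (L s + mdist m (\<gamma> s) (\<gamma> t)) = ennreal (L s) + ennreal (mdist m (\<gamma> s) (\<gamma> t))" by simp
    also have "\<dots> \<le> curve_length m \<gamma> 0 s + curve_length m \<gamma> s t"
      using that by (intro add_mono mdist_le_curve_length) (auto simp: L)
    also have "\<dots> \<le> curve_length m \<gamma> 0 t" using that by (intro curve_length_superadditive)
    also have "\<dots> = ennreal (L t)" using that by (simp add: L)
    finally show ?thesis by (simp del: ennreal_plus)
  qed
  have L0: "L 0 = 0"
  proof -
    have "curve_length m \<gamma> 0 0 \<le> 0"
    proof (rule curve_length_leI)
      fix n and t :: "nat \<Rightarrow> real" assume t: "\<And>i. i \<le> n \<Longrightarrow> t i \<in> {0..0}"
      have "mdist m (\<gamma> (t i)) (\<gamma> (t (Suc i))) = 0" if "i < n" for i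
        using t[of i] t[of "Suc i"] that X[of 0] by simp
      then show "(\<Sum>i<n. ennreal (mdist m (\<gamma> (t i)) (\<gamma> (t (Suc i))))) \<le> 0" by simp
    qed
    then show ?thesis by (simp add: L_def)
  qed
  have ex: "\<exists>t. t \<in> {0..1} \<and> curve_length m \<gamma> 0 t = ennreal \<tau>" if "0 \<le> \<tau>" "\<tau> \<le> len" for \<tau>
  proof -
    have "\<exists>t\<ge>0. t \<le> 1 \<and> L t = \<tau>"
      using that continuous_on_curve_length[OF assms(1)] L0
      by (intro IVT') (auto simp: L_def len_def)
    then show ?thesis using L by auto
  qed
  define T where "T \<tau> = (SOME t. t \<in> {0..1} \<and> curve_length m \<gamma> 0 t = ennreal \<tau>)" for \<tau>
  have arc: "arc_length_param m \<gamma> \<tau> = \<gamma> (T \<tau>)" for \<tau> by (simp add: arc_length_param_def T_def)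
  have T: "T \<tau> \<in> {0..1}" "L (T \<tau>) = \<tau>" if "0 \<le> \<tau>" "\<tau> \<le> len" for \<tau>
    using someI_ex[OF ex[OF that]] that unfolding T_def[symmetric] by (auto simp: L)
  show "arc_length_param m \<gamma> \<tau> \<in> mspace m" if "\<tau> \<in> {0..len}" for \<tau>
    using T that X by (auto simp: arc)
  \<comment> \<open>The points are ordered by arc length rather than by parameter, since
    \<open>T\<close> comes from arbitrary choices. If the two orders disagree, the length between
    the points is 0.\<close>
  have lip: "mdist m (\<gamma> s) (\<gamma> t) \<le> L t - L s" if "s \<in> {0..1}" "t \<in> {0..1}" "L s \<le> L t" for s t
  proof (cases "s \<le> t")
    case False
    then have "mdist m (\<gamma> s) (\<gamma> t) \<le> L s - L t" using dL[of t s] that by (simp add: mdist_commute)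
    then show ?thesis using that(3) mdist_nonneg[of m "\<gamma> s" "\<gamma> t"] by linarith
  qed (use dL that in auto)
  show "mdist m (arc_length_param m \<gamma> \<sigma>) (arc_length_param m \<gamma> \<tau>) \<le> \<tau> - \<sigma>"
    if "0 \<le> \<sigma>" "\<sigma> \<le> \<tau>" "\<tau> \<le> len" for \<sigma> \<tau>
    using lip[of "T \<sigma>" "T \<tau>"] T[of \<sigma>] T[of \<tau>] that by (simp add: arc)
  have l0: "0 \<le> len" by (simp add: len_def)
  have eq: "\<gamma> (T (L t)) = \<gamma> t" if "t \<in> {0..1}" for t
  proof -
    have "L t \<le> len" using dL[of t 1] that by (simp add: len_def L_def) (smt (verit) mdist_nonneg)
    then have "mdist m (\<gamma> (T (L t))) (\<gamma> t) \<le> 0" and "T (L t) \<in> {0..1}"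
      using lip[of "T (L t)" t] T[of "L t"] that by auto
    then show ?thesis using X that by (metis antisym mdist_nonneg mdist_zero)
  qed
  show "arc_length_param m \<gamma> 0 = \<gamma> 0" using eq[of 0] by (simp add: arc L0)
  show "arc_length_param m \<gamma> len = \<gamma> 1" using eq[of 1] by (simp add: arc L_def len_def)
qed

text \<open>Cutting a curve into pieces shorter than \<open>\<epsilon>\<close> reduces the claim to a constant integrand on each piece.\<close>

lemma upper_gradient_local_Lipschitz:
  assumes g: "g \<in> borel_measurable (mborel m)" and "\<epsilon> > 0"
    and loc: "\<And>x y p. \<lbrakk>x \<in> mspace m; y \<in> mspace m; p \<in> mspace m; mdist m x y < \<epsilon>; mdist m p x < \<epsilon>\<rbrakk> \<Longrightarrow>
      ennreal \<bar>u x - u y\<bar> \<le> ennreal (mdist m x y) * g p"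
  shows "upper_gradient m u g"
  unfolding upper_gradient_def
proof (intro conjI allI impI g)
  fix \<gamma> assume rect: "rectifiable m \<gamma>"
  define len where "len = enn2real (curve_length m \<gamma> 0 1)"
  define a where "a = arc_length_param m \<gamma>"
  note arc = arc_length_param[OF rect, folded len_def a_def]
  show "ennreal \<bar>u (\<gamma> 0) - u (\<gamma> 1)\<bar> \<le> curve_integral m \<gamma> g"
  proof (cases "len = 0")
    case True
    then have "\<gamma> 0 = \<gamma> 1" using arc(3,4) by metis
    then show ?thesis by simp
  next
    case False
    then have l: "len > 0" by (simp add: len_def less_le)
    \<comment> \<open>The number of pieces makes each of them shorter than
      \<open>\<epsilon>\<close>, so that \<open>loc\<close> applies to its end points together with
      any point of the piece.\<close>
    obtain n :: nat where "len / \<epsilon> < real n" using reals_Archimedean2 by blast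
    with l \<open>\<epsilon> > 0\<close> have n: "n > 0" "len / real n < \<epsilon>"
      by (auto simp: field_simps intro!: Nat.gr0I)
        (metis \<open>0 < \<epsilon>\<close> divide_less_eq gr0I less_divide_eq mult.commute mult_zero_right not_less_iff_gr_or_eq of_nat_0 of_nat_0_less_iff)
    define h where "h = len / real n"
    have h: "h > 0" "real n * h = len" using l n by (auto simp: h_def)
    have ih: "0 \<le> real i * h" "real i * h \<le> len" if "i \<le> n" for i
      using that h mult_right_mono[of "real i" "real n" h] by auto
    define c where "c i = \<bar>u (a (real i * h)) - u (a (real (Suc i) * h))\<bar>" for i
    have piece: "ennreal (c i / h) \<le> g (a \<tau>)"
      if "i < n" "real i * h < \<tau>" "\<tau> < real (Suc i) * h" for i \<tau>
    proof -
      let ?x = "a (real i * h)" and ?y = "a (real (Suc i) * h)"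
      have ss: "real (Suc i) * h = real i * h + h" by (simp add: algebra_simps)
      have ranges: "0 \<le> real i * h" "real (Suc i) * h \<le> len" using ih[of i] ih[of "Suc i"] that(1) by auto
      have "real i * h \<le> real (Suc i) * h" using h(1) ss by linarith
      from arc(2)[OF ranges(1) this ranges(2)] have dxy: "mdist m ?x ?y \<le> h"
        using ss by linarith
      have "\<tau> \<le> len" using that(3) ranges by linarith
      from arc(2)[OF ranges(1) less_imp_le[OF that(2)] this]
      have dx: "mdist m (a \<tau>) ?x \<le> h" using that(3) ss mdist_commute[of m "a \<tau>" ?x] by linarith
      have hn: "h < \<epsilon>" using n by (simp add: h_def)
      have "real i * h \<in> {0..len}" "real (Suc i) * h \<in> {0..len}" "\<tau> \<in> {0..len}"
        using ranges ss h(1) that(2,3) unfolding atLeastAtMost_iff by linarith+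
      from loc[OF arc(1)[OF this(1)] arc(1)[OF this(2)] arc(1)[OF this(3)]
        le_less_trans[OF dxy hn] le_less_trans[OF dx hn]]
      have "ennreal (c i) \<le> ennreal (mdist m ?x ?y) * g (a \<tau>)"
        unfolding c_def .
      also have "\<dots> \<le> ennreal h * g (a \<tau>)" using dxy by (intro mult_right_mono ennreal_leI) auto
      finally have "ennreal (1/h) * ennreal (c i) \<le> ennreal (1/h) * (ennreal h * g (a \<tau>))"
        by (intro mult_left_mono) auto
      also have "\<dots> = g (a \<tau>)" using h by (simp add: mult.assoc[symmetric] ennreal_mult[symmetric])
      finally show ?thesis using h by (simp add: ennreal_mult[symmetric] c_def)
    qed
    have "\<bar>u (\<gamma> 0) - u (\<gamma> 1)\<bar> = \<bar>u (a (real 0 * h)) - u (a (real n * h))\<bar>"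
      using arc(3,4) h by simp
    also have "\<dots> = \<bar>\<Sum>i<n. (u (a (real i * h)) - u (a (real (Suc i) * h)))\<bar>"
      by (subst sum_lessThan_telescope') simp
    also have "\<dots> \<le> (\<Sum>i<n. c i)" unfolding c_def by (rule sum_abs)
    finally have "ennreal \<bar>u (\<gamma> 0) - u (\<gamma> 1)\<bar> \<le> ennreal (\<Sum>i<n. c i)" by (rule ennreal_leI)
    \<comment> \<open>Each increment is the integral of its own slope over its piece. Open intervals
      keep the pieces disjoint, so at most one summand is nonzero at any
      \<open>\<tau>\<close>.\<close>
    also have "\<dots> = (\<Sum>i<n. \<integral>\<^sup>+\<tau>. ennreal (c i / h) * indicator {real i * h<..<real (Suc i) * h} \<tau> \<partial>lborel)"
    proof -
      have "(\<integral>\<^sup>+\<tau>. ennreal (c i / h) * indicator {real i * h<..<real (Suc i) * h} \<tau> \<partial>lborel) = ennreal (c i)" for i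
      proof -
        have "emeasure lborel {real i * h<..<real (Suc i) * h} = ennreal h"
          using h by (subst emeasure_lborel_Ioo) (auto simp: algebra_simps)
        then show ?thesis using h
          by (simp add: nn_integral_cmult_indicator ennreal_mult[symmetric] c_def)
      qed
      then show ?thesis by (simp add: c_def)
    qed
    also have "\<dots> = (\<integral>\<^sup>+\<tau>. (\<Sum>i<n. ennreal (c i / h) * indicator {real i * h<..<real (Suc i) * h} \<tau>) \<partial>lborel)"
      by (subst nn_integral_sum) auto
    also have "\<dots> \<le> curve_integral m \<gamma> g"
      unfolding curve_integral_def a_def[symmetric] len_def[symmetric]
    proof (rule nn_integral_mono)
      fix \<tau> :: real
      show "(\<Sum>i<n. ennreal (c i / h) * indicator {real i * h<..<real (Suc i) * h} \<tau>) \<le> g (a \<tau>) * indicator {0..len} \<tau>"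
      proof (cases "\<exists>i<n. \<tau> \<in> {real i * h<..<real (Suc i) * h}")
        case True
        then obtain i where i: "i < n" "real i * h < \<tau>" "\<tau> < real (Suc i) * h" by auto
        have "j = i" if "real j * h < \<tau>" "\<tau> < real (Suc j) * h" for j
        proof -
          have "real j * h < real (Suc i) * h" "real i * h < real (Suc j) * h" using that i by linarith+
          then have "j < Suc i" "i < Suc j" using h by (simp_all only: mult_less_cancel_right_pos of_nat_less_iff)
          then show ?thesis by simp
        qed
        then have "real j * h < \<tau> \<and> \<tau> < real (Suc j) * h \<longleftrightarrow> j = i" for j
          using i(2,3) by blast
        then have ind: "indicator {real j * h<..<real (Suc j) * h} \<tau> = (if j = i then 1 else 0 :: ennreal)" for j
          by (simp only: indicator_def greaterThanLessThan_iff of_bool_def)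
        have "(\<Sum>j<n. ennreal (c j / h) * indicator {real j * h<..<real (Suc j) * h} \<tau>) =
          (\<Sum>j<n. if j = i then ennreal (c i / h) else 0)"
          unfolding ind by (intro sum.cong) auto
        also have "\<dots> = ennreal (c i / h)" using i by simp
        also have "\<dots> \<le> g (a \<tau>)" using piece i by blast
        also have "\<dots> = g (a \<tau>) * indicator {0..len} \<tau>"
          using order.trans[OF ih(1)[of i] less_imp_le[OF i(2)]]
            order.trans[OF less_imp_le[OF i(3)] ih(2)[of "Suc i"]] i(1) by simp
        finally show ?thesis .
      next
        case False
        then have "(\<Sum>i<n. ennreal (c i / h) * indicator {real i * h<..<real (Suc i) * h} \<tau>) = 0"
          by (intro sum.neutral) (auto simp: indicator_def)
        then show ?thesis by simp
      qed
    qed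
    finally show ?thesis .
  qed
qed

section \<open>Tail of the kernel and functions of small support\<close>

text \<open>Convexity: \<open>2 powr (- s)\<close> lies below its chord between \<open>s = 0\<close>
  and \<open>s = 1\<close>. This turns the denominators of the geometric series below into multiples
  of \<open>s\<close> or \<open>1 - s\<close>.\<close>

lemma one_minus_two_powr_ge:
  fixes s :: real assumes "0 \<le> s" "s \<le> 1" shows "s / 2 \<le> 1 - 2 powr (-s)"
proof -
  have "(1/2) powr s * 1 powr (1 - s) \<le> s * (1/2) + (1 - s) * (1::real)"
    using assms by (intro Youngs_inequality_0) auto
  then show ?thesis by (simp add: powr_minus powr_divide field_simps)
qed

text \<open>The tangent bound in the other direction. It serves to bound the sum of the scales
  \<open>\<rho> / 2 ^ i\<close> to the power \<open>1 - s\<close> from below by a multiple of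
  \<open>1 / (1 - s)\<close>.\<close>

lemma one_minus_two_powr_le: "1 - 2 powr (-s) \<le> s" if "0 \<le> s" for s :: real
proof -
  have "1 + - s * ln 2 \<le> exp (- s * ln 2)" by (rule exp_ge_add_one_self)
  moreover have "s * ln 2 \<le> s * 1" using that ln_le_minus_one[of 2] by (intro mult_left_mono) auto
  ultimately show ?thesis by (simp add: powr_def)
qed

lemma suminf_ennreal_geometric:
  assumes "0 < s" "0 \<le> K"
  shows "(\<Sum>i. ennreal (K * 2 powr (- s * real i))) = ennreal (K / (1 - 2 powr (- s)))"
proof -
  have eq: "2 powr (- s * real i) = (2 powr (- s)) ^ i" for i
    by (simp add: powr_realpow[symmetric] powr_powr)
  have "2 powr (- s) < 1" using assms powr_less_cancel_iff[of 2 "-s" 0] by simp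
  then have "(\<lambda>i. K * 2 powr (- s * real i)) sums (K * (1 / (1 - 2 powr (- s))))"
    unfolding eq by (intro sums_mult geometric_sums) auto
  then show ?thesis using assms by (intro suminf_ennreal_eq) auto
qed

lemma ex_dyadic_up:
  assumes "(t::real) \<ge> 1" shows "\<exists>i::nat. 2 ^ i \<le> t \<and> t < 2 ^ Suc i"
proof -
  have ex: "\<exists>i::nat. t < 2 ^ i" by (rule real_arch_pow) simp
  define k where "k = (LEAST i::nat. t < 2 ^ i)"
  have k: "t < 2 ^ k" unfolding k_def using ex by (rule LeastI_ex)
  with assms have "k \<noteq> 0" by (intro notI) simp
  then obtain i where i: "k = Suc i" using not0_implies_Suc by blast
  have "\<not> t < 2 ^ i" using not_less_Least[of i "\<lambda>i. t < 2 ^ i"] i by (simp add: k_def)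
  with k i show ?thesis by (intro exI[of _ i]) auto
qed

lemma ex_dyadic_down:
  assumes "(t::real) < 1" "0 < t" shows "\<exists>i::nat. (1/2) ^ Suc i \<le> t \<and> t < (1/2) ^ i"
proof -
  obtain n where n: "(1/2) ^ n < t" using real_arch_pow_inv[of t "1/2"] assms by auto
  have ex: "\<exists>i::nat. (1/2) ^ i \<le> t" using n by (auto intro: less_imp_le)
  define k where "k = (LEAST i::nat. (1/2) ^ i \<le> t)"
  have k: "(1/2) ^ k \<le> t" unfolding k_def using ex by (rule LeastI_ex)
  with assms have "k \<noteq> 0" by (intro notI) simp
  then obtain i where i: "k = Suc i" using not0_implies_Suc by blast
  have "\<not> (1/2) ^ i \<le> t" using not_less_Least[of i "\<lambda>i. (1/2) ^ i \<le> t"] i by (simp add: k_def)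
  with k i show ?thesis by (intro exI[of _ i]) auto
qed

lemma suminf_ge_term: "f i \<le> (\<Sum>i. f i)" for f :: "nat \<Rightarrow> ennreal"
  using sum_le_suminf[of f "{i}"] by simp

context doubling_mms
begin

lemma d_self [simp]: "x \<in> X \<Longrightarrow> d x x = 0" by simp

definition energy :: "real \<Rightarrow> ('a \<Rightarrow> real) \<Rightarrow> ennreal" where
  "energy s \<Phi> = (\<integral>\<^sup>+x. \<integral>\<^sup>+y. ennreal (\<bar>\<Phi> x - \<Phi> y\<bar> / kern s x y) \<partial>N \<partial>N)"

text \<open>Dyadic annuli; the near part contributes \<open>1 / (1 - s)\<close> and the far part \<open>1 / s\<close>.\<close>

lemma kernel_tail:
  assumes x: "x \<in> X" and s: "0 < s" "s < 1" and \<delta>: "0 < \<delta>"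
  shows "(\<integral>\<^sup>+y. ennreal (min (d x y / \<delta>) 1 / kern s x y) \<partial>N) \<le> ennreal (4 * C / (s * (1 - s)) * \<delta> powr (-s))"
proof -
  define r where "r i = 2 ^ i * \<delta>" for i :: nat
  define q where "q i = (1/2) ^ i * \<delta>" for i :: nat
  have rq: "r i > 0" "q i > 0" for i using \<delta> by (auto simp: r_def q_def)
  \<comment> \<open>On the annulus between \<open>r i\<close> and \<open>r (Suc i)\<close> the
    kernel is at least \<open>v x (r i) * r i powr s\<close>; enlarging the annulus to a ball costs
    one doubling, and the volumes cancel. \<open>G\<close> does the same below
    \<open>\<delta>\<close>, where the numerator is at most \<open>(1/2) ^ i\<close>.\<close>
  define F where "F i y = ennreal (1 / (v x (r i) * r i powr s)) * indicator (B x (r (Suc i))) y" for i y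
  define G where "G i y = ennreal ((1/2) ^ i / (v x (q (Suc i)) * q (Suc i) powr s)) * indicator (B x (q i)) y" for i y
  have kern: "v x t * t powr s \<le> kern s x y" if "t \<le> d x y" "0 < t" for t y
  proof -
    have "v x t * t powr s \<le> v x (d x y) * d x y powr s"
      using that x s by (intro mult_mono v_le powr_mono2) auto
    also have "\<dots> \<le> kern s x y" by (rule kern_ge)
    finally show ?thesis .
  qed
  have pt: "ennreal (min (d x y / \<delta>) 1 / kern s x y) \<le> (\<Sum>i. F i y) + (\<Sum>i. G i y)" if y: "y \<in> X" for y
  proof (cases "y = x")
    case True
    then show ?thesis using x by (simp add: kern_diag)
  next
    case False
    then have d0: "d x y > 0" using x y by (metis mdist_nonneg mdist_zero order_le_less)
    show ?thesis
    proof (cases "d x y \<ge> \<delta>")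
      case True
      then obtain i where i: "2 ^ i \<le> d x y / \<delta>" "d x y / \<delta> < 2 ^ Suc i"
        using ex_dyadic_up[of "d x y / \<delta>"] \<delta> by auto
      then have i': "r i \<le> d x y" "d x y < r (Suc i)" using \<delta> by (auto simp: r_def field_simps)
      have "min (d x y / \<delta>) 1 / kern s x y \<le> 1 / (v x (r i) * r i powr s)"
        using kern[OF i'(1)] rq[of i] v_pos[OF x, of "r i"] \<delta> d0
        by (intro frac_le) (auto simp: field_simps)
      then have "ennreal (min (d x y / \<delta>) 1 / kern s x y) \<le> F i y"
        using i' x y by (auto simp: F_def intro!: ennreal_leI)
      also have "\<dots> \<le> (\<Sum>i. F i y)" by (rule suminf_ge_term)
      finally show ?thesis by (simp add: add_increasing2)
    next
      case False
      then obtain i where i: "(1/2) ^ Suc i \<le> d x y / \<delta>" "d x y / \<delta> < (1/2) ^ i"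
        using ex_dyadic_down[of "d x y / \<delta>"] \<delta> d0 by auto
      then have i': "q (Suc i) \<le> d x y" "d x y < q i" using \<delta> by (auto simp: q_def field_simps)
      have "min (d x y / \<delta>) 1 / kern s x y \<le> (1/2)^i / (v x (q (Suc i)) * q (Suc i) powr s)"
        using kern[OF i'(1)] rq(2)[of "Suc i"] v_pos[OF x, of "q (Suc i)"] \<delta> d0 i(2)
        by (intro frac_le) (auto simp: min_le_iff_disj)
      then have "ennreal (min (d x y / \<delta>) 1 / kern s x y) \<le> G i y"
        using i' x y by (auto simp: G_def intro!: ennreal_leI)
      also have "\<dots> \<le> (\<Sum>i. G i y)" by (rule suminf_ge_term)
      finally show ?thesis by (simp add: add_increasing)
    qed
  qed
  have F: "(\<integral>\<^sup>+y. F i y \<partial>N) \<le> ennreal (C * \<delta> powr (-s) * 2 powr (- s * real i))" for i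
  proof -
    have "(\<integral>\<^sup>+y. F i y \<partial>N) = ennreal (1 / (v x (r i) * r i powr s) * v x (r (Suc i)))"
      using x rq[of i] unfolding F_def
      by (subst nn_integral_cmult_indicator) (simp_all add: emeasure_ball' ennreal_mult[symmetric])
    also have "\<dots> \<le> ennreal (1 / (v x (r i) * r i powr s) * (C * v x (r i)))"
      using v_double[OF x rq(1)[of i]] rq[of i] by (intro ennreal_leI mult_left_mono) (auto simp: r_def mult.assoc)
    also have "1 / (v x (r i) * r i powr s) * (C * v x (r i)) = C * r i powr (-s)"
      using v_pos[OF x rq(1)[of i]] rq[of i] by (simp add: powr_minus field_simps)
    also have "r i powr (-s) = \<delta> powr (-s) * 2 powr (- s * real i)"
      using \<delta> by (simp add: r_def powr_mult powr_realpow[symmetric] powr_powr mult.commute)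
    finally show ?thesis by (simp add: mult.assoc)
  qed
  have G: "(\<integral>\<^sup>+y. G i y \<partial>N) \<le> ennreal (2 * C * \<delta> powr (-s) * 2 powr (- (1 - s) * real i))" for i
  proof -
    have "(\<integral>\<^sup>+y. G i y \<partial>N) = ennreal ((1/2)^i / (v x (q (Suc i)) * q (Suc i) powr s) * v x (q i))"
      using x rq(2)[of "Suc i"] unfolding G_def
      by (subst nn_integral_cmult_indicator) (simp_all add: emeasure_ball' ennreal_mult[symmetric])
    also have "\<dots> \<le> ennreal ((1/2)^i / (v x (q (Suc i)) * q (Suc i) powr s) * (C * v x (q (Suc i))))"
      using v_double[OF x rq(2)[of "Suc i"]] rq(2)[of "Suc i"] by (intro ennreal_leI mult_left_mono) (auto simp: q_def)
    also have "(1/2)^i / (v x (q (Suc i)) * q (Suc i) powr s) * (C * v x (q (Suc i))) = C * (1/2)^i * q (Suc i) powr (-s)"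
      using v_pos[OF x rq(2)[of "Suc i"]] rq(2)[of "Suc i"] by (simp add: powr_minus field_simps)
    also have "q (Suc i) powr (-s) = 2 powr s * \<delta> powr (-s) * 2 powr (s * real i)"
    proof -
      have "q (Suc i) = 2 powr (- real (Suc i)) * \<delta>"
        by (simp add: q_def powr_minus powr_realpow[of 2 "Suc i"] power_divide inverse_eq_divide del: of_nat_Suc)
      then have "q (Suc i) powr (-s) = 2 powr (s * real (Suc i)) * \<delta> powr (-s)"
        using \<delta> by (simp add: powr_mult powr_powr algebra_simps)
      then show ?thesis by (simp add: algebra_simps powr_add)
    qed
    also have "C * (1/2)^i * (2 powr s * \<delta> powr (-s) * 2 powr (s * real i)) = 2 powr s * (C * \<delta> powr (-s) * 2 powr (- (1 - s) * real i))"
    proof -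
      have "(1/2::real)^i = 2 powr (- real i)"
        by (simp add: powr_minus powr_realpow power_divide inverse_eq_divide)
      then have "(1/2::real)^i * 2 powr (s * real i) = 2 powr (- (1 - s) * real i)"
        by (simp add: powr_add[symmetric] algebra_simps)
      then show ?thesis by (simp add: algebra_simps)
    qed
    also have "\<dots> \<le> 2 * (C * \<delta> powr (-s) * 2 powr (- (1 - s) * real i))"
      using C_pos s powr_mono[of s 1 2] by (intro mult_right_mono) auto
    finally show ?thesis by (simp add: mult.assoc ennreal_leI)
  qed
  have "(\<integral>\<^sup>+y. ennreal (min (d x y / \<delta>) 1 / kern s x y) \<partial>N) \<le> (\<integral>\<^sup>+y. (\<Sum>i. F i y) + (\<Sum>i. G i y) \<partial>N)"
    using pt by (intro nn_integral_mono) auto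
  also have "\<dots> = (\<Sum>i. \<integral>\<^sup>+y. F i y \<partial>N) + (\<Sum>i. \<integral>\<^sup>+y. G i y \<partial>N)"
    unfolding F_def G_def by (subst nn_integral_add, measurable) (simp add: nn_integral_suminf)
  also have "\<dots> \<le> (\<Sum>i. ennreal (C * \<delta> powr (-s) * 2 powr (- s * real i))) +
      (\<Sum>i. ennreal (2 * C * \<delta> powr (-s) * 2 powr (- (1 - s) * real i)))"
    using F G by (intro add_mono suminf_le) auto
  also have "\<dots> = ennreal (C * \<delta> powr (-s) / (1 - 2 powr (-s))) + ennreal (2 * C * \<delta> powr (-s) / (1 - 2 powr (-(1 - s))))"
    using s C_pos by (intro arg_cong2[where f="(+)"] suminf_ennreal_geometric) auto
  also have "\<dots> \<le> ennreal (C * \<delta> powr (-s) / (s / 2)) + ennreal (2 * C * \<delta> powr (-s) / ((1 - s) / 2))"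
    using s C_pos one_minus_two_powr_ge[of s] one_minus_two_powr_ge[of "1 - s"]
    by (intro add_mono ennreal_leI divide_left_mono mult_pos_pos) auto
  also have "\<dots> = ennreal (C * \<delta> powr (-s) / (s / 2) + 2 * C * \<delta> powr (-s) / ((1 - s) / 2))"
    using s C_pos by simp
  also have "\<dots> \<le> ennreal (4 * C / (s * (1 - s)) * \<delta> powr (-s))"
  proof (rule ennreal_leI)
    \<comment> \<open>Over the common denominator the two contributions have the coefficient
      \<open>2 * (1 - s) + 4 * s\<close>, which is at most 4.\<close>
    have "C * \<delta> powr (-s) / (s / 2) + 2 * C * \<delta> powr (-s) / ((1 - s) / 2) = (2 * (1 - s) + 4 * s) * (C * \<delta> powr (-s)) / (s * (1 - s))"
      using s by (simp add: field_simps)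
    also have "\<dots> \<le> 4 * (C * \<delta> powr (-s)) / (s * (1 - s))"
      using s C_pos by (intro divide_right_mono mult_right_mono) auto
    finally show "C * \<delta> powr (-s) / (s / 2) + 2 * C * \<delta> powr (-s) / ((1 - s) / 2) \<le> 4 * C / (s * (1 - s)) * \<delta> powr (-s)"
      by simp
  qed
  finally show ?thesis .
qed

text \<open>The pairs in \<open>S \<times> (X - S)\<close>, where \<open>S\<close> is the support, already suffice.\<close>

lemma small_support_ineq:
  assumes \<Phi> [measurable]: "\<Phi> \<in> borel_measurable N" and "\<And>x. x \<in> X \<Longrightarrow> 0 \<le> \<Phi> x"
    and \<rho>: "0 < \<rho>" and s: "0 < s"
    and small: "\<And>x. x \<in> X \<Longrightarrow> B x \<rho> \<inter> {x \<in> X. 0 < \<Phi> x} \<noteq> {} \<Longrightarrow>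
      2 * emeasure N {x \<in> X. 0 < \<Phi> x} \<le> emeasure N (B x \<rho>)"
  shows "(\<integral>\<^sup>+x. ennreal (\<Phi> x) \<partial>N) \<le> ennreal (2 * C * \<rho> powr s) * energy s \<Phi>"
proof -
  define S where "S = {x \<in> X. 0 < \<Phi> x}"
  have [measurable]: "S \<in> sets N" unfolding S_def by measurable
  have pt: "ennreal (\<Phi> x) \<le> ennreal (2 * C * \<rho> powr s) * (\<integral>\<^sup>+y. ennreal (\<bar>\<Phi> x - \<Phi> y\<bar> / kern s x y) \<partial>N)"
    if x: "x \<in> X" for x
  proof (cases "x \<in> S")
    case False
    then have "\<Phi> x = 0" using x assms(2)[of x] by (auto simp: S_def)
    then show ?thesis by simp
  next
    case True
    have "2 * emeasure N S \<le> emeasure N (B x \<rho>)"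
      using small[OF x] True x \<rho> d_self[OF x] unfolding S_def disjoint_iff by fastforce
    then have S2: "2 * emeasure N S \<le> ennreal (v x \<rho>)" using x by (simp add: emeasure_ball')
    have "emeasure N S \<le> 2 * emeasure N S" by (simp add: mult_2)
    then have "emeasure N S < \<infinity>" using S2 by (metis ennreal_less_top infinity_ennreal_def le_less_trans order_trans)
    then have fS: "S \<in> fmeasurable N" by (intro fmeasurableI) auto
    then have mS: "2 * measure N S \<le> v x \<rho>"
      using S2 by (simp add: emeasure_eq_measure2 ennreal_mult[symmetric] flip: ennreal_numeral)
    have "v x \<rho> \<le> measure N (B x \<rho> - S) + measure N S"
      using fS by (intro order.trans[OF measure_mono_fmeasurable measure_Un_le]) (auto intro: fmeasurable.Un fmeasurable.Diff)
    then have half: "v x \<rho> / 2 \<le> measure N (B x \<rho> - S)" using mS by simp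
    \<comment> \<open>A lower bound of the integrand on \<open>B x \<rho> - S\<close>: there
      \<open>\<Phi> y = 0\<close>, and the kernel is at most
      \<open>C * v x \<rho> * \<rho> powr s\<close>. As this set has at least half the measure of
      the ball, the volume cancels and the constant becomes \<open>2 * C\<close>.\<close>
    define c where "c = \<Phi> x / (C * v x \<rho> * \<rho> powr s)"
    have vp: "v x \<rho> > 0" using x \<rho> by (rule v_pos)
    have c: "0 \<le> c" using True vp C_pos by (auto simp: c_def S_def)
    have "ennreal (\<Phi> x) = ennreal (2 * C * \<rho> powr s) * (ennreal c * ennreal (v x \<rho> / 2))"
      using C_pos vp \<rho> True c by (simp add: ennreal_mult[symmetric] c_def S_def)
    also have "\<dots> \<le> ennreal (2 * C * \<rho> powr s) * (ennreal c * emeasure N (B x \<rho> - S))"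
      using half fS by (intro mult_left_mono) (auto simp: emeasure_eq_measure2 fmeasurable.Diff intro!: ennreal_leI)
    also have "ennreal c * emeasure N (B x \<rho> - S) = (\<integral>\<^sup>+y. ennreal c * indicator (B x \<rho> - S) y \<partial>N)"
      by (subst nn_integral_cmult_indicator) auto
    also have "\<dots> \<le> (\<integral>\<^sup>+y. ennreal (\<bar>\<Phi> x - \<Phi> y\<bar> / kern s x y) \<partial>N)"
    proof (rule nn_integral_mono)
      fix y assume "y \<in> space N" then have y: "y \<in> X" by simp
      show "ennreal c * indicator (B x \<rho> - S) y \<le> ennreal (\<bar>\<Phi> x - \<Phi> y\<bar> / kern s x y)"
      proof (cases "y \<in> B x \<rho> - S")
        case T: True
        then have y0: "\<Phi> y = 0" "d x y < \<rho>" using assms(2)[of y] by (auto simp: S_def)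
        have "y \<noteq> x" using T True by auto
        then have kp: "0 < kern s x y" using x y by (intro kern_pos) auto
        have "kern s x y \<le> v x (2 * d x y) * d x y powr s" using x y by (rule kern_le)
        also have "\<dots> \<le> (C * v x \<rho>) * \<rho> powr s"
          using x y0 s \<rho> C_pos by (intro mult_mono powr_mono2 order.trans[OF v_le v_double]) auto
        finally have "c \<le> \<bar>\<Phi> x - \<Phi> y\<bar> / kern s x y"
          unfolding c_def using kp y0 by (intro frac_le) auto
        then show ?thesis using T by (auto intro!: ennreal_leI)
      qed simp
    qed
    finally show ?thesis by (simp add: mult_left_mono)
  qed
  have "(\<integral>\<^sup>+x. ennreal (\<Phi> x) \<partial>N) \<le> (\<integral>\<^sup>+x. ennreal (2 * C * \<rho> powr s) * (\<integral>\<^sup>+y. ennreal (\<bar>\<Phi> x - \<Phi> y\<bar> / kern s x y) \<partial>N) \<partial>N)"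
    using pt by (intro nn_integral_mono) auto
  also have "\<dots> = ennreal (2 * C * \<rho> powr s) * energy s \<Phi>"
    unfolding energy_def by (rule nn_integral_cmult) measurable
  finally show ?thesis .
qed


section \<open>Averages with a Lipschitz weight\<close>

lemma d_triangle: "x \<in> X \<Longrightarrow> y \<in> X \<Longrightarrow> z \<in> X \<Longrightarrow> d x z \<le> d x y + d y z"
  by (rule mdist_triangle)

lemma nn_integral_swap:
  assumes "(\<lambda>(x, y). f x y) \<in> borel_measurable (N \<Otimes>\<^sub>M N)"
  shows "(\<integral>\<^sup>+y. \<integral>\<^sup>+x. f x y \<partial>N \<partial>N) = (\<integral>\<^sup>+x. \<integral>\<^sup>+y. f x y \<partial>N \<partial>N)"
proof -
  interpret P: pair_sigma_finite N N by (rule pair_sigma_finite_N)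
  show ?thesis using assms by (rule P.Fubini')
qed

lemma nn_integral_ball:
  assumes "x \<in> X"
  shows "(\<integral>\<^sup>+z. (if d x z < r then c else 0) \<partial>N) = c * ennreal (v x r)"
proof -
  have "(\<integral>\<^sup>+z. (if d x z < r then c else 0) \<partial>N) = (\<integral>\<^sup>+z. c * indicator (B x r) z \<partial>N)"
    using assms by (intro nn_integral_cong) (auto simp: indicator_def)
  also have "\<dots> = c * ennreal (v x r)"
    using assms by (subst nn_integral_cmult_indicator) (auto simp: emeasure_ball')
  finally show ?thesis .
qed

text \<open>The plain mean over a ball may jump with its center. A tent function as weight makes the
  average locally Lipschitz, so that an upper gradient can be written down explicitly.\<close>

definition bump :: "real \<Rightarrow> 'a \<Rightarrow> 'a \<Rightarrow> real" where
  "bump e x z = max 0 (1 - d x z / e)"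

definition mass :: "real \<Rightarrow> 'a \<Rightarrow> real" where
  "mass e x = (\<integral>z. bump e x z \<partial>N)"

definition smooth :: "real \<Rightarrow> ('a \<Rightarrow> real) \<Rightarrow> 'a \<Rightarrow> real" where
  "smooth e \<Phi> x = (\<integral>z. bump e x z * \<Phi> z \<partial>N) / mass e x"

lemma measurable_bump [measurable (raw)]:
  assumes "f \<in> M \<rightarrow>\<^sub>M N" "g \<in> M \<rightarrow>\<^sub>M N"
  shows "(\<lambda>x. bump e (f x) (g x)) \<in> borel_measurable M"
  unfolding bump_def using assms by measurable

lemma measurable_bump2 [measurable (raw)]:
  assumes "x \<in> X" "g \<in> M \<rightarrow>\<^sub>M N"
  shows "(\<lambda>z. bump e x (g z)) \<in> borel_measurable M"
  using assms by (intro measurable_bump) auto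

lemma bump_bounds: "0 \<le> bump e x z" "e > 0 \<Longrightarrow> bump e x z \<le> 1"
  by (auto simp: bump_def divide_nonneg_pos)

lemma bump_zero: "e > 0 \<Longrightarrow> e \<le> d x z \<Longrightarrow> bump e x z = 0"
  by (simp add: bump_def)

lemma bump_diff:
  assumes "e > 0" "x \<in> X" "y \<in> X" "z \<in> X"
  shows "\<bar>bump e x z - bump e y z\<bar> \<le> d x y / e"
proof -
  have "\<bar>d x z - d y z\<bar> \<le> d x y"
    using d_triangle[of x y z] d_triangle[of y x z] assms by (auto simp: mdist_commute)
  then have "\<bar>d x z / e - d y z / e\<bar> \<le> d x y / e"
    using assms by (simp add: diff_divide_distrib[symmetric] divide_right_mono)
  then show ?thesis unfolding bump_def by linarith
qed

lemma integrable_ball: "x \<in> X \<Longrightarrow> integrable N (\<lambda>z. indicator (B x r) z :: real)"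
  using finite_ball by (intro integrable_real_indicator) auto

lemma integral_ball: "(\<integral>z. indicator (B x r) z \<partial>N) = v x r"
proof -
  have "B x r \<inter> X = B x r" by auto
  then show ?thesis by simp
qed

lemma bump_le_indicator: "e > 0 \<Longrightarrow> x \<in> X \<Longrightarrow> z \<in> X \<Longrightarrow> bump e x z \<le> indicator (B x e) z"
  by (cases "d x z < e") (auto simp: bump_bounds bump_zero)

lemma integrable_bump:
  assumes "e > 0" "x \<in> X" shows "integrable N (bump e x)"
proof (rule Bochner_Integration.integrable_bound[OF integrable_ball[OF assms(2), of e]])
  show "bump e x \<in> borel_measurable N" using assms by measurable
  show "AE z in N. norm (bump e x z) \<le> norm (indicator (B x e) z :: real)"
    using bump_le_indicator[OF assms] by (intro AE_I2) (simp add: bump_bounds)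
qed

text \<open>The tent is at least 1 / 2 on the ball of radius \<open>e / 2\<close>, and two doublings
  lead from there to \<open>2 * e\<close>.\<close>

lemma mass_ge:
  assumes e: "e > 0" and x: "x \<in> X" shows "v x (2 * e) \<le> 2 * C ^ 2 * mass e x"
proof -
  have "v x (e / 2) / 2 = (\<integral>z. indicator (B x (e / 2)) z / 2 \<partial>N)"
    by (simp only: integral_ball integral_divide_zero)
  also have "\<dots> \<le> mass e x" unfolding mass_def
  proof (rule integral_mono)
    fix z assume "z \<in> space N"
    show "indicator (B x (e / 2)) z / 2 \<le> bump e x z"
    proof (cases "d x z < e / 2")
      case True
      then have "d x z / e \<le> 1 / 2" using e by (simp add: field_simps)
      then have "1 / 2 \<le> bump e x z" unfolding bump_def by linarith
      then show ?thesis by (simp add: indicator_def)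
    qed (auto simp: bump_bounds)
  qed (use integrable_bump integrable_ball assms in auto)
  finally have "v x (e / 2) \<le> 2 * mass e x" by simp
  moreover have "v x (2 * e) \<le> C ^ 2 * v x (e / 2)"
    using assms by (intro v_doubling) auto
  ultimately show ?thesis using mult_left_mono[of "v x (e/2)" "2 * mass e x" "C^2"] by simp
qed

lemma mass_pos: "e > 0 \<Longrightarrow> x \<in> X \<Longrightarrow> 0 < mass e x"
  using mass_ge[of e x] v_pos[of x "2*e"] C_pos
  by (smt (verit) zero_less_mult_iff zero_less_power)

lemma mass_diff:
  assumes e: "e > 0" and xy: "x \<in> X" "y \<in> X" "d x y < e"
  shows "\<bar>mass e x - mass e y\<bar> \<le> d x y / e * v x (2 * e)"
    and "z \<in> X \<Longrightarrow> \<bar>bump e x z - bump e y z\<bar> \<le> d x y / e * indicator (B x (2 * e)) z"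
proof -
  have *: "\<bar>bump e x z - bump e y z\<bar> \<le> d x y / e * indicator (B x (2 * e)) z" if "z \<in> X" for z
  proof (cases "d x z < 2 * e")
    case True
    then show ?thesis using bump_diff[OF e xy(1,2) that] xy that by simp
  next
    case False
    then have "e \<le> d x z" "e \<le> d y z" using e xy that d_triangle[of x y z] by auto
    then show ?thesis using e by (simp add: bump_zero)
  qed
  then show "z \<in> X \<Longrightarrow> \<bar>bump e x z - bump e y z\<bar> \<le> d x y / e * indicator (B x (2 * e)) z" .
  have "\<bar>mass e x - mass e y\<bar> = \<bar>\<integral>z. bump e x z - bump e y z \<partial>N\<bar>"
    unfolding mass_def using integrable_bump e xy by simp
  also have "\<dots> \<le> (\<integral>z. d x y / e * indicator (B x (2 * e)) z \<partial>N)"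
    using * integrable_bump[OF e] integrable_ball xy
    by (intro order.trans[OF integral_abs_bound] integral_mono) auto
  also have "\<dots> = d x y / e * v x (2 * e)" by (simp only: integral_ball integral_mult_right_zero)
  finally show "\<bar>mass e x - mass e y\<bar> \<le> d x y / e * v x (2 * e)" .
qed

text \<open>The quotient rule: the change of the numerator and the change of the normalization are
  estimated separately. \<open>mass_ge\<close> at \<open>x\<close> costs \<open>2 * C ^ 2\<close>,
  at \<open>y\<close> one more doubling and hence \<open>2 * C ^ 3\<close>; the total
  \<open>2 * C ^ 2 + 4 * C ^ 5\<close> is absorbed in \<open>6 * C ^ 5\<close> because
  \<open>C\<close> is at least 1.\<close>

lemma weight_diff:
  assumes e: "e > 0" and xy: "x \<in> X" "y \<in> X" "d x y < e" and z: "z \<in> X"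
  shows "\<bar>bump e x z / mass e x - bump e y z / mass e y\<bar> \<le> 6 * C ^ 5 * (d x y / e) / v x (2 * e) * indicator (B x (2 * e)) z"
proof -
  define V where "V = v x (2 * e)"
  define t where "t = d x y / e"
  define I :: real where "I = indicator (B x (2 * e)) z"
  have V: "V > 0" using e xy v_pos by (simp add: V_def)
  have t: "t \<ge> 0" using e by (simp add: t_def)
  have n: "mass e x > 0" "mass e y > 0" using mass_pos e xy by auto
  have nx: "1 / mass e x \<le> 2 * C ^ 2 / V"
    using mass_ge[OF e xy(1)] n V by (simp add: V_def field_simps)
  have "V \<le> C * v y (2 * e)"
    unfolding V_def using v_doubling[of y x "2 * e" "2 * e" 1] e xy by (simp add: mdist_commute)
  also have "\<dots> \<le> C * (2 * C ^ 2 * mass e y)" using mass_ge[OF e xy(2)] C_pos by simp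
  finally have ny: "1 / mass e y \<le> 2 * C ^ 3 / V"
    using n V by (simp add: field_simps power3_eq_cube power2_eq_square)
  have bym: "bump e y z \<le> I"
    using bump_zero[OF e, of y z] bump_bounds(1)[of e y z] bump_bounds(2)[OF e, of y z] d_triangle[of x y z] xy z
    by (auto simp: I_def indicator_def)
  have bxy: "\<bar>bump e x z - bump e y z\<bar> \<le> t * I"
    using mass_diff(2)[OF e xy z] by (simp add: t_def I_def)
  have nd: "\<bar>mass e x - mass e y\<bar> \<le> t * V" using mass_diff(1)[OF e xy] by (simp add: t_def V_def)
  have I: "0 \<le> I" by (simp add: I_def)
  have "bump e x z / mass e x - bump e y z / mass e y =
    (bump e x z - bump e y z) * (1 / mass e x) + bump e y z * ((mass e y - mass e x) * (1 / mass e x) * (1 / mass e y))"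
    using n by (simp add: field_simps)
  also have "\<bar>\<dots>\<bar> \<le> \<bar>bump e x z - bump e y z\<bar> * (1 / mass e x) + bump e y z * (\<bar>mass e x - mass e y\<bar> * (1 / mass e x) * (1 / mass e y))"
    using n bump_bounds(1)[of e y z] by (intro order.trans[OF abs_triangle_ineq]) (simp add: abs_mult abs_minus_commute)
  also have "\<dots> \<le> (t * I) * (2 * C ^ 2 / V) + I * (t * V * (2 * C ^ 2 / V) * (2 * C ^ 3 / V))"
    using n nx ny bym bxy nd V t I C_pos bump_bounds(1)[of e y z]
    by (intro add_mono mult_mono) auto
  also have "\<dots> = (2 * C ^ 2 + 4 * C ^ 5) * (t * I / V)"
    using V by (simp add: field_simps power2_eq_square eval_nat_numeral)
  also have "\<dots> \<le> (6 * C ^ 5) * (t * I / V)"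
    using C_ge_1 power_increasing[of 2 5 C] t I V by (intro mult_right_mono) auto
  finally show ?thesis by (simp add: t_def I_def V_def)
qed

end

section \<open>Upper gradients of the averages and the mean oscillation\<close>

locale integrable_fun = doubling_mms m \<mu> C
  for m :: "'a metric" and \<mu> :: "'a set \<Rightarrow> ennreal" and C :: real +
  fixes \<Phi> :: "'a \<Rightarrow> real"
  assumes integrable: "integrable N \<Phi>"
begin

lemma measurable_\<Phi> [measurable]: "\<Phi> \<in> borel_measurable N"
  using integrable by (rule borel_measurable_integrable)

lemma integrable_bump_mult:
  assumes "e > 0" "x \<in> X" shows "integrable N (\<lambda>z. bump e x z * \<Phi> z)"
proof (rule Bochner_Integration.integrable_bound[OF integrable])
  show "(\<lambda>z. bump e x z * \<Phi> z) \<in> borel_measurable N" using assms by measurable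
  show "AE z in N. norm (bump e x z * \<Phi> z) \<le> norm (\<Phi> z)"
    using assms bump_bounds[of e x] by (intro AE_I2) (simp add: abs_mult mult_left_le_one_le)
qed

text \<open>The weights have integral 1, so any constant may be subtracted inside the average. This
  freedom is used with the values of \<open>\<Phi>\<close> itself as constants.\<close>

lemma smooth_minus_const:
  assumes "e > 0" "x \<in> X"
  shows "smooth e \<Phi> x - c = (\<integral>z. bump e x z / mass e x * (\<Phi> z - c) \<partial>N)"
    and "integrable N (\<lambda>z. bump e x z / mass e x * (\<Phi> z - c))"
proof -
  note i = integrable_bump_mult[OF assms] integrable_bump[OF assms]
  have eq: "bump e x z / mass e x * (\<Phi> z - c) = (bump e x z * \<Phi> z - bump e x z * c) / mass e x" for z
    by (simp add: algebra_simps diff_divide_distrib)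
  show "integrable N (\<lambda>z. bump e x z / mass e x * (\<Phi> z - c))"
    unfolding eq using i by simp
  have "(\<integral>z. bump e x z * \<Phi> z - bump e x z * c \<partial>N) = (\<integral>z. bump e x z * \<Phi> z \<partial>N) - mass e x * c"
    using i by (simp add: mass_def)
  then show "smooth e \<Phi> x - c = (\<integral>z. bump e x z / mass e x * (\<Phi> z - c) \<partial>N)"
    unfolding eq smooth_def integral_divide_zero using mass_pos[OF assms]
    by (simp add: diff_divide_distrib del: integral_divide_zero)
qed

text \<open>The constant \<open>c\<close> is left open on purpose: taking
  \<open>c = \<Phi> w\<close> and averaging over \<open>w\<close> turns the right-hand side into a
  double oscillation.\<close>

lemma smooth_diff:
  assumes e: "e > 0" and xy: "x \<in> X" "y \<in> X" "d x y < e"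
  shows "ennreal \<bar>smooth e \<Phi> x - smooth e \<Phi> y\<bar> \<le>
    ennreal (6 * C ^ 5 * (d x y / e) / v x (2 * e)) * (\<integral>\<^sup>+z. (if d x z < 2 * e then ennreal \<bar>\<Phi> z - c\<bar> else 0) \<partial>N)"
proof -
  let ?K = "6 * C ^ 5 * (d x y / e) / v x (2 * e)"
  have K: "?K \<ge> 0" using C_pos e by simp
  define f where "f z = bump e x z / mass e x * (\<Phi> z - c) - bump e y z / mass e y * (\<Phi> z - c)" for z
  note S = smooth_minus_const[OF e xy(1), of c] smooth_minus_const[OF e xy(2), of c]
  have i: "integrable N f" unfolding f_def using S by (intro Bochner_Integration.integrable_diff)
  have "smooth e \<Phi> x - smooth e \<Phi> y = (smooth e \<Phi> x - c) - (smooth e \<Phi> y - c)" by simp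
  also have "\<dots> = (\<integral>z. f z \<partial>N)" unfolding f_def S(1,3) using S by (intro Bochner_Integration.integral_diff[symmetric])
  finally have "ennreal \<bar>smooth e \<Phi> x - smooth e \<Phi> y\<bar> \<le> (\<integral>\<^sup>+z. norm (f z) \<partial>N)"
    using integral_norm_bound_ennreal[OF i] by simp
  also have "\<dots> \<le> (\<integral>\<^sup>+z. ennreal ?K * (if d x z < 2 * e then ennreal \<bar>\<Phi> z - c\<bar> else 0) \<partial>N)"
  proof (rule nn_integral_mono)
    fix z assume "z \<in> space N" then have z: "z \<in> X" by simp
    have "norm (f z) = \<bar>bump e x z / mass e x - bump e y z / mass e y\<bar> * \<bar>\<Phi> z - c\<bar>"
      unfolding f_def left_diff_distrib[symmetric] abs_mult[symmetric] by simp
    also have "\<dots> \<le> ?K * indicator (B x (2 * e)) z * \<bar>\<Phi> z - c\<bar>"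
      using weight_diff[OF e xy z] by (intro mult_right_mono) auto
    finally show "ennreal (norm (f z)) \<le> ennreal ?K * (if d x z < 2 * e then ennreal \<bar>\<Phi> z - c\<bar> else 0)"
      using z xy K by (auto simp: ennreal_mult[symmetric] indicator_def intro!: ennreal_leI split: if_splits)
  qed
  also have "\<dots> = ennreal ?K * (\<integral>\<^sup>+z. (if d x z < 2 * e then ennreal \<bar>\<Phi> z - c\<bar> else 0) \<partial>N)"
    using xy by (intro nn_integral_cmult) measurable
  finally show ?thesis .
qed

definition osc :: "real \<Rightarrow> 'a \<Rightarrow> ennreal" where
  "osc e p = (\<integral>\<^sup>+w. \<integral>\<^sup>+z. (if d p z < 3 * e \<and> d p w < 3 * e then ennreal \<bar>\<Phi> z - \<Phi> w\<bar> else 0) \<partial>N \<partial>N)"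

text \<open>The center is a point \<open>p\<close> of the curve near \<open>x\<close>, not
  \<open>x\<close> itself; \<open>B x (2 * e)\<close> lies in \<open>B p (3 * e)\<close> when
  \<open>d p x < e\<close>. One power of the volume comes from the weights, the other from averaging
  over \<open>w\<close>; the sixth factor \<open>C\<close> pays for moving the ball from
  \<open>x\<close> to \<open>p\<close>.\<close>

definition grad :: "real \<Rightarrow> 'a \<Rightarrow> ennreal" where
  "grad e p = ennreal (6 * C ^ 6 / e / (v p (3 * e))\<^sup>2) * osc e p"

lemma measurable_grad: "grad e \<in> borel_measurable (mborel m)"
  unfolding grad_def osc_def by measurable

text \<open>Multiplying the left-hand side by \<open>v p (3 * e)\<close> is the same as integrating
  it over \<open>w\<close> in that ball, and for each \<open>w\<close> the estimate
  \<open>smooth_diff\<close> is applied with the constant \<open>\<Phi> w\<close>.\<close>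

lemma grad_bound:
  assumes e: "e > 0" and xy: "x \<in> X" "y \<in> X" "p \<in> X" "d x y < e" "d p x < e"
  shows "ennreal \<bar>smooth e \<Phi> x - smooth e \<Phi> y\<bar> \<le> ennreal (d x y) * grad e p"
proof -
  let ?T = "ennreal \<bar>smooth e \<Phi> x - smooth e \<Phi> y\<bar>"
  define K where "K = 6 * C ^ 5 * (d x y / e) / v x (2 * e)"
  define V where "V = v p (3 * e)"
  have V: "V > 0" using e xy v_pos by (simp add: V_def)
  have VX: "V \<le> C * v x (2 * e)"
    unfolding V_def using v_doubling[of x p "2 * e" "3 * e" 1] e xy by (simp add: mdist_commute)
  have K: "0 \<le> K" "K \<le> 6 * C ^ 6 * (d x y / e) / V"
  proof -
    have vx: "v x (2 * e) > 0" using e xy by (intro v_pos) auto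
    have "1 / v x (2 * e) \<le> C / V" using VX V vx by (simp add: field_simps)
    then have "6 * C ^ 5 * (d x y / e) * (1 / v x (2 * e)) \<le> 6 * C ^ 5 * (d x y / e) * (C / V)"
      using C_pos e by (intro mult_left_mono) auto
    then show "K \<le> 6 * C ^ 6 * (d x y / e) / V" by (simp add: K_def eval_nat_numeral algebra_simps)
    show "0 \<le> K" using C_pos e by (simp add: K_def)
  qed
  have "?T * ennreal V = (\<integral>\<^sup>+w. (if d p w < 3 * e then ?T else 0) \<partial>N)"
    using xy by (simp add: nn_integral_ball V_def)
  also have "\<dots> \<le> (\<integral>\<^sup>+w. ennreal K * (\<integral>\<^sup>+z. (if d p z < 3 * e \<and> d p w < 3 * e then ennreal \<bar>\<Phi> z - \<Phi> w\<bar> else 0) \<partial>N) \<partial>N)"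
  proof (rule nn_integral_mono)
    fix w assume "w \<in> space N"
    show "(if d p w < 3 * e then ?T else 0) \<le> ennreal K * (\<integral>\<^sup>+z. (if d p z < 3 * e \<and> d p w < 3 * e then ennreal \<bar>\<Phi> z - \<Phi> w\<bar> else 0) \<partial>N)"
    proof (cases "d p w < 3 * e")
      case True
      have "?T \<le> ennreal K * (\<integral>\<^sup>+z. (if d x z < 2 * e then ennreal \<bar>\<Phi> z - \<Phi> w\<bar> else 0) \<partial>N)"
        unfolding K_def using e xy by (intro smooth_diff)
      also have "\<dots> \<le> ennreal K * (\<integral>\<^sup>+z. (if d p z < 3 * e \<and> d p w < 3 * e then ennreal \<bar>\<Phi> z - \<Phi> w\<bar> else 0) \<partial>N)"
        using True e xy d_triangle[of p x] by (intro mult_left_mono nn_integral_mono) (auto, smt (verit))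
      finally show ?thesis using True by simp
    qed simp
  qed
  also have "\<dots> = ennreal K * osc e p"
    unfolding osc_def using xy by (intro nn_integral_cmult) measurable
  also have "\<dots> \<le> ennreal (6 * C ^ 6 * (d x y / e) / V) * osc e p"
    using K by (intro mult_right_mono ennreal_leI) auto
  finally have "ennreal (1 / V) * (?T * ennreal V) \<le> ennreal (1 / V) * (ennreal (6 * C ^ 6 * (d x y / e) / V) * osc e p)"
    by (intro mult_left_mono) auto
  moreover have "ennreal (1 / V) * (?T * ennreal V) = ?T"
  proof -
    have "ennreal (1 / V) * ennreal V = 1" using V by (simp add: ennreal_mult[symmetric])
    then show ?thesis by (metis mult.left_commute mult.right_neutral)
  qed
  moreover have "ennreal (1 / V) * (ennreal (6 * C ^ 6 * (d x y / e) / V) * osc e p) = ennreal (d x y) * grad e p"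
    unfolding grad_def V_def[symmetric] mult.assoc[symmetric] using V C_pos e
    by (simp add: ennreal_mult[symmetric] field_simps power2_eq_square)
  ultimately show ?thesis by simp
qed

lemma upper_gradient_smooth: "e > 0 \<Longrightarrow> upper_gradient m (smooth e \<Phi>) (grad e)"
  using grad_bound by (intro upper_gradient_local_Lipschitz[of _ _ e] measurable_grad) auto

text \<open>The mean oscillation, integrated over all centers. The radius is \<open>6 * e\<close>
  because two points of \<open>B p (3 * e)\<close> are less than \<open>6 * e\<close> apart.\<close>

definition dev :: "real \<Rightarrow> ennreal" where
  "dev e = (\<integral>\<^sup>+x. \<integral>\<^sup>+y. (if d x y < 6 * e then ennreal (\<bar>\<Phi> x - \<Phi> y\<bar> / v x (6 * e)) else 0) \<partial>N \<partial>N)"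

text \<open>With \<open>p\<close> as the innermost variable the integrand is supported in a ball
  around \<open>w\<close> of radius \<open>6 * e\<close>, whose volume cancels one of the two volume
  factors. Moving the squared volume from \<open>p\<close> to \<open>w\<close> costs
  \<open>(C ^ 2) ^ 2\<close>, whence \<open>C ^ 10\<close>.\<close>

lemma nn_integral_grad:
  assumes e: "e > 0" shows "(\<integral>\<^sup>+p. grad e p \<partial>N) \<le> ennreal (6 * C ^ 10 / e) * dev e"
proof -
  define h where "h p w z = ennreal (6 * C ^ 6 / e / (v p (3 * e))\<^sup>2) *
    (if d p z < 3 * e \<and> d p w < 3 * e then ennreal \<bar>\<Phi> z - \<Phi> w\<bar> else 0)" for p w z
  have "(\<integral>\<^sup>+p. grad e p \<partial>N) = (\<integral>\<^sup>+p. \<integral>\<^sup>+w. \<integral>\<^sup>+z. h p w z \<partial>N \<partial>N \<partial>N)"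
  proof (rule nn_integral_cong)
    fix p assume "p \<in> space N"
    then have [measurable]: "p \<in> space N" .
    show "grad e p = (\<integral>\<^sup>+w. \<integral>\<^sup>+z. h p w z \<partial>N \<partial>N)"
      unfolding grad_def osc_def h_def
      by (subst nn_integral_cmult[symmetric], measurable, intro nn_integral_cong, subst nn_integral_cmult, measurable)
  qed
  also have "\<dots> = (\<integral>\<^sup>+w. \<integral>\<^sup>+p. \<integral>\<^sup>+z. h p w z \<partial>N \<partial>N \<partial>N)"
    unfolding h_def by (intro nn_integral_swap[symmetric]) measurable
  also have "\<dots> = (\<integral>\<^sup>+w. \<integral>\<^sup>+z. \<integral>\<^sup>+p. h p w z \<partial>N \<partial>N \<partial>N)"
  proof (rule nn_integral_cong)
    fix w assume "w \<in> space N"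
    then have [measurable]: "w \<in> space N" .
    show "(\<integral>\<^sup>+p. \<integral>\<^sup>+z. h p w z \<partial>N \<partial>N) = (\<integral>\<^sup>+z. \<integral>\<^sup>+p. h p w z \<partial>N \<partial>N)"
      unfolding h_def by (intro nn_integral_swap[symmetric]) measurable
  qed
  also have "\<dots> \<le> (\<integral>\<^sup>+w. \<integral>\<^sup>+z. ennreal (6 * C ^ 10 / e) * (if d w z < 6 * e then ennreal (\<bar>\<Phi> w - \<Phi> z\<bar> / v w (6 * e)) else 0) \<partial>N \<partial>N)"
  proof (intro nn_integral_mono)
    fix w z assume "w \<in> space N" "z \<in> space N" then have wz: "w \<in> X" "z \<in> X" by auto
    define K where "K = 6 * C ^ 10 / e * (\<bar>\<Phi> w - \<Phi> z\<bar> / v w (6 * e)) / v w (6 * e)"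
    have vw: "v w (6 * e) > 0" using e wz by (intro v_pos) auto
    show "(\<integral>\<^sup>+p. h p w z \<partial>N) \<le> ennreal (6 * C ^ 10 / e) * (if d w z < 6 * e then ennreal (\<bar>\<Phi> w - \<Phi> z\<bar> / v w (6 * e)) else 0)"
    proof (cases "d w z < 6 * e")
      case False
      have "h p w z = 0" if "p \<in> X" for p
        using False d_triangle[of w p z] that wz by (auto simp: h_def mdist_commute)
      then have "(\<integral>\<^sup>+p. h p w z \<partial>N) = (\<integral>\<^sup>+p. 0 \<partial>N)" by (intro nn_integral_cong) auto
      then show ?thesis by simp
    next
      case True
      have "(\<integral>\<^sup>+p. h p w z \<partial>N) \<le> (\<integral>\<^sup>+p. (if d w p < 6 * e then ennreal K else 0) \<partial>N)"
      proof (rule nn_integral_mono)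
        fix p assume "p \<in> space N" then have p: "p \<in> X" by simp
        show "h p w z \<le> (if d w p < 6 * e then ennreal K else 0)"
        proof (cases "d p z < 3 * e \<and> d p w < 3 * e")
          case T: True
          then have dp: "d w p < 6 * e" using e mdist_commute[of m w p] by simp
          have "v w (6 * e) \<le> C ^ 2 * v p (3 * e)" using T e p wz by (intro v_doubling) auto
          then have "(v w (6 * e))\<^sup>2 \<le> (C ^ 2 * v p (3 * e))\<^sup>2" using vw by (intro power_mono) auto
          then have "C ^ 6 / (v p (3 * e))\<^sup>2 \<le> C ^ 10 / (v w (6 * e))\<^sup>2"
            using vw v_pos[OF p, of "3 * e"] e C_pos
            by (simp add: divide_simps power_mult_distrib) (simp add: eval_nat_numeral algebra_simps)
          then have "6 / e * \<bar>\<Phi> z - \<Phi> w\<bar> * (C ^ 6 / (v p (3 * e))\<^sup>2) \<le> 6 / e * \<bar>\<Phi> z - \<Phi> w\<bar> * (C ^ 10 / (v w (6 * e))\<^sup>2)"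
            using e by (intro mult_left_mono) auto
          then have "6 * C ^ 6 / e / (v p (3 * e))\<^sup>2 * \<bar>\<Phi> z - \<Phi> w\<bar> \<le> K"
            by (simp add: K_def abs_minus_commute power2_eq_square algebra_simps)
          then show ?thesis using T dp C_pos e by (simp add: h_def ennreal_mult[symmetric] ennreal_leI)
        qed (auto simp: h_def)
      qed
      also have "\<dots> = ennreal (6 * C ^ 10 / e) * ennreal (\<bar>\<Phi> w - \<Phi> z\<bar> / v w (6 * e))"
        using wz vw e C_pos by (subst nn_integral_ball) (auto simp: K_def ennreal_mult[symmetric])
      finally show ?thesis using True by simp
    qed
  qed
  also have "\<dots> = ennreal (6 * C ^ 10 / e) * dev e"
  proof -
    have "(\<integral>\<^sup>+z. ennreal (6 * C ^ 10 / e) * (if d w z < 6 * e then ennreal (\<bar>\<Phi> w - \<Phi> z\<bar> / v w (6 * e)) else 0) \<partial>N) = 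
      ennreal (6 * C ^ 10 / e) * (\<integral>\<^sup>+z. (if d w z < 6 * e then ennreal (\<bar>\<Phi> w - \<Phi> z\<bar> / v w (6 * e)) else 0) \<partial>N)" if "w \<in> space N" for w
      using that by (intro nn_integral_cmult) measurable
    then show ?thesis unfolding dev_def by (simp add: nn_integral_cmult cong: nn_integral_cong_simp)
  qed
  finally show ?thesis .
qed

lemma measurable_smooth [measurable]: "smooth e \<Phi> \<in> borel_measurable N"
  unfolding smooth_def mass_def by measurable

text \<open>The constant subtracted in the average is \<open>\<Phi> x\<close>. The factor
  \<open>2 * C ^ 4\<close> is \<open>mass_ge\<close> followed by two doublings from
  \<open>2 * e\<close> to \<open>6 * e\<close>.\<close>

lemma nn_integral_smooth_diff:
  assumes e: "e > 0" shows "(\<integral>\<^sup>+x. ennreal \<bar>smooth e \<Phi> x - \<Phi> x\<bar> \<partial>N) \<le> ennreal (2 * C ^ 4) * dev e"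
proof -
  define h where "h x y = (if d x y < 6 * e then ennreal (\<bar>\<Phi> x - \<Phi> y\<bar> / v x (6 * e)) else 0)" for x y
  have "(\<integral>\<^sup>+x. ennreal \<bar>smooth e \<Phi> x - \<Phi> x\<bar> \<partial>N) \<le> (\<integral>\<^sup>+x. ennreal (2 * C ^ 4) * (\<integral>\<^sup>+y. h x y \<partial>N) \<partial>N)"
  proof (rule nn_integral_mono)
    fix x assume "x \<in> space N" then have x: "x \<in> X" and [measurable]: "x \<in> space N" by auto
    have n: "mass e x > 0" and v6: "v x (6 * e) > 0" using e x by (auto intro: mass_pos v_pos)
    have "v x (6 * e) \<le> C ^ 2 * v x (2 * e)" using e x by (intro v_doubling) auto
    also have "\<dots> \<le> C ^ 2 * (2 * C ^ 2 * mass e x)" using mass_ge[OF e x] by (intro mult_left_mono) auto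
    finally have nr: "1 / mass e x \<le> 2 * C ^ 4 / v x (6 * e)"
      using n v6 by (simp add: field_simps eval_nat_numeral)
    have "ennreal \<bar>smooth e \<Phi> x - \<Phi> x\<bar> \<le> (\<integral>\<^sup>+z. norm (bump e x z / mass e x * (\<Phi> z - \<Phi> x)) \<partial>N)"
      using integral_norm_bound_ennreal[OF smooth_minus_const(2)[OF e x, of "\<Phi> x"]]
      unfolding smooth_minus_const(1)[OF e x] by simp
    also have "\<dots> \<le> (\<integral>\<^sup>+z. ennreal (2 * C ^ 4) * h x z \<partial>N)"
    proof (rule nn_integral_mono)
      fix z assume "z \<in> space N" then have z: "z \<in> X" by simp
      show "ennreal (norm (bump e x z / mass e x * (\<Phi> z - \<Phi> x))) \<le> ennreal (2 * C ^ 4) * h x z"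
      proof (cases "d x z < e")
        case True
        have "norm (bump e x z / mass e x * (\<Phi> z - \<Phi> x)) = bump e x z * (1 / mass e x) * \<bar>\<Phi> x - \<Phi> z\<bar>"
          using n bump_bounds(1)[of e x z] by (simp add: abs_mult abs_minus_commute)
        also have "\<dots> \<le> 1 * (2 * C ^ 4 / v x (6 * e)) * \<bar>\<Phi> x - \<Phi> z\<bar>"
          using n nr bump_bounds[of e x z] e by (intro mult_right_mono mult_mono) auto
        finally show ?thesis using True e C_pos by (simp add: h_def ennreal_mult[symmetric] ennreal_leI)
      next
        case False
        then show ?thesis using e by (simp add: bump_zero)
      qed
    qed
    also have "\<dots> = ennreal (2 * C ^ 4) * (\<integral>\<^sup>+y. h x y \<partial>N)"
      unfolding h_def by (intro nn_integral_cmult) measurable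
    finally show "ennreal \<bar>smooth e \<Phi> x - \<Phi> x\<bar> \<le> ennreal (2 * C ^ 4) * (\<integral>\<^sup>+y. h x y \<partial>N)" .
  qed
  also have "\<dots> = ennreal (2 * C ^ 4) * dev e"
    unfolding dev_def h_def by (intro nn_integral_cmult) measurable
  finally show ?thesis .
qed

end

section \<open>Small support under a Poincare inequality\<close>

text \<open>The terms grow by the factor \<open>2 powr s\<close> and stop before reaching 1, so the
  sum is a geometric series read backwards from its last term. The minimum is what makes the
  induction work: the second entry controls the sum while terms still appear, the first one after
  they have stopped.\<close>

lemma sum_geometric_above:
  fixes a \<rho> s :: real
  assumes a: "0 < a" and \<rho>: "0 < \<rho>" and s: "0 < s"
  shows "(\<Sum>i<n. if a < \<rho> / 2 ^ i then (a / (\<rho> / 2 ^ i)) powr s else 0) * (1 - 2 powr (- s))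
    \<le> min 1 ((a / (\<rho> / 2 ^ n)) powr s * 2 powr (- s))"
proof (induction n)
  case 0
  then show ?case by simp
next
  case (Suc n)
  define t where "t = (a / (\<rho> / 2 ^ n)) powr s"
  define S where "S = (\<Sum>i<n. if a < \<rho> / 2 ^ i then (a / (\<rho> / 2 ^ i)) powr s else 0) * (1 - 2 powr (- s))"
  have IH: "S \<le> 1" "S \<le> t * 2 powr (- s)" using Suc by (auto simp: S_def t_def)
  have q: "2 powr (- s) < 1" using s powr_less_cancel_iff[of 2 "- s" 0] by simp
  have "(a / (\<rho> / 2 ^ Suc n)) powr s = (2 * (a / (\<rho> / 2 ^ n))) powr s" by (simp add: field_simps)
  also have "\<dots> = 2 powr s * t" unfolding t_def using a \<rho> by (subst powr_mult) auto
  finally have nx: "(a / (\<rho> / 2 ^ Suc n)) powr s * 2 powr (- s) = t"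
    by (simp add: powr_minus field_simps)
  show ?case
  proof (cases "a < \<rho> / 2 ^ n")
    case True
    then have "t \<le> 1 powr s" unfolding t_def using a \<rho> s by (intro powr_mono2) (auto simp: field_simps)
    then have "t \<le> 1" by simp
    moreover have "S + t * (1 - 2 powr (- s)) \<le> t" using IH(2) by (simp add: algebra_simps)
    ultimately show ?thesis unfolding nx using True by (simp add: S_def t_def algebra_simps)
  next
    case False
    then have "1 powr s \<le> t" unfolding t_def using a \<rho> s by (intro powr_mono2) (auto simp: field_simps)
    then show ?thesis unfolding nx using False IH by (simp add: S_def)
  qed
qed

lemma suminf_geometric_above:
  fixes a \<rho> s :: real
  assumes a: "0 < a" and \<rho>: "0 < \<rho>" and s: "0 < s"
  shows "(\<Sum>i. if a < \<rho> / 2 ^ i then ennreal ((a / (\<rho> / 2 ^ i)) powr s) else 0) \<le> ennreal (1 / (1 - 2 powr (- s)))"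
proof -
  have q: "2 powr (- s) < 1" using s powr_less_cancel_iff[of 2 "- s" 0] by simp
  have "(\<Sum>i<n. if a < \<rho> / 2 ^ i then ennreal ((a / (\<rho> / 2 ^ i)) powr s) else 0) \<le> ennreal (1 / (1 - 2 powr (- s)))" for n
  proof -
    have "(\<Sum>i<n. if a < \<rho> / 2 ^ i then ennreal ((a / (\<rho> / 2 ^ i)) powr s) else 0) =
      (\<Sum>i<n. ennreal (if a < \<rho> / 2 ^ i then (a / (\<rho> / 2 ^ i)) powr s else 0))"
      by (intro sum.cong) auto
    also have "\<dots> = ennreal (\<Sum>i<n. if a < \<rho> / 2 ^ i then (a / (\<rho> / 2 ^ i)) powr s else 0)"
      by (intro sum_ennreal) auto
    also have "\<dots> \<le> ennreal (1 / (1 - 2 powr (- s)))"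
      using sum_geometric_above[OF assms, of n] q
      by (intro ennreal_leI) (simp add: pos_le_divide_eq)
    finally show ?thesis .
  qed
  then show ?thesis unfolding suminf_eq_SUP by (intro SUP_least)
qed

lemma ennreal_sum_prod:
  assumes "0 \<le> a" "0 \<le> b" "0 \<le> c" "0 \<le> p" "0 \<le> q" "0 \<le> r"
  shows "ennreal a * (ennreal b * (ennreal c * D) + ennreal p * (ennreal q * (ennreal r * D))) =
    ennreal (a * (b * c + p * (q * r))) * D"
  using assms by (simp add: ennreal_mult ennreal_plus distrib_left distrib_right mult.assoc)

context doubling_mms
begin

text \<open>Exchanging the integrals, \<open>h z\<close> receives the weight given by the integral
  of \<open>1 / v x \<rho>\<close> over the ball around \<open>z\<close>, which is at least
  \<open>1 / C\<close> by doubling. Averaging over all centers replaces a covering by balls with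
  bounded overlap.\<close>

lemma average_lower:
  assumes [measurable]: "h \<in> borel_measurable N" and \<rho>: "\<rho> > 0"
  shows "(\<integral>\<^sup>+z. h z \<partial>N) \<le> ennreal C * (\<integral>\<^sup>+x. ennreal (1 / v x \<rho>) * (\<integral>\<^sup>+z. (if d x z < \<rho> then h z else 0) \<partial>N) \<partial>N)"
proof -
  define f where "f x z = ennreal (1 / v x \<rho>) * (if d x z < \<rho> then h z else 0)" for x z
  have pt: "h z \<le> ennreal C * (\<integral>\<^sup>+x. f x z \<partial>N)" if z: "z \<in> X" for z
  proof -
    have vz: "v z \<rho> > 0" using z \<rho> by (rule v_pos)
    have "h z = ennreal C * (ennreal (1 / (C * v z \<rho>)) * h z * ennreal (v z \<rho>))"
    proof -
      have "ennreal C * (ennreal (1 / (C * v z \<rho>)) * h z * ennreal (v z \<rho>)) =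
        (ennreal C * ennreal (1 / (C * v z \<rho>)) * ennreal (v z \<rho>)) * h z" by (simp add: ac_simps)
      also have "ennreal C * ennreal (1 / (C * v z \<rho>)) * ennreal (v z \<rho>) = 1"
        using C_pos vz by (simp add: ennreal_mult[symmetric])
      finally show ?thesis by simp
    qed
    also have "ennreal (1 / (C * v z \<rho>)) * h z * ennreal (v z \<rho>) = (\<integral>\<^sup>+x. (if d z x < \<rho> then ennreal (1 / (C * v z \<rho>)) * h z else 0) \<partial>N)"
      using z by (rule nn_integral_ball[symmetric])
    also have "\<dots> \<le> (\<integral>\<^sup>+x. f x z \<partial>N)"
    proof (rule nn_integral_mono)
      fix x assume "x \<in> space N" then have x: "x \<in> X" by simp
      show "(if d z x < \<rho> then ennreal (1 / (C * v z \<rho>)) * h z else 0) \<le> f x z"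
      proof (cases "d z x < \<rho>")
        case True
        then have "v x \<rho> \<le> C ^ 1 * v z \<rho>" using z x \<rho> by (intro v_doubling) auto
        then have "1 / (C * v z \<rho>) \<le> 1 / v x \<rho>" using v_pos[OF x \<rho>] by (intro divide_left_mono) auto
        then show ?thesis using True by (simp add: f_def mdist_commute mult_right_mono ennreal_leI)
      qed simp
    qed
    finally show ?thesis by (simp add: mult_left_mono)
  qed
  have "(\<integral>\<^sup>+z. h z \<partial>N) \<le> (\<integral>\<^sup>+z. ennreal C * (\<integral>\<^sup>+x. f x z \<partial>N) \<partial>N)"
    using pt by (intro nn_integral_mono) auto
  also have "\<dots> = ennreal C * (\<integral>\<^sup>+z. \<integral>\<^sup>+x. f x z \<partial>N \<partial>N)"
    unfolding f_def by (intro nn_integral_cmult) measurable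
  also have "(\<integral>\<^sup>+z. \<integral>\<^sup>+x. f x z \<partial>N \<partial>N) = (\<integral>\<^sup>+x. \<integral>\<^sup>+z. f x z \<partial>N \<partial>N)"
    unfolding f_def by (intro nn_integral_swap) measurable
  also have "\<dots> = (\<integral>\<^sup>+x. ennreal (1 / v x \<rho>) * (\<integral>\<^sup>+z. (if d x z < \<rho> then h z else 0) \<partial>N) \<partial>N)"
    unfolding f_def by (intro nn_integral_cong nn_integral_cmult) measurable
  finally show ?thesis .
qed

text \<open>The counterpart for dilated balls, as they occur on the right of the Poincare
  inequality: for \<open>x\<close> in the ball of radius \<open>k * \<rho>\<close> around
  \<open>z\<close>, that ball lies in the one of radius \<open>2 * k * \<rho>\<close> around
  \<open>x\<close>, which \<open>n\<close> doublings cover.\<close>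

lemma average_upper:
  assumes [measurable]: "h \<in> borel_measurable N" and \<rho>: "\<rho> > 0" and k: "0 < k" "2 * k \<le> 2 ^ n"
  shows "(\<integral>\<^sup>+x. ennreal (1 / v x \<rho>) * (\<integral>\<^sup>+z. (if d x z < k * \<rho> then h z else 0) \<partial>N) \<partial>N)
    \<le> ennreal (C ^ n) * (\<integral>\<^sup>+z. h z \<partial>N)"
proof -
  define f where "f x z = ennreal (1 / v x \<rho>) * (if d x z < k * \<rho> then h z else 0)" for x z
  have pt: "(\<integral>\<^sup>+x. f x z \<partial>N) \<le> ennreal (C ^ n) * h z" if z: "z \<in> X" for z
  proof -
    have vz: "v z (k * \<rho>) > 0" using z \<rho> k by (intro v_pos) auto
    have "(\<integral>\<^sup>+x. f x z \<partial>N) \<le> (\<integral>\<^sup>+x. (if d z x < k * \<rho> then ennreal (C ^ n / v z (k * \<rho>)) * h z else 0) \<partial>N)"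
    proof (rule nn_integral_mono)
      fix x assume "x \<in> space N" then have x: "x \<in> X" by simp
      show "f x z \<le> (if d z x < k * \<rho> then ennreal (C ^ n / v z (k * \<rho>)) * h z else 0)"
      proof (cases "d z x < k * \<rho>")
        case True
        have "2 * k * \<rho> \<le> 2 ^ n * \<rho>" using k \<rho> by (intro mult_right_mono) auto
        then have "d x z + k * \<rho> \<le> 2 ^ n * \<rho>" using True mdist_commute[of m x z] by linarith
        then have "v z (k * \<rho>) \<le> C ^ n * v x \<rho>" using z x \<rho> by (intro v_doubling) auto
        then have "1 / v x \<rho> \<le> C ^ n / v z (k * \<rho>)" using v_pos[OF x \<rho>] vz C_pos by (simp add: field_simps)
        then show ?thesis using True by (simp add: f_def mdist_commute mult_right_mono ennreal_leI)
      qed (simp add: f_def mdist_commute)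
    qed
    also have "\<dots> = ennreal (C ^ n / v z (k * \<rho>)) * h z * ennreal (v z (k * \<rho>))"
      using z by (rule nn_integral_ball)
    also have "\<dots> = (ennreal (C ^ n / v z (k * \<rho>)) * ennreal (v z (k * \<rho>))) * h z" by (simp add: ac_simps)
    also have "\<dots> = ennreal (C ^ n) * h z" using vz C_pos by (simp add: ennreal_mult[symmetric])
    finally show ?thesis .
  qed
  have "(\<integral>\<^sup>+x. ennreal (1 / v x \<rho>) * (\<integral>\<^sup>+z. (if d x z < k * \<rho> then h z else 0) \<partial>N) \<partial>N) = (\<integral>\<^sup>+x. \<integral>\<^sup>+z. f x z \<partial>N \<partial>N)"
    unfolding f_def by (intro nn_integral_cong nn_integral_cmult[symmetric]) measurable
  also have "\<dots> = (\<integral>\<^sup>+z. \<integral>\<^sup>+x. f x z \<partial>N \<partial>N)"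
    unfolding f_def by (intro nn_integral_swap[symmetric]) measurable
  also have "\<dots> \<le> (\<integral>\<^sup>+z. ennreal (C ^ n) * h z \<partial>N)" using pt by (intro nn_integral_mono) auto
  also have "\<dots> = ennreal (C ^ n) * (\<integral>\<^sup>+z. h z \<partial>N)" by (intro nn_integral_cmult) measurable
  finally show ?thesis .
qed

lemma nn_integral_ball_indicator:
  assumes "x \<in> X"
  shows "(\<integral>\<^sup>+z. f z * indicator (B x r) z \<partial>N) = (\<integral>\<^sup>+z. (if d x z < r then f z else 0) \<partial>N)"
  using assms by (intro nn_integral_cong) (auto simp: indicator_def)

text \<open>If \<open>\<Phi>\<close> vanishes on at least half of \<open>A\<close>, then \<open>\<bar>\<tau>\<bar>\<close> times the measure of the rest is
  absorbed by the integral of \<open>\<bar>\<Phi> - \<tau>\<bar> = \<bar>\<tau>\<bar>\<close> over that half.\<close>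

lemma integral_le_deviation:
  fixes \<Phi> :: "'a \<Rightarrow> real" and \<tau> :: real
  assumes [measurable]: "\<Phi> \<in> borel_measurable N" "A \<in> sets N" and pos: "\<And>x. x \<in> X \<Longrightarrow> 0 \<le> \<Phi> x"
    and half: "2 * emeasure N (A \<inter> {x \<in> X. 0 < \<Phi> x}) \<le> emeasure N A" "emeasure N A < \<infinity>"
  shows "(\<integral>\<^sup>+x. ennreal (\<Phi> x) * indicator A x \<partial>N) \<le> (\<integral>\<^sup>+x. ennreal \<bar>\<Phi> x - \<tau>\<bar> * indicator A x \<partial>N)"
proof -
  define S where "S = A \<inter> {x \<in> X. 0 < \<Phi> x}"
  have S [measurable]: "S \<in> sets N" unfolding S_def by measurable
  have fS: "emeasure N S < \<infinity>" using emeasure_mono[of S A N] half(2) by (auto simp: S_def elim: le_less_trans)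
  have sum: "emeasure N A = emeasure N S + emeasure N (A - S)"
    by (subst plus_emeasure) (auto simp: S_def intro!: arg_cong[where f="emeasure N"])
  then have "emeasure N S + emeasure N S \<le> emeasure N S + emeasure N (A - S)"
    using half(1) by (simp add: S_def[symmetric] mult_2)
  then have SA: "emeasure N S \<le> emeasure N (A - S)"
    using fS by (auto simp: ennreal_add_left_cancel_le)
  have "(\<integral>\<^sup>+x. ennreal (\<Phi> x) * indicator A x \<partial>N) \<le> (\<integral>\<^sup>+x. ennreal \<bar>\<Phi> x - \<tau>\<bar> * indicator S x + ennreal \<bar>\<tau>\<bar> * indicator S x \<partial>N)"
  proof (rule nn_integral_mono)
    fix x assume "x \<in> space N" then have x: "x \<in> X" by simp
    show "ennreal (\<Phi> x) * indicator A x \<le> ennreal \<bar>\<Phi> x - \<tau>\<bar> * indicator S x + ennreal \<bar>\<tau>\<bar> * indicator S x"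
      using pos[OF x] x by (auto simp: S_def indicator_def ennreal_plus[symmetric] simp del: ennreal_plus intro!: ennreal_leI)
  qed
  also have "\<dots> = (\<integral>\<^sup>+x. ennreal \<bar>\<Phi> x - \<tau>\<bar> * indicator S x \<partial>N) + ennreal \<bar>\<tau>\<bar> * emeasure N S"
    by (subst nn_integral_add) (auto simp: nn_integral_cmult_indicator)
  also have "\<dots> \<le> (\<integral>\<^sup>+x. ennreal \<bar>\<Phi> x - \<tau>\<bar> * indicator S x \<partial>N) + ennreal \<bar>\<tau>\<bar> * emeasure N (A - S)"
    using SA by (intro add_left_mono mult_left_mono) auto
  also have "ennreal \<bar>\<tau>\<bar> * emeasure N (A - S) = (\<integral>\<^sup>+x. ennreal \<bar>\<tau>\<bar> * indicator (A - S) x \<partial>N)"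
    by (subst nn_integral_cmult_indicator) auto
  also have "\<dots> = (\<integral>\<^sup>+x. ennreal \<bar>\<Phi> x - \<tau>\<bar> * indicator (A - S) x \<partial>N)"
  proof (rule nn_integral_cong)
    fix x assume "x \<in> space N" then have x: "x \<in> X" by simp
    show "ennreal \<bar>\<tau>\<bar> * indicator (A - S) x = ennreal \<bar>\<Phi> x - \<tau>\<bar> * indicator (A - S) x"
      using pos[OF x] x by (auto simp: S_def indicator_def)
  qed
  also have "(\<integral>\<^sup>+x. ennreal \<bar>\<Phi> x - \<tau>\<bar> * indicator S x \<partial>N) + (\<integral>\<^sup>+x. ennreal \<bar>\<Phi> x - \<tau>\<bar> * indicator (A - S) x \<partial>N) =
    (\<integral>\<^sup>+x. ennreal \<bar>\<Phi> x - \<tau>\<bar> * indicator A x \<partial>N)"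
    by (subst nn_integral_add[symmetric]) (auto intro!: nn_integral_cong simp: S_def indicator_def)
  finally show ?thesis .
qed

end

section \<open>The Poincare inequality for averages and its sum over scales\<close>

context integrable_fun
begin

lemma poincare_ball:
  assumes P: "poincare m \<mu> CP lam" and e: "0 < e" and \<rho>: "0 < \<rho>" and x: "x \<in> X"
    and i: "integrable N (smooth e \<Phi>)"
  shows "\<exists>\<tau>. (\<integral>\<^sup>+z. (if d x z < \<rho> then ennreal \<bar>smooth e \<Phi> z - \<tau>\<bar> else 0) \<partial>N) \<le>
    ennreal (CP * \<rho>) * (\<integral>\<^sup>+z. (if d x z < lam * \<rho> then grad e z else 0) \<partial>N)"
proof -
  let ?T = "smooth e \<Phi>"
  define \<tau> where "\<tau> = ball_mean m \<mu> (B x \<rho>) ?T"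
  have P': "CP > 0" "lam \<ge> 1" using P by (auto simp: poincare_def)
  have "set_integrable N (B y r) ?T" for y r
    unfolding set_integrable_def using i by (intro integrable_mult_indicator) auto
  then have "(\<integral>\<^sup>+z\<in>B x \<rho>. ennreal \<bar>?T z - \<tau>\<bar> \<partial>N) / \<mu> (B x \<rho>) \<le>
      ennreal (CP * \<rho>) * ((\<integral>\<^sup>+z\<in>B x (lam * \<rho>). grad e z \<partial>N) / \<mu> (B x (lam * \<rho>)))"
    using P upper_gradient_smooth[OF e] x \<rho> unfolding poincare_def \<tau>_def by blast
  then have le: "(\<integral>\<^sup>+z. (if d x z < \<rho> then ennreal \<bar>?T z - \<tau>\<bar> else 0) \<partial>N) / ennreal (v x \<rho>) \<le>
      ennreal (CP * \<rho>) * ((\<integral>\<^sup>+z. (if d x z < lam * \<rho> then grad e z else 0) \<partial>N) / ennreal (v x (lam * \<rho>)))"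
    (is "?A / _ \<le> _ * (?G / _)")
    using x by (simp add: nn_integral_ball_indicator emeasure_N[symmetric] emeasure_ball')
  have v1: "0 < v x \<rho>" "0 < v x (lam * \<rho>)" using x \<rho> P' by (auto intro!: v_pos)
  have "\<rho> \<le> lam * \<rho>" using P' \<rho> by simp
  then have v2: "v x \<rho> \<le> v x (lam * \<rho>)" using x by (intro v_le) auto
  \<comment> \<open>The normalizations are removed by multiplying the left side by the smaller and
    the right side by the larger volume.\<close>
  have "?A = ?A / ennreal (v x \<rho>) * ennreal (v x \<rho>)"
    using v1 by (simp add: ennreal_divide_times mult_divide_eq_ennreal)
  also have "\<dots> \<le> ennreal (CP * \<rho>) * (?G / ennreal (v x (lam * \<rho>))) * ennreal (v x (lam * \<rho>))"
    using le v2 by (intro mult_mono ennreal_leI) auto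
  also have "\<dots> = ennreal (CP * \<rho>) * ?G"
    using v1 by (simp add: mult.assoc ennreal_divide_times mult_divide_eq_ennreal)
  finally show ?thesis by blast
qed

text \<open>On a ball of radius \<open>\<rho>\<close> the integral of \<open>\<Phi>\<close> is at
  most that of its deviation from any constant. The deviation is split at the average:
  \<open>smooth e \<Phi> - \<Phi>\<close> is controlled by \<open>dev e\<close>, the rest by the
  Poincare inequality and \<open>grad e\<close>. Integrating over all centers makes the bound
  global. The constant collects \<open>C * C * (2 * C ^ 4)\<close> and
  \<open>C * C ^ n * (6 * C ^ 10)\<close>; \<open>e \<le> \<rho>\<close> allows
  \<open>\<rho> / e\<close> in front of the former too.\<close>

lemma poincare_scale:
  assumes P: "poincare m \<mu> CP lam" and n: "2 * lam \<le> 2 ^ n" and e: "0 < e" "e \<le> \<rho>"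
    and pos: "\<And>x. x \<in> X \<Longrightarrow> 0 \<le> \<Phi> x"
    and small: "\<And>x. x \<in> X \<Longrightarrow> B x \<rho> \<inter> {x \<in> X. 0 < \<Phi> x} \<noteq> {} \<Longrightarrow>
      2 * emeasure N {x \<in> X. 0 < \<Phi> x} \<le> emeasure N (B x \<rho>)"
  shows "(\<integral>\<^sup>+x. ennreal (\<Phi> x) \<partial>N) \<le> ennreal ((2 * C ^ 6 + 6 * CP * C ^ (n + 11)) * (\<rho> / e)) * dev e"
\<comment> \<open>An infinite right-hand side makes the claim trivial; a finite one makes the
  average integrable, as needed to apply \<open>poincare\<close> to it.\<close>
proof (cases "dev e = \<infinity>")
  case True
  have P': "CP > 0" "lam \<ge> 1" using P by (auto simp: poincare_def)
  define L where "L = (2 * C ^ 6 + 6 * CP * C ^ (n + 11)) * (\<rho> / e)"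
  have "0 < L"
    unfolding L_def using P' e C_pos by (intro mult_pos_pos add_pos_pos divide_pos_pos) auto
  then show ?thesis unfolding L_def[symmetric] using True by (simp add: ennreal_mult_top)
next
  case False
  let ?T = "smooth e \<Phi>"
  have P': "CP > 0" "lam \<ge> 1" using P by (auto simp: poincare_def)
  have \<rho>: "\<rho> > 0" using e by simp
  have [measurable]: "grad e \<in> borel_measurable N"
    using measurable_compose[OF id_N_mborel measurable_grad] by simp
  define D where "D x = ennreal \<bar>?T x - \<Phi> x\<bar>" for x
  have [measurable]: "D \<in> borel_measurable N" unfolding D_def by measurable
  have D: "(\<integral>\<^sup>+x. D x \<partial>N) \<le> ennreal (2 * C ^ 4) * dev e"
    unfolding D_def by (rule nn_integral_smooth_diff[OF e(1)])
  have "ennreal (2 * C ^ 4) * dev e < \<infinity>" using False by (simp add: ennreal_mult_less_top less_top)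
  then have "integrable N (\<lambda>x. ?T x - \<Phi> x)"
    using D by (intro integrableI_bounded) (auto simp: D_def)
  then have "integrable N (\<lambda>x. (?T x - \<Phi> x) + \<Phi> x)"
    using integrable by (rule Bochner_Integration.integrable_add)
  then have iT: "integrable N ?T" by simp
  have ball: "(\<integral>\<^sup>+z. (if d x z < \<rho> then ennreal (\<Phi> z) else 0) \<partial>N) \<le>
      (\<integral>\<^sup>+z. (if d x z < 1 * \<rho> then D z else 0) \<partial>N) + ennreal (CP * \<rho>) * (\<integral>\<^sup>+z. (if d x z < lam * \<rho> then grad e z else 0) \<partial>N)"
    if x: "x \<in> X" for x
  proof (cases "B x \<rho> \<inter> {x \<in> X. 0 < \<Phi> x} = {}")
    case True
    have "(\<integral>\<^sup>+z. (if d x z < \<rho> then ennreal (\<Phi> z) else 0) \<partial>N) = (\<integral>\<^sup>+z. 0 \<partial>N)"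
      using True x pos by (intro nn_integral_cong) (force simp: disjoint_iff not_less)
    then show ?thesis by simp
  next
    case False
    obtain \<tau> where \<tau>: "(\<integral>\<^sup>+z. (if d x z < \<rho> then ennreal \<bar>?T z - \<tau>\<bar> else 0) \<partial>N) \<le>
      ennreal (CP * \<rho>) * (\<integral>\<^sup>+z. (if d x z < lam * \<rho> then grad e z else 0) \<partial>N)"
      using poincare_ball[OF P e(1) \<rho> x iT] by blast
    have [measurable]: "x \<in> space N" using x by simp
    have "2 * emeasure N (B x \<rho> \<inter> {x \<in> X. 0 < \<Phi> x}) \<le> 2 * emeasure N {x \<in> X. 0 < \<Phi> x}"
      by (intro mult_left_mono emeasure_mono) auto
    also have "\<dots> \<le> emeasure N (B x \<rho>)" using x False by (rule small)
    finally have half: "2 * emeasure N (B x \<rho> \<inter> {x \<in> X. 0 < \<Phi> x}) \<le> emeasure N (B x \<rho>)" .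
    have "(\<integral>\<^sup>+z. (if d x z < \<rho> then ennreal (\<Phi> z) else 0) \<partial>N) = (\<integral>\<^sup>+z. ennreal (\<Phi> z) * indicator (B x \<rho>) z \<partial>N)"
      using x by (rule nn_integral_ball_indicator[symmetric])
    also have "\<dots> \<le> (\<integral>\<^sup>+z. ennreal \<bar>\<Phi> z - \<tau>\<bar> * indicator (B x \<rho>) z \<partial>N)"
      using half pos finite_ball by (intro integral_le_deviation) auto
    also have "\<dots> = (\<integral>\<^sup>+z. (if d x z < \<rho> then ennreal \<bar>\<Phi> z - \<tau>\<bar> else 0) \<partial>N)"
      using x by (rule nn_integral_ball_indicator)
    also have "\<dots> \<le> (\<integral>\<^sup>+z. (if d x z < 1 * \<rho> then D z else 0) + (if d x z < \<rho> then ennreal \<bar>?T z - \<tau>\<bar> else 0) \<partial>N)"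
      by (intro nn_integral_mono) (auto simp: D_def ennreal_plus[symmetric] simp del: ennreal_plus intro!: ennreal_leI)
    also have "\<dots> = (\<integral>\<^sup>+z. (if d x z < 1 * \<rho> then D z else 0) \<partial>N) + (\<integral>\<^sup>+z. (if d x z < \<rho> then ennreal \<bar>?T z - \<tau>\<bar> else 0) \<partial>N)"
      by (intro nn_integral_add) measurable
    also have "\<dots> \<le> (\<integral>\<^sup>+z. (if d x z < 1 * \<rho> then D z else 0) \<partial>N) + ennreal (CP * \<rho>) * (\<integral>\<^sup>+z. (if d x z < lam * \<rho> then grad e z else 0) \<partial>N)"
      using \<tau> by (intro add_left_mono)
    finally show ?thesis .
  qed
  define a where "a x = ennreal (1 / v x \<rho>)" for x
  have [measurable]: "a \<in> borel_measurable N" unfolding a_def by measurable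
  define DD where "DD x = (\<integral>\<^sup>+z. (if d x z < 1 * \<rho> then D z else 0) \<partial>N)" for x
  define GG where "GG x = (\<integral>\<^sup>+z. (if d x z < lam * \<rho> then grad e z else 0) \<partial>N)" for x
  have [measurable]: "DD \<in> borel_measurable N" "GG \<in> borel_measurable N"
    unfolding DD_def GG_def by measurable
  have avD: "(\<integral>\<^sup>+x. a x * DD x \<partial>N) \<le> ennreal (C ^ 1) * (\<integral>\<^sup>+z. D z \<partial>N)"
    unfolding a_def DD_def using \<rho> by (intro average_upper) auto
  have avG: "(\<integral>\<^sup>+x. a x * GG x \<partial>N) \<le> ennreal (C ^ n) * (\<integral>\<^sup>+z. grad e z \<partial>N)"
    unfolding a_def GG_def using \<rho> P' n by (intro average_upper) auto
  have inner: "(\<integral>\<^sup>+x. a x * (DD x + ennreal (CP * \<rho>) * GG x) \<partial>N) \<le>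
      ennreal (C ^ 1) * (ennreal (2 * C ^ 4) * dev e) + ennreal (CP * \<rho>) * (ennreal (C ^ n) * (ennreal (6 * C ^ 10 / e) * dev e))"
  proof -
    have "(\<integral>\<^sup>+x. a x * (DD x + ennreal (CP * \<rho>) * GG x) \<partial>N) = (\<integral>\<^sup>+x. a x * DD x + ennreal (CP * \<rho>) * (a x * GG x) \<partial>N)"
      by (intro nn_integral_cong) (simp add: algebra_simps)
    also have "\<dots> = (\<integral>\<^sup>+x. a x * DD x \<partial>N) + ennreal (CP * \<rho>) * (\<integral>\<^sup>+x. a x * GG x \<partial>N)"
      by (subst nn_integral_add) (auto simp: nn_integral_cmult)
    also have "\<dots> \<le> ennreal (C ^ 1) * (ennreal (2 * C ^ 4) * dev e) + ennreal (CP * \<rho>) * (ennreal (C ^ n) * (ennreal (6 * C ^ 10 / e) * dev e))"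
      using D nn_integral_grad[OF e(1)]
      by (intro add_mono mult_left_mono order.trans[OF avD] order.trans[OF avG]) auto
    finally show ?thesis .
  qed
  have "(\<integral>\<^sup>+x. ennreal (\<Phi> x) \<partial>N) \<le> ennreal C * (\<integral>\<^sup>+x. a x * (\<integral>\<^sup>+z. (if d x z < \<rho> then ennreal (\<Phi> z) else 0) \<partial>N) \<partial>N)"
    unfolding a_def using \<rho> by (intro average_lower) measurable
  also have "\<dots> \<le> ennreal C * (\<integral>\<^sup>+x. a x * (DD x + ennreal (CP * \<rho>) * GG x) \<partial>N)"
    using ball unfolding DD_def GG_def by (intro mult_left_mono nn_integral_mono) auto
  also have "\<dots> \<le> ennreal C * (ennreal (C ^ 1) * (ennreal (2 * C ^ 4) * dev e) + ennreal (CP * \<rho>) * (ennreal (C ^ n) * (ennreal (6 * C ^ 10 / e) * dev e)))"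
    using inner by (rule mult_left_mono) simp
  also have "\<dots> = ennreal (C * (C ^ 1 * (2 * C ^ 4) + CP * \<rho> * (C ^ n * (6 * C ^ 10 / e)))) * dev e"
  proof -
    have nn: "0 \<le> C" "0 \<le> C ^ 1" "0 \<le> 2 * C ^ 4" "0 \<le> CP * \<rho>" "0 \<le> C ^ n" "0 \<le> 6 * C ^ 10 / e"
      using C_pos P' \<rho> e by auto
    then show ?thesis by (rule ennreal_sum_prod)
  qed
  also have "\<dots> \<le> ennreal ((2 * C ^ 6 + 6 * CP * C ^ (n + 11)) * (\<rho> / e)) * dev e"
  proof (intro mult_right_mono ennreal_leI)
    have "2 * C ^ 6 * 1 \<le> 2 * C ^ 6 * (\<rho> / e)" using e C_pos by (intro mult_left_mono) auto
    then show "C * (C ^ 1 * (2 * C ^ 4) + CP * \<rho> * (C ^ n * (6 * C ^ 10 / e))) \<le> (2 * C ^ 6 + 6 * CP * C ^ (n + 11)) * (\<rho> / e)"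
      by (simp add: algebra_simps power_add eval_nat_numeral)
  qed auto
  finally show ?thesis .
qed

text \<open>Summing the estimates at the scales \<open>\<rho> / 2 ^ i\<close> with weights \<open>(\<rho> / 2 ^ i) powr (1 - s)\<close>
  yields the factor \<open>1 - s\<close>.\<close>

lemma poincare_small_support_ineq:
  assumes P: "poincare m \<mu> CP lam" and n: "2 * lam \<le> 2 ^ n" and \<rho>: "0 < \<rho>" and s: "1 / 2 \<le> s" "s < 1"
    and pos: "\<And>x. x \<in> X \<Longrightarrow> 0 \<le> \<Phi> x"
    and small: "\<And>x. x \<in> X \<Longrightarrow> B x \<rho> \<inter> {x \<in> X. 0 < \<Phi> x} \<noteq> {} \<Longrightarrow>
      2 * emeasure N {x \<in> X. 0 < \<Phi> x} \<le> emeasure N (B x \<rho>)"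
  shows "(\<integral>\<^sup>+x. ennreal (\<Phi> x) \<partial>N) \<le>
    ennreal (24 * C * (2 * C ^ 6 + 6 * CP * C ^ (n + 11)) * (1 - s) * \<rho> powr s) * energy s \<Phi>"
proof -
  define K where "K = 2 * C ^ 6 + 6 * CP * C ^ (n + 11)"
  have P': "CP > 0" "lam \<ge> 1" using P by (auto simp: poincare_def)
  have K: "K > 0" unfolding K_def using C_pos P' by (intro add_pos_pos) auto
  define e where "e i = \<rho> / 2 ^ i" for i :: nat
  have e: "0 < e i" "e i \<le> \<rho>" for i using \<rho> by (auto simp: e_def field_simps)
  define A where "A = (\<integral>\<^sup>+x. ennreal (\<Phi> x) \<partial>N)"
  have sc: "ennreal (e i powr (1 - s)) * A \<le> ennreal (K * \<rho>) * (ennreal (e i powr (- s)) * dev (e i))" for i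
  proof -
    have "ennreal (e i powr (1 - s)) * A \<le> ennreal (e i powr (1 - s)) * (ennreal (K * (\<rho> / e i)) * dev (e i))"
      unfolding A_def K_def using P n e pos small by (intro mult_left_mono poincare_scale) auto
    also have "\<dots> = ennreal (K * \<rho>) * (ennreal (e i powr (- s)) * dev (e i))"
    proof -
      have "e i powr (1 - s) * (K * (\<rho> / e i)) = K * \<rho> * e i powr (- s)"
        using e(1)[of i] by (simp add: powr_diff powr_minus field_simps)
      then show ?thesis using K \<rho> e(1)[of i]
        by (simp add: mult.assoc[symmetric] ennreal_mult[symmetric] less_imp_le)
    qed
    finally show ?thesis .
  qed
  \<comment> \<open>Here \<open>1 - s\<close> is gained: all scales bound the same integral
    \<open>A\<close>, and their weights add up to at least
    \<open>\<rho> powr (1 - s) / (1 - s)\<close>.\<close>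
  have lhs: "ennreal (\<rho> powr (1 - s) / (1 - s)) * A \<le> (\<Sum>i. ennreal (e i powr (1 - s)) * A)"
  proof -
    have ei: "e i powr (1 - s) = \<rho> powr (1 - s) * 2 powr (- (1 - s) * real i)" for i
    proof -
      have "e i = \<rho> * 2 powr (- real i)"
        by (simp add: e_def powr_minus powr_realpow divide_inverse)
      then have "e i powr (1 - s) = \<rho> powr (1 - s) * (2 powr (- real i)) powr (1 - s)"
        using \<rho> by (simp add: powr_mult)
      then show ?thesis unfolding powr_powr by (simp add: algebra_simps)
    qed
    have "(\<Sum>i. ennreal (e i powr (1 - s))) = ennreal (\<rho> powr (1 - s) / (1 - 2 powr (- (1 - s))))"
      unfolding ei using s by (intro suminf_ennreal_geometric) auto
    moreover have "\<rho> powr (1 - s) / (1 - s) \<le> \<rho> powr (1 - s) / (1 - 2 powr (- (1 - s)))"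
    proof (rule divide_left_mono)
      show "1 - 2 powr (- (1 - s)) \<le> 1 - s" using s by (intro one_minus_two_powr_le) auto
      have "(1 - s) / 2 \<le> 1 - 2 powr (- (1 - s))" using s by (intro one_minus_two_powr_ge) auto
      moreover have "0 < (1 - s) / 2" using s by simp
      ultimately have "0 < 1 - 2 powr (- (1 - s))" by (rule less_le_trans[rotated])
      then show "0 < (1 - s) * (1 - 2 powr (- (1 - s)))" using s by (intro mult_pos_pos) auto
    qed simp
    ultimately have "ennreal (\<rho> powr (1 - s) / (1 - s)) \<le> (\<Sum>i. ennreal (e i powr (1 - s)))"
      by (simp only: ennreal_leI)
    then show ?thesis unfolding ennreal_suminf_multc by (rule mult_right_mono) simp
  qed
  define f where "f i x y = (if d x y < 6 * e i then ennreal (e i powr (- s)) * ennreal (\<bar>\<Phi> x - \<Phi> y\<bar> / v x (6 * e i)) else 0)" for i x y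
  have [measurable]: "(\<lambda>(x, y). f i x y) \<in> borel_measurable (N \<Otimes>\<^sub>M N)" for i unfolding f_def by measurable
  have dev: "ennreal (e i powr (- s)) * dev (e i) = (\<integral>\<^sup>+x. \<integral>\<^sup>+y. f i x y \<partial>N \<partial>N)" for i
  proof -
    have "ennreal (e i powr (- s)) * dev (e i) = (\<integral>\<^sup>+x. ennreal (e i powr (- s)) * (\<integral>\<^sup>+y. (if d x y < 6 * e i then ennreal (\<bar>\<Phi> x - \<Phi> y\<bar> / v x (6 * e i)) else 0) \<partial>N) \<partial>N)"
      unfolding dev_def by (intro nn_integral_cmult[symmetric]) measurable
    also have "\<dots> = (\<integral>\<^sup>+x. \<integral>\<^sup>+y. f i x y \<partial>N \<partial>N)"
      unfolding f_def
      by (intro nn_integral_cong, subst nn_integral_cmult[symmetric], measurable) (auto intro!: nn_integral_cong)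
    finally show ?thesis .
  qed
  have rhs: "(\<Sum>i. ennreal (e i powr (- s)) * dev (e i)) = (\<integral>\<^sup>+x. \<integral>\<^sup>+y. (\<Sum>i. f i x y) \<partial>N \<partial>N)"
    unfolding dev
    by (subst nn_integral_suminf[symmetric], measurable) (intro nn_integral_cong, subst nn_integral_suminf, auto)
  have pt: "(\<Sum>i. f i x y) \<le> ennreal (24 * C) * ennreal (\<bar>\<Phi> x - \<Phi> y\<bar> / kern s x y)" if xy: "x \<in> X" "y \<in> X" for x y
  proof (cases "x = y")
    case True
    then have "f i x y = 0" for i by (simp add: f_def)
    then show ?thesis by simp
  next
    case False
    then have d0: "d x y > 0" using xy by (metis mdist_nonneg mdist_zero order_le_less)
    \<comment> \<open>A pair at distance \<open>d x y\<close> is seen by \<open>dev (e i)\<close>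
      exactly at the scales with \<open>b < e i\<close>. Its contributions grow as the scale
      decreases to \<open>b\<close>, which is the series of
      \<open>suminf_geometric_above\<close>.\<close>
    define b where "b = d x y / 6"
    have b: "b > 0" using d0 by (simp add: b_def)
    have kp: "0 < kern s x y" using xy False by (rule kern_pos)
    define D where "D = \<bar>\<Phi> x - \<Phi> y\<bar> / kern s x y"
    have D: "D \<ge> 0" using kp by (simp add: D_def)
    have "f i x y \<le> ennreal (6 * C * D) * (if b < \<rho> / 2 ^ i then ennreal ((b / (\<rho> / 2 ^ i)) powr s) else 0)" for i
    proof (cases "d x y < 6 * e i")
      case True
      then have bi: "b < \<rho> / 2 ^ i" by (simp add: b_def e_def mult.commute)
      have v6: "v x (6 * e i) > 0" using xy e(1)[of i] by (intro v_pos) auto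
      have "kern s x y \<le> v x (2 * d x y) * d x y powr s" using xy by (rule kern_le)
      also have "\<dots> \<le> (C * v x (6 * e i)) * d x y powr s"
        using xy d0 True by (intro mult_right_mono order.trans[OF v_double] mult_left_mono v_le) (auto simp: C_pos less_imp_le)
      finally have "1 / v x (6 * e i) \<le> C * d x y powr s / kern s x y"
        using v6 kp by (simp add: field_simps)
      then have "e i powr (- s) * \<bar>\<Phi> x - \<Phi> y\<bar> * (1 / v x (6 * e i)) \<le> e i powr (- s) * \<bar>\<Phi> x - \<Phi> y\<bar> * (C * d x y powr s / kern s x y)"
        by (intro mult_left_mono) auto
      also have "\<dots> = C * D * (d x y / e i) powr s"
        using d0 e(1)[of i] by (simp add: D_def powr_divide powr_minus field_simps)
      also have "(d x y / e i) powr s = 6 powr s * (b / e i) powr s"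
        using b e(1)[of i] by (subst powr_mult[symmetric]) (auto simp: b_def)
      also have "C * D * (6 powr s * (b / e i) powr s) \<le> C * D * (6 powr 1 * (b / e i) powr s)"
        using C_pos D s by (intro mult_left_mono mult_right_mono powr_mono) auto
      finally have "e i powr (- s) * (\<bar>\<Phi> x - \<Phi> y\<bar> / v x (6 * e i)) \<le> 6 * C * D * (b / (\<rho> / 2 ^ i)) powr s"
        by (simp add: e_def algebra_simps)
      then show ?thesis using True bi C_pos D
        by (simp add: f_def ennreal_mult[symmetric] ennreal_leI)
    qed (simp add: f_def)
    then have "(\<Sum>i. f i x y) \<le> (\<Sum>i. ennreal (6 * C * D) * (if b < \<rho> / 2 ^ i then ennreal ((b / (\<rho> / 2 ^ i)) powr s) else 0))"
      by (intro suminf_le) auto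
    also have "\<dots> \<le> ennreal (6 * C * D) * ennreal (1 / (1 - 2 powr (- s)))"
      unfolding ennreal_suminf_cmult using b \<rho> s by (intro mult_left_mono suminf_geometric_above) auto
    \<comment> \<open>This is where \<open>1 / 2 \<le> s\<close> enters:
      \<open>1 - 2 powr (- s)\<close> is at least \<open>s / 2\<close>, hence at least 1 /
      4.\<close>
    also have "\<dots> \<le> ennreal (6 * C * D) * ennreal 4"
      using s one_minus_two_powr_ge[of s] by (intro mult_left_mono ennreal_leI) (auto simp: field_simps)
    also have "\<dots> = ennreal (24 * C) * ennreal D"
      using C_pos D by (simp add: ennreal_mult[symmetric] del: ennreal_numeral)
    finally show ?thesis by (simp add: D_def)
  qed
  have "ennreal (\<rho> powr (1 - s) / (1 - s)) * A \<le> (\<Sum>i. ennreal (K * \<rho>) * (ennreal (e i powr (- s)) * dev (e i)))"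
    using sc by (intro order.trans[OF lhs] suminf_le) auto
  also have "\<dots> = ennreal (K * \<rho>) * (\<integral>\<^sup>+x. \<integral>\<^sup>+y. (\<Sum>i. f i x y) \<partial>N \<partial>N)"
    by (simp add: rhs)
  also have "\<dots> \<le> ennreal (K * \<rho>) * (\<integral>\<^sup>+x. \<integral>\<^sup>+y. ennreal (24 * C) * ennreal (\<bar>\<Phi> x - \<Phi> y\<bar> / kern s x y) \<partial>N \<partial>N)"
    using pt by (intro mult_left_mono nn_integral_mono) auto
  also have "(\<integral>\<^sup>+x. \<integral>\<^sup>+y. ennreal (24 * C) * ennreal (\<bar>\<Phi> x - \<Phi> y\<bar> / kern s x y) \<partial>N \<partial>N) = (\<integral>\<^sup>+x. ennreal (24 * C) * (\<integral>\<^sup>+y. ennreal (\<bar>\<Phi> x - \<Phi> y\<bar> / kern s x y) \<partial>N) \<partial>N)"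
    by (intro nn_integral_cong nn_integral_cmult) measurable
  also have "\<dots> = ennreal (24 * C) * energy s \<Phi>"
    unfolding energy_def by (intro nn_integral_cmult) measurable
  finally have main: "ennreal ((1 - s) * \<rho> powr s / \<rho>) * (ennreal (\<rho> powr (1 - s) / (1 - s)) * A) \<le>
      ennreal ((1 - s) * \<rho> powr s / \<rho>) * (ennreal (K * \<rho>) * (ennreal (24 * C) * energy s \<Phi>))"
    by (intro mult_left_mono) auto
  have l: "ennreal ((1 - s) * \<rho> powr s / \<rho>) * (ennreal (\<rho> powr (1 - s) / (1 - s)) * A) = A"
  proof -
    have "(1 - s) * \<rho> powr s / \<rho> * (\<rho> powr (1 - s) / (1 - s)) = 1"
      using s \<rho> by (simp add: powr_diff)
    then show ?thesis using s \<rho> by (simp add: mult.assoc[symmetric] ennreal_mult[symmetric])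
  qed
  have r: "ennreal ((1 - s) * \<rho> powr s / \<rho>) * (ennreal (K * \<rho>) * (ennreal (24 * C) * energy s \<Phi>)) = ennreal (24 * C * K * (1 - s) * \<rho> powr s) * energy s \<Phi>"
  proof -
    have "(1 - s) * \<rho> powr s / \<rho> * (K * \<rho> * (24 * C)) = 24 * C * K * (1 - s) * \<rho> powr s"
      using \<rho> by simp
    then show ?thesis using s \<rho> K C_pos
      by (simp add: mult.assoc[symmetric] ennreal_mult[symmetric]) (simp add: algebra_simps)
  qed
  show ?thesis using main[unfolded l r] unfolding A_def K_def .
qed

end

section \<open>Caccioppoli estimate\<close>

text \<open>If both values are above \<open>k\<close>, each difference is a multiple of
  \<open>a - b\<close> plus a commutator with the cutoff, and the two multiples
  \<open>\<eta>1\<close> and \<open>1 - \<eta>1\<close> add up to 1. If \<open>b < k\<close>, then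
  \<open>W2 = 0\<close> and subtracting \<open>\<eta>1 * W1 \<le> a - b\<close> does not overshoot,
  so nothing is lost.\<close>

lemma truncation_energy_aux:
  fixes a b k :: real
  assumes "0 \<le> \<eta>1" "\<eta>1 \<le> 1" "0 \<le> \<eta>2" "\<eta>2 \<le> 1" "b \<le> a"
  defines "W1 \<equiv> max (a - k) 0" and "W2 \<equiv> max (b - k) 0"
  shows "\<bar>\<eta>1 * W1 - \<eta>2 * W2\<bar> + \<bar>(a - \<eta>1 * W1) - (b - \<eta>2 * W2)\<bar> \<le> \<bar>a - b\<bar> + 2 * \<bar>\<eta>1 - \<eta>2\<bar> * W2"
proof (cases "k \<le> b")
  case True
  then have W: "W1 = a - k" "W2 = b - k" using assms by (auto simp: W1_def W2_def)
  have 1: "\<eta>1 * W1 - \<eta>2 * W2 = \<eta>1 * (a - b) + (\<eta>1 - \<eta>2) * W2" by (simp add: W algebra_simps)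
  have 2: "(a - \<eta>1 * W1) - (b - \<eta>2 * W2) = (1 - \<eta>1) * (a - b) + (\<eta>2 - \<eta>1) * W2" by (simp add: W algebra_simps)
  have "\<bar>\<eta>1 * W1 - \<eta>2 * W2\<bar> \<le> \<bar>\<eta>1 * (a - b)\<bar> + \<bar>(\<eta>1 - \<eta>2) * W2\<bar>" unfolding 1 by (rule abs_triangle_ineq)
  moreover have "\<bar>(a - \<eta>1 * W1) - (b - \<eta>2 * W2)\<bar> \<le> \<bar>(1 - \<eta>1) * (a - b)\<bar> + \<bar>(\<eta>2 - \<eta>1) * W2\<bar>"
    unfolding 2 by (rule abs_triangle_ineq)
  moreover have "\<bar>(\<eta>1 - \<eta>2) * W2\<bar> = \<bar>\<eta>1 - \<eta>2\<bar> * W2" "\<bar>(\<eta>2 - \<eta>1) * W2\<bar> = \<bar>\<eta>1 - \<eta>2\<bar> * W2"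
    using True by (auto simp: W abs_mult)
  moreover have "\<bar>\<eta>1 * (a - b)\<bar> = \<eta>1 * (a - b)" "\<bar>(1 - \<eta>1) * (a - b)\<bar> = (1 - \<eta>1) * (a - b)"
    using assms(1-5) by (auto simp: abs_mult)
  ultimately show ?thesis using assms(5) by (simp add: algebra_simps)
next
  case False
  then have W2: "W2 = 0" by (simp add: W2_def)
  have W1: "0 \<le> W1" "\<eta>1 * W1 \<le> W1" "0 \<le> \<eta>1 * W1" using assms(1,2) by (auto simp: W1_def mult_left_le_one_le)
  show ?thesis
  proof (cases "k \<le> a")
    case True
    then have "W1 = a - k" by (simp add: W1_def)
    then show ?thesis using W1 W2 False by simp
  next
    case F: False
    then have "W1 = 0" by (simp add: W1_def)
    then show ?thesis using W2 by simp
  qed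
qed

text \<open>The pointwise inequality behind the Caccioppoli estimate: \<open>a\<close>, \<open>b\<close> are the values of the
  function at two points, \<open>a - \<eta>1 * w1\<close>, \<open>b - \<eta>2 * w2\<close> those of the competitor.\<close>

lemma truncation_energy:
  fixes a b k :: real
  assumes \<eta>: "0 \<le> \<eta>1" "\<eta>1 \<le> 1" "0 \<le> \<eta>2" "\<eta>2 \<le> 1"
    and w1: "w1 = max (a - k) 0 \<or> w1 = 0 \<and> \<eta>1 = 0" and w2: "w2 = max (b - k) 0 \<or> w2 = 0 \<and> \<eta>2 = 0"
  shows "\<bar>\<eta>1 * w1 - \<eta>2 * w2\<bar> + \<bar>(a - \<eta>1 * w1) - (b - \<eta>2 * w2)\<bar> \<le> \<bar>a - b\<bar> + 2 * \<bar>\<eta>1 - \<eta>2\<bar> * (w1 + w2)"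
proof -
  define W1 W2 where "W1 = max (a - k) 0" and "W2 = max (b - k) 0"
  have e: "\<eta>1 * w1 = \<eta>1 * W1" "\<eta>2 * w2 = \<eta>2 * W2" using w1 w2 by (auto simp: W1_def W2_def)
  have "\<bar>\<eta>1 * W1 - \<eta>2 * W2\<bar> + \<bar>(a - \<eta>1 * W1) - (b - \<eta>2 * W2)\<bar> \<le> \<bar>a - b\<bar> + 2 * (\<bar>\<eta>1 - \<eta>2\<bar> * min W1 W2)"
  proof (cases "b \<le> a")
    case True
    then have "min W1 W2 = W2" by (auto simp: W1_def W2_def)
    then show ?thesis using truncation_energy_aux[OF \<eta> True, of k] by (simp add: W1_def W2_def)
  next
    case False
    then have ab: "a \<le> b" and "min W1 W2 = W1" by (auto simp: W1_def W2_def)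
    then show ?thesis using truncation_energy_aux[OF \<eta>(3,4,1,2) ab, of k]
      by (simp add: W1_def[symmetric] W2_def[symmetric] abs_minus_commute)
  qed
  \<comment> \<open>The values \<open>w1\<close>, \<open>w2\<close> may have been set to 0 where the
    cutoff vanishes. If both cutoffs vanish the term is 0; otherwise one of \<open>w1\<close>,
    \<open>w2\<close> is the true positive part and dominates the minimum.\<close>
  moreover have "\<bar>\<eta>1 - \<eta>2\<bar> * min W1 W2 \<le> \<bar>\<eta>1 - \<eta>2\<bar> * (w1 + w2)"
  proof (cases "\<eta>1 = 0 \<and> \<eta>2 = 0")
    case False
    have "0 \<le> w1" "0 \<le> w2" using w1 w2 by auto
    moreover have "w1 = W1 \<or> w2 = W2" using False w1 w2 by (auto simp: W1_def W2_def)
    ultimately have "min W1 W2 \<le> w1 + w2" by auto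
    then show ?thesis by (intro mult_left_mono) auto
  qed simp
  ultimately show ?thesis unfolding e by simp
qed

text \<open>The negative part is moved to the other side, so that the inequality can be integrated
  without subtraction. The second claim records that the error \<open>n\<close> alone controls the
  negative part.\<close>

lemma pos_neg_parts_le:
  assumes le: "enn2ereal p \<le> f + enn2ereal n"
  shows "p + e2ennreal (- f) \<le> e2ennreal f + n" and "e2ennreal (- f) \<le> n"
proof -
  have "p + e2ennreal (- f) \<le> e2ennreal f + n \<and> e2ennreal (- f) \<le> n"
  proof (cases "n = top \<or> f = \<infinity>")
    case True
    then show ?thesis by (auto simp: e2ennreal_neg)
  next
    case False
    then obtain b where b: "n = ennreal b" "0 \<le> b" by (cases n) auto
    have "f \<noteq> -\<infinity>" using le enn2ereal_nonneg[of p] by (auto simp: b enn2ereal_ennreal)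
    then obtain r where r: "f = ereal r" using False by (cases f) auto
    have "p \<noteq> top" using le by (auto simp: b r enn2ereal_ennreal top_ereal_def)
    then obtain a where a: "p = ennreal a" "0 \<le> a" by (cases p) auto
    have "a \<le> r + b" using le by (simp add: a b r enn2ereal_ennreal)
    have rb: "- r \<le> b" using \<open>a \<le> r + b\<close> a(2) by linarith
    have "ennreal a + ennreal (- r) \<le> ennreal r + ennreal b"
    proof (cases "0 \<le> r")
      case True
      then show ?thesis using \<open>a \<le> r + b\<close> a(2) b(2)
        by (simp add: ennreal_neg ennreal_plus[symmetric] ennreal_leI del: ennreal_plus)
    next
      case False
      have "ennreal (a + - r) \<le> ennreal b" using \<open>a \<le> r + b\<close> by (intro ennreal_leI) linarith
      then show ?thesis using False a(2) ennreal_plus[of a "- r"] by (simp add: ennreal_neg)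
    qed
    then show ?thesis using ennreal_leI[OF rb] by (simp add: a b r)
  qed
  then show "p + e2ennreal (- f) \<le> e2ennreal f + n" "e2ennreal (- f) \<le> n" by auto
qed

text \<open>The way back to a difference after integration. The second hypothesis ensures that an
  infinite \<open>Fm\<close> occurs only together with an infinite \<open>Nn\<close>, in which case
  the right-hand side is infinite.\<close>

lemma ennreal_le_diffI:
  assumes "P + Fm \<le> Fp + Nn" "Fm \<le> Nn"
  shows "enn2ereal P \<le> (enn2ereal Fp - enn2ereal Fm) + enn2ereal Nn"
proof (cases "Nn = top")
  case False
  then obtain b where b: "Nn = ennreal b" "0 \<le> b" by (cases Nn) auto
  have "Fm \<noteq> top" using assms(2) False by (auto simp: top_unique)
  then obtain c where c: "Fm = ennreal c" "0 \<le> c" by (cases Fm) auto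
  show ?thesis
  proof (cases "Fp = top")
    case False
    then obtain e where e: "Fp = ennreal e" "0 \<le> e" by (cases Fp) auto
    have "P \<noteq> top" using assms(1) by (auto simp: b c e top_unique ennreal_plus[symmetric] simp del: ennreal_plus)
    then obtain a where a: "P = ennreal a" "0 \<le> a" by (cases P) auto
    have "a + c \<le> e + b" using assms(1) a b c e by (simp add: ennreal_plus[symmetric] del: ennreal_plus)
    then show ?thesis using a b c e by (simp add: enn2ereal_ennreal)
  qed (simp add: b c enn2ereal_ennreal top_ereal_def)
qed (simp add: top_ereal_def)

text \<open>Monotonicity for the integral defined by positive and negative parts, without assuming
  either part finite. It is applied to the inner and then to the outer integral of
  \<open>F_functional\<close>.\<close>

lemma ereal_integral_ge:
  assumes [measurable]: "f \<in> borel_measurable M" "p \<in> borel_measurable M" "n \<in> borel_measurable M" "A \<in> sets M"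
    and le: "\<And>x. x \<in> A \<Longrightarrow> enn2ereal (p x) \<le> f x + enn2ereal (n x)"
  shows "enn2ereal (\<integral>\<^sup>+x\<in>A. p x \<partial>M) \<le> ereal_integral M A f + enn2ereal (\<integral>\<^sup>+x\<in>A. n x \<partial>M)"
proof -
  define P Nn Fp Fm where "P = (\<integral>\<^sup>+x\<in>A. p x \<partial>M)" and "Nn = (\<integral>\<^sup>+x\<in>A. n x \<partial>M)"
    and "Fp = (\<integral>\<^sup>+x\<in>A. e2ennreal (f x) \<partial>M)" and "Fm = (\<integral>\<^sup>+x\<in>A. e2ennreal (- f x) \<partial>M)"
  have pt: "p x + e2ennreal (- f x) \<le> e2ennreal (f x) + n x" "e2ennreal (- f x) \<le> n x" if "x \<in> A" for x
    using pos_neg_parts_le[OF le[OF that]] by auto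
  have "P + Fm = (\<integral>\<^sup>+x\<in>A. (p x + e2ennreal (- f x)) \<partial>M)"
    unfolding P_def Fm_def by (subst nn_integral_add[symmetric]) (auto intro!: nn_integral_cong simp: distrib_right)
  also have "\<dots> \<le> (\<integral>\<^sup>+x\<in>A. (e2ennreal (f x) + n x) \<partial>M)"
    using pt(1) by (intro nn_integral_mono) (auto simp: indicator_def)
  also have "\<dots> = Fp + Nn"
    unfolding Fp_def Nn_def by (subst nn_integral_add[symmetric]) (auto intro!: nn_integral_cong simp: distrib_right)
  finally have 1: "P + Fm \<le> Fp + Nn" .
  have 2: "Fm \<le> Nn"
    unfolding Fm_def Nn_def using pt(2) by (intro nn_integral_mono) (auto simp: indicator_def)
  have "enn2ereal P \<le> (enn2ereal Fp - enn2ereal Fm) + enn2ereal Nn"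
    using 1 2 by (rule ennreal_le_diffI)
  then show ?thesis by (simp add: ereal_integral_def P_def Nn_def Fp_def Fm_def)
qed

context doubling_mms
begin

lemma divide_kernel:
  assumes "x \<in> X" "y \<in> X" "0 \<le> t" "x = y \<Longrightarrow> t = 0"
  shows "ennreal t / kernel m \<mu> s x y = ennreal (t / kern s x y)"
proof (cases "x = y")
  case False
  then show ?thesis using assms kern_pos[OF assms(1,2), of s] by (simp add: kernel_eq divide_ennreal)
qed (use assms in simp)

lemma seminorm_ereal: "seminorm_Ws1 m \<mu> s X (\<lambda>x. ereal (h x)) = energy s h"
  unfolding seminorm_Ws1_def energy_def
proof (intro nn_integral_cong)
  fix y assume y: "y \<in> space N"
  have "(\<integral>\<^sup>+x\<in>X. e2ennreal \<bar>ereal (h x) - ereal (h y)\<bar> / kernel m \<mu> s x y \<partial>N) =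
    (\<integral>\<^sup>+x. ennreal (\<bar>h y - h x\<bar> / kern s y x) \<partial>N)"
    using y by (intro nn_integral_cong) (simp add: divide_kernel abs_minus_commute[of "h y"] kern_sym[of s y])
  then show "(\<integral>\<^sup>+x\<in>X. e2ennreal \<bar>ereal (h x) - ereal (h y)\<bar> / kernel m \<mu> s x y \<partial>N) * indicator X y =
    (\<integral>\<^sup>+x. ennreal (\<bar>h y - h x\<bar> / kern s y x) \<partial>N)"
    using y by simp
qed

lemma measurable_kernel [measurable]: "(\<lambda>p. kernel m \<mu> s (fst p) (snd p)) \<in> borel_measurable (N \<Otimes>\<^sub>M N)"
proof -
  have "(\<lambda>p. ennreal (kern s (fst p) (snd p))) \<in> borel_measurable (N \<Otimes>\<^sub>M N)" by measurable
  then show ?thesis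
    by (rule measurable_cong[THEN iffD1, rotated]) (auto simp: space_pair_measure kernel_eq)
qed

lemma nn_integral_add2:
  assumes [measurable]: "(\<lambda>(x, y). f x y) \<in> borel_measurable (N \<Otimes>\<^sub>M N)" "(\<lambda>(x, y). g x y) \<in> borel_measurable (N \<Otimes>\<^sub>M N)"
  shows "(\<integral>\<^sup>+y. \<integral>\<^sup>+x. f x y + g x y \<partial>N \<partial>N) = (\<integral>\<^sup>+y. \<integral>\<^sup>+x. f x y \<partial>N \<partial>N) + (\<integral>\<^sup>+y. \<integral>\<^sup>+x. g x y \<partial>N \<partial>N)"
proof -
  have "(\<integral>\<^sup>+y. \<integral>\<^sup>+x. f x y + g x y \<partial>N \<partial>N) = (\<integral>\<^sup>+y. (\<integral>\<^sup>+x. f x y \<partial>N) + (\<integral>\<^sup>+x. g x y \<partial>N) \<partial>N)"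
    by (intro nn_integral_cong nn_integral_add) measurable
  also have "\<dots> = (\<integral>\<^sup>+y. \<integral>\<^sup>+x. f x y \<partial>N \<partial>N) + (\<integral>\<^sup>+y. \<integral>\<^sup>+x. g x y \<partial>N \<partial>N)"
    by (intro nn_integral_add) measurable
  finally show ?thesis .
qed

text \<open>Symmetry identifies the two mixed blocks, which is the origin of the factor 2 in
  \<open>F_functional\<close>.\<close>

lemma nn_integral_split_symmetric:
  assumes [measurable]: "(\<lambda>(x, y). h x y) \<in> borel_measurable (N \<Otimes>\<^sub>M N)" "\<Omega> \<in> sets N"
    and sym: "\<And>x y. h x y = h y x"
  shows "(\<integral>\<^sup>+y. \<integral>\<^sup>+x. h x y \<partial>N \<partial>N) = (\<integral>\<^sup>+y\<in>\<Omega>. (\<integral>\<^sup>+x\<in>\<Omega>. h x y \<partial>N) \<partial>N) +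
    2 * (\<integral>\<^sup>+y\<in>\<Omega>. (\<integral>\<^sup>+x\<in>X - \<Omega>. h x y \<partial>N) \<partial>N) + (\<integral>\<^sup>+y\<in>X - \<Omega>. (\<integral>\<^sup>+x\<in>X - \<Omega>. h x y \<partial>N) \<partial>N)"
proof -
  have [measurable]: "X - \<Omega> \<in> sets N" by measurable
  define J where "J A D = (\<integral>\<^sup>+y\<in>A. (\<integral>\<^sup>+x\<in>D. h x y \<partial>N) \<partial>N)" for A D
  have inner: "(\<integral>\<^sup>+x. h x y \<partial>N) = (\<integral>\<^sup>+x\<in>\<Omega>. h x y \<partial>N) + (\<integral>\<^sup>+x\<in>X - \<Omega>. h x y \<partial>N)" if "y \<in> space N" for y
    using that by (subst nn_integral_add[symmetric]) (auto intro!: nn_integral_cong simp: indicator_def)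
  have outer: "(\<integral>\<^sup>+y. q y \<partial>N) = (\<integral>\<^sup>+y\<in>\<Omega>. q y \<partial>N) + (\<integral>\<^sup>+y\<in>X - \<Omega>. q y \<partial>N)" if [measurable]: "q \<in> borel_measurable N" for q
    by (subst nn_integral_add[symmetric]) (auto intro!: nn_integral_cong simp: indicator_def)
  have "(\<integral>\<^sup>+y. \<integral>\<^sup>+x. h x y \<partial>N \<partial>N) = (\<integral>\<^sup>+y. (\<integral>\<^sup>+x\<in>\<Omega>. h x y \<partial>N) + (\<integral>\<^sup>+x\<in>X - \<Omega>. h x y \<partial>N) \<partial>N)"
    using inner by (intro nn_integral_cong)
  also have "\<dots> = (\<integral>\<^sup>+y. (\<integral>\<^sup>+x\<in>\<Omega>. h x y \<partial>N) \<partial>N) + (\<integral>\<^sup>+y. (\<integral>\<^sup>+x\<in>X - \<Omega>. h x y \<partial>N) \<partial>N)"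
    by (intro nn_integral_add) measurable
  also have "\<dots> = (J \<Omega> \<Omega> + J (X - \<Omega>) \<Omega>) + (J \<Omega> (X - \<Omega>) + J (X - \<Omega>) (X - \<Omega>))"
    unfolding J_def by (intro arg_cong2[where f="(+)"] outer) measurable
  also have "J (X - \<Omega>) \<Omega> = J \<Omega> (X - \<Omega>)"
  proof -
    have "J (X - \<Omega>) \<Omega> = (\<integral>\<^sup>+y. \<integral>\<^sup>+x. h x y * indicator \<Omega> x * indicator (X - \<Omega>) y \<partial>N \<partial>N)"
      unfolding J_def by (intro nn_integral_cong nn_integral_multc[symmetric]) measurable
    also have "\<dots> = (\<integral>\<^sup>+x. \<integral>\<^sup>+y. h x y * indicator \<Omega> x * indicator (X - \<Omega>) y \<partial>N \<partial>N)"
      by (intro nn_integral_swap) measurable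
    also have "\<dots> = (\<integral>\<^sup>+x. \<integral>\<^sup>+y. h y x * indicator (X - \<Omega>) y * indicator \<Omega> x \<partial>N \<partial>N)"
      using sym by (simp add: ac_simps)
    also have "\<dots> = J \<Omega> (X - \<Omega>)"
      unfolding J_def by (intro nn_integral_cong nn_integral_multc) measurable
    finally show ?thesis .
  qed
  finally show ?thesis by (simp add: J_def mult_2 ac_simps)
qed

end

section \<open>The truncated test function and its competitor\<close>

locale truncation = doubling_mms m \<mu> C
  for m :: "'a metric" and \<mu> :: "'a set \<Rightarrow> ennreal" and C :: real +
  fixes u :: "'a \<Rightarrow> ereal" and x0 :: 'a and r1 r2 k s :: real
  assumes u [measurable]: "u \<in> borel_measurable N" and x0: "x0 \<in> X" and r12: "r1 < r2"
    and s: "0 < s" "s < 1"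
begin

definition cutoff :: "'a \<Rightarrow> real" where
  "cutoff x = max 0 (min 1 ((r2 - d x0 x) / (r2 - r1)))"

text \<open>\<^const>\<open>real_of_ereal\<close> sends \<open>\<infinity>\<close> to \<open>0\<close>; points where \<open>u\<close> is infinite do no harm, since all
  differences involving them are \<open>\<infinity>\<close>.\<close>

definition excess :: "'a \<Rightarrow> real" where
  "excess x = real_of_ereal (max (u x - ereal k) 0) * indicator (B x0 r2) x"

definition test :: "'a \<Rightarrow> real" where
  "test x = cutoff x * excess x"

text \<open>The remainder of \<open>truncation_energy\<close>, divided by the kernel.\<close>

definition error :: "'a \<Rightarrow> 'a \<Rightarrow> ennreal" where
  "error x y = ennreal (2 * \<bar>cutoff x - cutoff y\<bar> * (excess x + excess y) / kern s x y)"

definition quot :: "'a \<Rightarrow> 'a \<Rightarrow> ennreal" where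
  "quot x y = ennreal (\<bar>test x - test y\<bar> / kern s x y)"

text \<open>Adding a negative number instead of subtracting matches the perturbation
  \<open>u x + \<eta> x\<close> in \<open>subminimizer\<close> literally.\<close>

definition competitor :: "'a \<Rightarrow> ereal" where
  "competitor x = u x + ereal (- test x)"

lemma cutoff_bounds: "0 \<le> cutoff x" "cutoff x \<le> 1" by (auto simp: cutoff_def)

lemma cutoff_1: "d x0 x \<le> r1 \<Longrightarrow> cutoff x = 1"
  using r12 by (simp add: cutoff_def)

lemma cutoff_0: "r2 \<le> d x0 x \<Longrightarrow> cutoff x = 0"
  using r12 by (simp add: cutoff_def divide_nonpos_pos)

lemma cutoff_diff: assumes "x \<in> X" "y \<in> X" shows "\<bar>cutoff x - cutoff y\<bar> \<le> min (d x y / (r2 - r1)) 1"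
proof -
  have "\<bar>d x0 x - d x0 y\<bar> \<le> d x y"
    using d_triangle[of x0 x y] d_triangle[of x0 y x] assms x0 by (auto simp: mdist_commute)
  then have "\<bar>(r2 - d x0 x) / (r2 - r1) - (r2 - d x0 y) / (r2 - r1)\<bar> \<le> d x y / (r2 - r1)"
    using r12 by (simp add: diff_divide_distrib[symmetric] divide_right_mono)
  moreover have "\<bar>cutoff x - cutoff y\<bar> \<le> 1" using cutoff_bounds[of x] cutoff_bounds[of y] by linarith
  moreover have "\<bar>max 0 (min 1 p) - max 0 (min 1 q)\<bar> \<le> \<bar>p - q\<bar>" for p q :: real
    by (auto simp: min_def max_def)
  ultimately show ?thesis unfolding cutoff_def by (meson min.boundedI order_trans)
qed

lemma excess_nonneg [simp]: "0 \<le> excess x"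
  by (auto simp: excess_def real_of_ereal_pos)

lemma test_nonneg [simp]: "0 \<le> test x" using cutoff_bounds by (simp add: test_def)

lemma test_le_excess: "test x \<le> excess x" using cutoff_bounds by (simp add: test_def mult_left_le_one_le)

lemma measurable_truncation [measurable]: "cutoff \<in> borel_measurable N" "excess \<in> borel_measurable N"
    "test \<in> borel_measurable N" "competitor \<in> borel_measurable N"
proof -
  have [measurable]: "x0 \<in> space N" using x0 by simp
  show 1: "cutoff \<in> borel_measurable N" unfolding cutoff_def by measurable
  show 2: "excess \<in> borel_measurable N" unfolding excess_def by measurable
  show "test \<in> borel_measurable N" unfolding test_def using 1 2 by measurable
  then show "competitor \<in> borel_measurable N" unfolding competitor_def by measurable
qed

lemma measurable_error [measurable]: "(\<lambda>(x, y). error x y) \<in> borel_measurable (N \<Otimes>\<^sub>M N)"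
  unfolding error_def by measurable

lemma measurable_quot [measurable]: "(\<lambda>(x, y). quot x y) \<in> borel_measurable (N \<Otimes>\<^sub>M N)"
  unfolding quot_def by measurable

lemma error_sym: "error x y = error y x" and quot_sym: "quot x y = quot y x"
  by (simp_all add: error_def quot_def kern_sym abs_minus_commute add.commute)

lemma excess_cases:
  assumes "u x = ereal a" "x \<in> X" shows "excess x = max (a - k) 0 \<or> excess x = 0 \<and> cutoff x = 0"
proof (cases "x \<in> B x0 r2")
  case True
  have "max (ereal (a - k)) 0 = ereal (max (a - k) 0)" by (simp add: max_def)
  then have "real_of_ereal (max (ereal (a - k)) 0) = max (a - k) 0" by (simp only: real_of_ereal.simps)
  then show ?thesis using True assms by (simp add: excess_def)
next
  case False
  then have "r2 \<le> d x0 x" using assms x0 by auto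
  then show ?thesis using False cutoff_0 by (auto simp: excess_def)
qed

lemma energy_real:
  assumes "x \<in> X" "y \<in> X" "u x = ereal a" "u y = ereal b"
  shows "\<bar>test x - test y\<bar> + \<bar>(a - test x) - (b - test y)\<bar> \<le> \<bar>a - b\<bar> + 2 * \<bar>cutoff x - cutoff y\<bar> * (excess x + excess y)"
  unfolding test_def using assms by (intro truncation_energy[where k=k] cutoff_bounds excess_cases)

text \<open>If \<open>u\<close> is infinite at one of the points, the integrand is
  \<open>\<infinity>\<close> by the convention for \<open>\<infinity> - \<infinity>\<close>, and
  there is nothing to prove. Elsewhere this is \<open>truncation_energy\<close> divided by the
  kernel.\<close>

lemma energy_F:
  assumes "x \<in> X" "y \<in> X"
  shows "enn2ereal (quot x y) \<le> F_integrand m \<mu> s u competitor x y + enn2ereal (error x y)"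
proof (cases "\<bar>u x\<bar> = \<infinity> \<or> \<bar>u y\<bar> = \<infinity>")
  case True
  then have 1: "\<bar>u x - u y\<bar> = \<infinity>" by (cases "u x"; cases "u y") auto
  have "F_integrand m \<mu> s u competitor x y = \<infinity>"
    using assms by (auto simp: F_integrand_def 1 kernel_eq enn2ereal_ennreal divide_ereal_def less_le)
  then show ?thesis by simp
next
  case False
  then obtain a b where ab: "u x = ereal a" "u y = ereal b" by (cases "u x"; cases "u y") auto
  show ?thesis
  proof (cases "x = y")
    case True
    then show ?thesis using assms ab
      by (simp add: quot_def error_def F_integrand_def kern_diag competitor_def zero_ereal_def[symmetric])
  next
    case False
    then have kp: "kern s x y > 0" using assms by (intro kern_pos)
    have F: "F_integrand m \<mu> s u competitor x y = ereal ((\<bar>a - b\<bar> - \<bar>(a - test x) - (b - test y)\<bar>) / kern s x y)"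
      using assms ab kp by (simp add: F_integrand_def kernel_eq competitor_def enn2ereal_ennreal)
    show ?thesis using energy_real[OF assms ab] kp
      by (simp add: F quot_def error_def enn2ereal_ennreal add_divide_distrib[symmetric] divide_right_mono)
  qed
qed

lemma energy_seminorm:
  assumes "x \<in> X" "y \<in> X"
  shows "quot x y + e2ennreal \<bar>competitor x - competitor y\<bar> / kernel m \<mu> s x y \<le> e2ennreal \<bar>u x - u y\<bar> / kernel m \<mu> s x y + error x y"
proof (cases "\<bar>u x\<bar> = \<infinity> \<or> \<bar>u y\<bar> = \<infinity>")
  case True
  then have 1: "\<bar>u x - u y\<bar> = \<infinity>" by (cases "u x"; cases "u y") auto
  have "e2ennreal \<bar>u x - u y\<bar> / kernel m \<mu> s x y = \<infinity>"
    using assms by (auto simp: 1 kernel_eq ennreal_top_divide)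
  then show ?thesis by simp
next
  case False
  then obtain a b where ab: "u x = ereal a" "u y = ereal b" by (cases "u x"; cases "u y") auto
  show ?thesis
  proof (cases "x = y")
    case True
    then show ?thesis using assms ab
      by (simp add: quot_def error_def kern_diag competitor_def zero_ereal_def[symmetric])
  next
    case False
    then have kp: "kern s x y > 0" using assms by (intro kern_pos)
    show ?thesis using energy_real[OF assms ab] kp assms ab
      by (simp add: kernel_eq competitor_def quot_def error_def divide_ennreal ennreal_plus[symmetric] add_divide_distrib[symmetric]
        divide_right_mono ennreal_leI del: ennreal_plus)
  qed
qed

text \<open>Needed since a subminimizer is only known to have finite energy on
  \<open>\<Omega>\<close>: a pair with a point outside \<open>\<Omega>\<close> is controlled by the
  error alone, because cutoff and excess vanish there. Hence the test function has finite energy on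
  the whole space.\<close>

lemma quot_le:
  assumes xy: "x \<in> X" "y \<in> X" and "B x0 r2 \<subseteq> \<Omega>"
  shows "quot x y \<le> (if x \<in> \<Omega> \<and> y \<in> \<Omega> then e2ennreal \<bar>u x - u y\<bar> / kernel m \<mu> s x y else 0) + error x y"
proof (cases "x \<in> \<Omega> \<and> y \<in> \<Omega>")
  case True
  have "quot x y \<le> quot x y + e2ennreal \<bar>competitor x - competitor y\<bar> / kernel m \<mu> s x y" by simp
  also have "\<dots> \<le> e2ennreal \<bar>u x - u y\<bar> / kernel m \<mu> s x y + error x y" using xy by (rule energy_seminorm)
  finally show ?thesis using True by simp
next
  case False
  have z: "cutoff z = 0 \<and> excess z = 0" if "z \<in> X" "z \<notin> \<Omega>" for z
    using that assms(3) cutoff_0[of z] x0 by (force simp: excess_def indicator_def)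
  have "\<bar>test x - test y\<bar> \<le> 2 * \<bar>cutoff x - cutoff y\<bar> * (excess x + excess y)"
  proof (cases "x \<in> \<Omega>")
    case True
    then have "y \<notin> \<Omega>" using False by simp
    then show ?thesis using z[OF xy(2)] cutoff_bounds[of x] by (simp add: test_def)
  next
    case F: False
    then show ?thesis using z[OF xy(1)] cutoff_bounds[of y] by (simp add: test_def)
  qed
  then have "quot x y \<le> error x y" by (simp add: quot_def error_def divide_right_mono ennreal_leI)
  then show ?thesis using False by (auto simp: add_increasing)
qed

text \<open>The constant 16 consists of the 4 of \<open>kernel_tail\<close>, the 2 in
  \<open>error\<close>, and another 2 because the summands with \<open>excess x\<close> and
  \<open>excess y\<close> have equal integrals by symmetry.\<close>

lemma error_total:
  "(\<integral>\<^sup>+y. \<integral>\<^sup>+x. error x y \<partial>N \<partial>N) \<le> ennreal (16 * C / (s * (1 - s)) * (r2 - r1) powr (- s)) * (\<integral>\<^sup>+x. ennreal (excess x) \<partial>N)"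
proof -
  define K where "K = 4 * C / (s * (1 - s)) * (r2 - r1) powr (- s)"
  have K: "K \<ge> 0" using C_pos s by (simp add: K_def)
  define h where "h x y = ennreal (\<bar>cutoff x - cutoff y\<bar> / kern s x y)" for x y
  have [measurable]: "(\<lambda>(x, y). h x y) \<in> borel_measurable (N \<Otimes>\<^sub>M N)" unfolding h_def by measurable
  have hsym: "h x y = h y x" for x y by (simp add: h_def kern_sym abs_minus_commute)
  have h: "(\<integral>\<^sup>+y. h x y \<partial>N) \<le> ennreal K" if x: "x \<in> X" for x
  proof -
    have "(\<integral>\<^sup>+y. h x y \<partial>N) \<le> (\<integral>\<^sup>+y. ennreal (min (d x y / (r2 - r1)) 1 / kern s x y) \<partial>N)"
      unfolding h_def using cutoff_diff[OF x] by (intro nn_integral_mono ennreal_leI divide_right_mono) auto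
    also have "\<dots> \<le> ennreal K" unfolding K_def using x s r12 by (intro kernel_tail) auto
    finally show ?thesis .
  qed
  define W where "W = (\<integral>\<^sup>+x. ennreal (excess x) \<partial>N)"
  have half: "(\<integral>\<^sup>+x. \<integral>\<^sup>+y. ennreal (excess x) * h x y \<partial>N \<partial>N) \<le> ennreal K * W"
  proof -
    have "(\<integral>\<^sup>+x. \<integral>\<^sup>+y. ennreal (excess x) * h x y \<partial>N \<partial>N) = (\<integral>\<^sup>+x. ennreal (excess x) * (\<integral>\<^sup>+y. h x y \<partial>N) \<partial>N)"
      by (intro nn_integral_cong nn_integral_cmult) measurable
    also have "\<dots> \<le> (\<integral>\<^sup>+x. ennreal (excess x) * ennreal K \<partial>N)" using h by (intro nn_integral_mono mult_left_mono) auto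
    also have "\<dots> = ennreal K * W" unfolding W_def by (subst nn_integral_multc) (auto simp: mult.commute)
    finally show ?thesis .
  qed
  have "(\<integral>\<^sup>+y. \<integral>\<^sup>+x. error x y \<partial>N \<partial>N) = (\<integral>\<^sup>+y. \<integral>\<^sup>+x. 2 * (ennreal (excess x) * h x y) + 2 * (ennreal (excess y) * h x y) \<partial>N \<partial>N)"
  proof (intro nn_integral_cong)
    fix x y
    define p where "p = \<bar>cutoff x - cutoff y\<bar> / kern s x y"
    have p: "0 \<le> p" by (simp add: p_def)
    have "2 * \<bar>cutoff x - cutoff y\<bar> * (excess x + excess y) / kern s x y = 2 * (excess x * p) + 2 * (excess y * p)"
      by (simp add: p_def algebra_simps add_divide_distrib)
    then show "error x y = 2 * (ennreal (excess x) * h x y) + 2 * (ennreal (excess y) * h x y)"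
      using p unfolding error_def h_def p_def[symmetric] by (simp add: ennreal_mult ennreal_plus)
  qed
  also have "\<dots> = (\<integral>\<^sup>+y. (\<integral>\<^sup>+x. 2 * (ennreal (excess x) * h x y) \<partial>N) + (\<integral>\<^sup>+x. 2 * (ennreal (excess y) * h x y) \<partial>N) \<partial>N)"
    by (intro nn_integral_cong nn_integral_add) measurable
  also have "\<dots> = (\<integral>\<^sup>+y. (\<integral>\<^sup>+x. 2 * (ennreal (excess x) * h x y) \<partial>N) \<partial>N) + (\<integral>\<^sup>+y. (\<integral>\<^sup>+x. 2 * (ennreal (excess y) * h x y) \<partial>N) \<partial>N)"
    by (intro nn_integral_add) measurable
  also have "(\<integral>\<^sup>+y. (\<integral>\<^sup>+x. 2 * (ennreal (excess y) * h x y) \<partial>N) \<partial>N) = (\<integral>\<^sup>+x. (\<integral>\<^sup>+y. 2 * (ennreal (excess x) * h x y) \<partial>N) \<partial>N)"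
    using hsym by simp
  also have "(\<integral>\<^sup>+y. (\<integral>\<^sup>+x. 2 * (ennreal (excess x) * h x y) \<partial>N) \<partial>N) = (\<integral>\<^sup>+x. (\<integral>\<^sup>+y. 2 * (ennreal (excess x) * h x y) \<partial>N) \<partial>N)"
    by (intro nn_integral_swap) measurable
  also have "(\<integral>\<^sup>+x. (\<integral>\<^sup>+y. 2 * (ennreal (excess x) * h x y) \<partial>N) \<partial>N) = (\<integral>\<^sup>+x. 2 * (\<integral>\<^sup>+y. ennreal (excess x) * h x y \<partial>N) \<partial>N)"
    by (intro nn_integral_cong nn_integral_cmult) measurable
  also have "\<dots> = 2 * (\<integral>\<^sup>+x. (\<integral>\<^sup>+y. ennreal (excess x) * h x y \<partial>N) \<partial>N)" by (intro nn_integral_cmult) measurable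
  also have "2 * (\<integral>\<^sup>+x. (\<integral>\<^sup>+y. ennreal (excess x) * h x y \<partial>N) \<partial>N) + 2 * (\<integral>\<^sup>+x. (\<integral>\<^sup>+y. ennreal (excess x) * h x y \<partial>N) \<partial>N) \<le>
      2 * (ennreal K * W) + 2 * (ennreal K * W)"
    using half by (intro add_mono mult_left_mono) auto
  also have "\<dots> = ennreal 4 * ennreal K * W"
    by (simp add: mult.assoc distrib_right[symmetric])
  also have "ennreal 4 * ennreal K = ennreal (16 * C / (s * (1 - s)) * (r2 - r1) powr (- s))"
    using K by (subst ennreal_mult[symmetric]) (auto simp: K_def)
  finally show ?thesis by (simp add: W_def)
qed

lemma energy_eq: "energy s test = (\<integral>\<^sup>+y. \<integral>\<^sup>+x. quot x y \<partial>N \<partial>N)"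
  unfolding energy_def quot_def by (intro nn_integral_swap[symmetric]) measurable

lemma error_finite:
  assumes "(\<integral>\<^sup>+x. ennreal (excess x) \<partial>N) < \<infinity>"
  shows "(\<integral>\<^sup>+y. \<integral>\<^sup>+x. error x y \<partial>N \<partial>N) < \<infinity>"
  using assms by (intro le_less_trans[OF error_total]) (simp add: ennreal_mult_less_top less_top)

lemma measurable_quotient [measurable]:
  assumes [measurable]: "v' \<in> borel_measurable N"
  shows "(\<lambda>(x, y). e2ennreal \<bar>v' x - v' y\<bar> / kernel m \<mu> s x y) \<in> borel_measurable (N \<Otimes>\<^sub>M N)"
proof -
  have "(\<lambda>p. e2ennreal \<bar>v' (fst p) - v' (snd p)\<bar> / kernel m \<mu> s (fst p) (snd p)) \<in> borel_measurable (N \<Otimes>\<^sub>M N)"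
    by measurable
  then show ?thesis by (simp add: case_prod_beta)
qed

text \<open>Lowering \<open>u\<close> only where it exceeds \<open>k\<close>, and not below
  \<open>k\<close>, keeps the competitor above the obstacle. Minimality then replaces the seminorm
  of \<open>u\<close> by that of the competitor in the integrated pointwise inequality, and the
  latter cancels.\<close>

lemma caccioppoli_obstacle:
  assumes sol: "obstacle_solution m \<mu> s \<Omega> \<psi> (\<lambda>_. 0) u" and sub: "B x0 r2 \<subseteq> \<Omega>"
    and \<psi>: "AE y in N. y \<in> B x0 r2 \<longrightarrow> \<psi> y \<le> ereal k"
    and fin: "(\<integral>\<^sup>+x. ennreal (excess x) \<partial>N) < \<infinity>"
  shows "energy s test \<le> (\<integral>\<^sup>+y. \<integral>\<^sup>+x. error x y \<partial>N \<partial>N)"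
proof -
  let ?E = "\<integral>\<^sup>+y. \<integral>\<^sup>+x. error x y \<partial>N \<partial>N"
  define q where "q f x y = e2ennreal \<bar>f x - f y\<bar> / kernel m \<mu> s x y" for f :: "'a \<Rightarrow> ereal" and x y
  have q: "(\<lambda>(x, y). q f x y) \<in> borel_measurable (N \<Otimes>\<^sub>M N)" if "f \<in> borel_measurable N" for f
    unfolding q_def using that by (rule measurable_quotient)
  have semi: "seminorm_Ws1 m \<mu> s X f = (\<integral>\<^sup>+y. \<integral>\<^sup>+x. q f x y \<partial>N \<partial>N)" for f
    unfolding seminorm_Ws1_def q_def
    by (intro nn_integral_cong) (auto simp: indicator_def intro!: nn_integral_cong)
  have "(\<integral>\<^sup>+y. \<integral>\<^sup>+x. quot x y \<partial>N \<partial>N) + (\<integral>\<^sup>+y. \<integral>\<^sup>+x. q competitor x y \<partial>N \<partial>N) = (\<integral>\<^sup>+y. \<integral>\<^sup>+x. quot x y + q competitor x y \<partial>N \<partial>N)"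
    by (intro nn_integral_add2[symmetric] measurable_quot q measurable_truncation)
  also have "\<dots> \<le> (\<integral>\<^sup>+y. \<integral>\<^sup>+x. q u x y + error x y \<partial>N \<partial>N)"
    unfolding q_def by (intro nn_integral_mono energy_seminorm) auto
  also have "\<dots> = (\<integral>\<^sup>+y. \<integral>\<^sup>+x. q u x y \<partial>N \<partial>N) + ?E"
    by (intro nn_integral_add2 measurable_error q u)
  finally have main: "energy s test + seminorm_Ws1 m \<mu> s X competitor \<le> seminorm_Ws1 m \<mu> s X u + ?E"
    by (simp add: semi energy_eq)
  have uC: "u \<in> obstacle_class m \<mu> s \<Omega> \<psi> (\<lambda>_. 0)" using sol by (simp add: obstacle_solution_def)
  then have fu: "seminorm_Ws1 m \<mu> s X u < \<infinity>" by (simp add: obstacle_class_def dot_Ws1_def)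
  \<comment> \<open>Finiteness is needed twice: for membership of the competitor in the obstacle
    class and for the final cancellation.\<close>
  have "seminorm_Ws1 m \<mu> s X competitor \<le> energy s test + seminorm_Ws1 m \<mu> s X competitor" by simp
  also note main
  also have "seminorm_Ws1 m \<mu> s X u + ?E < \<infinity>" using fu error_finite[OF fin] by (simp add: less_top)
  finally have fc: "seminorm_Ws1 m \<mu> s X competitor < \<infinity>" .
  have "competitor \<in> obstacle_class m \<mu> s \<Omega> \<psi> (\<lambda>_. 0)"
    unfolding obstacle_class_def dot_Ws1_def
  proof (intro CollectI conjI fc)
    show "competitor \<in> borel_measurable (restrict_space N X)"
      by (intro measurable_restrict_space1) measurable
    have "AE x in N. x \<in> \<Omega> \<longrightarrow> \<psi> x \<le> u x" using uC by (simp add: obstacle_class_def)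
    with \<psi> show "AE x in N. x \<in> \<Omega> \<longrightarrow> \<psi> x \<le> competitor x"
    proof eventually_elim
      case (elim x)
      show ?case
      proof
        assume x: "x \<in> \<Omega>"
        show "\<psi> x \<le> competitor x"
        proof (cases "test x = 0")
          case True
          then show ?thesis using elim x by (simp add: competitor_def zero_ereal_def[symmetric])
        next
          case False
          then have excess: "excess x \<noteq> 0" and et: "cutoff x \<noteq> 0" by (auto simp: test_def)
          then have xB: "x \<in> B x0 r2" by (auto simp: excess_def indicator_def split: if_splits)
          obtain a where a: "u x = ereal a"
            using excess by (cases "u x") (auto simp: excess_def max_def)
          have "excess x = max (a - k) 0" using excess_cases[OF a] xB et by auto
          then have "test x \<le> a - k" using test_le_excess[of x] excess by auto
          then have "ereal k \<le> competitor x" by (simp add: competitor_def a)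
          then show ?thesis using elim xB by (meson order_trans)
        qed
      qed
    qed
    have "AE x in N. x \<in> X - \<Omega> \<longrightarrow> u x = 0" using uC by (simp add: obstacle_class_def)
    then show "AE x in N. x \<in> X - \<Omega> \<longrightarrow> competitor x = 0"
    proof eventually_elim
      case (elim x)
      then show ?case using sub by (auto simp: competitor_def test_def excess_def indicator_def zero_ereal_def[symmetric])
    qed
  qed
  then have "seminorm_Ws1 m \<mu> s X u \<le> seminorm_Ws1 m \<mu> s X competitor"
    using sol by (simp add: obstacle_solution_def)
  then have "seminorm_Ws1 m \<mu> s X u + ?E \<le> seminorm_Ws1 m \<mu> s X competitor + ?E"
    by (rule add_right_mono)
  with main have "seminorm_Ws1 m \<mu> s X competitor + energy s test \<le> seminorm_Ws1 m \<mu> s X competitor + ?E"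
    by (simp only: add.commute[of "energy s test"])
  then show ?thesis using fc by (auto simp: ennreal_add_left_cancel_le)
qed

text \<open>The pointwise inequality is integrated separately over the two blocks that make up
  \<open>F_functional\<close>. Adding them with weights 1 and 2 and using that the functional is
  nonpositive leaves the error, while the pairs outside \<open>\<Omega>\<close> contribute nothing
  to the energy of \<open>test\<close>.\<close>

lemma caccioppoli_subminimizer:
  assumes subm: "subminimizer m \<mu> s \<Omega> u" and sub: "B x0 r2 \<subseteq> \<Omega>" and \<Omega>: "openin (mtopology_of m) \<Omega>"
    and fin: "(\<integral>\<^sup>+x. ennreal (excess x) \<partial>N) < \<infinity>"
  shows "energy s test \<le> (\<integral>\<^sup>+y. \<integral>\<^sup>+x. error x y \<partial>N \<partial>N)"
proof -
  let ?E = "\<integral>\<^sup>+y. \<integral>\<^sup>+x. error x y \<partial>N \<partial>N"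
  have [measurable]: "\<Omega> \<in> sets N" using \<Omega> by (rule sets_N_openin)
  have \<Omega>X: "\<Omega> \<subseteq> X" using \<Omega> openin_subset by fastforce
  have [measurable]: "X - \<Omega> \<in> sets N" by measurable
  have fE: "?E < \<infinity>" using fin by (rule error_finite)
  have out: "test x = 0" if "x \<notin> \<Omega>" for x
    using that sub by (auto simp: test_def excess_def indicator_def)
  have energy_finite: "energy s test < \<infinity>"
  proof -
    define q where "q x y = e2ennreal \<bar>u x - u y\<bar> / kernel m \<mu> s x y" for x y
    have [measurable]: "(\<lambda>(x, y). q x y) \<in> borel_measurable (N \<Otimes>\<^sub>M N)" unfolding q_def by measurable
    have "energy s test \<le> (\<integral>\<^sup>+y. \<integral>\<^sup>+x. (q x y * indicator \<Omega> x) * indicator \<Omega> y + error x y \<partial>N \<partial>N)"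
      unfolding energy_eq
    proof (intro nn_integral_mono)
      fix x y assume "x \<in> space N" "y \<in> space N"
      then show "quot x y \<le> q x y * indicator \<Omega> x * indicator \<Omega> y + error x y"
        using quot_le[of x y \<Omega>] sub by (auto simp: q_def indicator_def)
    qed
    also have "\<dots> = (\<integral>\<^sup>+y. \<integral>\<^sup>+x. (q x y * indicator \<Omega> x) * indicator \<Omega> y \<partial>N \<partial>N) + ?E"
      by (intro nn_integral_add2 measurable_error) measurable
    also have "(\<integral>\<^sup>+y. \<integral>\<^sup>+x. (q x y * indicator \<Omega> x) * indicator \<Omega> y \<partial>N \<partial>N) = seminorm_Ws1 m \<mu> s \<Omega> u"
      unfolding seminorm_Ws1_def q_def[symmetric] by (intro nn_integral_cong nn_integral_multc) measurable
    also have "\<dots> + ?E < \<infinity>"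
      using fE subm by (simp add: subminimizer_def dot_Ws1_def less_top)
    finally show ?thesis .
  qed
  define \<phi> where "\<phi> x = ereal (- test x)" for x
  have \<phi>: "\<phi> \<in> Ws1_0 m \<mu> s \<Omega>"
    unfolding Ws1_0_def Ws1_def norm_Ws1_def
  proof (intro CollectI conjI)
    show "\<phi> \<in> borel_measurable (restrict_space N X)"
      unfolding \<phi>_def by (intro measurable_restrict_space1) measurable
    have "(\<integral>\<^sup>+x\<in>X. e2ennreal \<bar>\<phi> x\<bar> \<partial>N) \<le> (\<integral>\<^sup>+x. ennreal (excess x) \<partial>N)"
      using test_le_excess by (intro nn_integral_mono) (auto simp: \<phi>_def indicator_def intro!: ennreal_leI)
    moreover have "seminorm_Ws1 m \<mu> s X \<phi> = energy s test"
      unfolding \<phi>_def seminorm_ereal energy_def by (simp add: abs_minus_commute)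
    ultimately show "(\<integral>\<^sup>+x\<in>X. e2ennreal \<bar>\<phi> x\<bar> \<partial>N) + seminorm_Ws1 m \<mu> s X \<phi> < \<infinity>"
      using fin energy_finite by (simp add: less_top)
    show "AE x in N. x \<in> X - \<Omega> \<longrightarrow> \<phi> x = 0"
      using out by (auto simp: \<phi>_def zero_ereal_def)
  qed
  have \<phi>0: "\<forall>x\<in>X. \<phi> x \<le> 0" by (simp add: \<phi>_def)
  have "(\<forall>x\<in>X. \<eta> x \<le> 0) \<Longrightarrow> F_functional m \<mu> s \<Omega> u (\<lambda>x. u x + \<eta> x) \<le> 0"
    if "\<eta> \<in> Ws1_0 m \<mu> s \<Omega>" for \<eta>
    using subm that unfolding subminimizer_def by blast
  from this[OF \<phi> \<phi>0] have F: "F_functional m \<mu> s \<Omega> u competitor \<le> 0"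
    by (simp only: \<phi>_def competitor_def[abs_def])
  define G where "G = F_integrand m \<mu> s u competitor"
  have [measurable]: "(\<lambda>(x, y). G x y) \<in> borel_measurable (N \<Otimes>\<^sub>M N)"
  proof -
    have "(\<lambda>p. G (fst p) (snd p)) \<in> borel_measurable (N \<Otimes>\<^sub>M N)"
      unfolding G_def F_integrand_def by measurable
    then show ?thesis by (simp add: case_prod_beta)
  qed
  define J where "J h A = (\<integral>\<^sup>+y\<in>\<Omega>. (\<integral>\<^sup>+x\<in>A. h x y \<partial>N) \<partial>N)" for h :: "'a \<Rightarrow> 'a \<Rightarrow> ennreal" and A
  define E where "E A = ereal_integral N \<Omega> (\<lambda>y. ereal_integral N A (\<lambda>x. G x y))" for A
  have JE: "enn2ereal (J quot A) \<le> E A + enn2ereal (J error A)" if [measurable]: "A \<in> sets N" for A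
    unfolding J_def E_def
  proof (rule ereal_integral_ge)
    show "(\<lambda>y. ereal_integral N A (\<lambda>x. G x y)) \<in> borel_measurable N"
      unfolding ereal_integral_def by measurable
    fix y assume "y \<in> \<Omega>"
    then have y: "y \<in> X" "y \<in> space N" using \<Omega>X by auto
    show "enn2ereal (\<integral>\<^sup>+x\<in>A. quot x y \<partial>N) \<le> ereal_integral N A (\<lambda>x. G x y) + enn2ereal (\<integral>\<^sup>+x\<in>A. error x y \<partial>N)"
    proof (rule ereal_integral_ge)
      fix x assume "x \<in> A"
      then have "x \<in> X" using sets.sets_into_space[OF that] by auto
      then show "enn2ereal (quot x y) \<le> G x y + enn2ereal (error x y)"
        unfolding G_def using y by (intro energy_F)
    qed (use y in measurable)
  qed measurable
  have F': "E \<Omega> + 2 * E (X - \<Omega>) \<le> 0" using F by (simp add: F_functional_def E_def G_def)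
  have error: "J error \<Omega> + 2 * J error (X - \<Omega>) \<le> ?E"
    unfolding J_def by (subst nn_integral_split_symmetric[of error \<Omega>]) (auto simp: error_sym)
  have "energy s test = J quot \<Omega> + 2 * J quot (X - \<Omega>) + (\<integral>\<^sup>+y\<in>X - \<Omega>. (\<integral>\<^sup>+x\<in>X - \<Omega>. quot x y \<partial>N) \<partial>N)"
    unfolding J_def energy_eq by (rule nn_integral_split_symmetric) (auto simp: quot_sym)
  also have "(\<integral>\<^sup>+y\<in>X - \<Omega>. (\<integral>\<^sup>+x\<in>X - \<Omega>. quot x y \<partial>N) \<partial>N) = (\<integral>\<^sup>+y. 0 \<partial>N)"
  proof (intro nn_integral_cong)
    fix y
    have "(\<integral>\<^sup>+x\<in>X - \<Omega>. quot x y \<partial>N) = (\<integral>\<^sup>+x. 0 \<partial>N)" if "y \<notin> \<Omega>"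
      using that out by (intro nn_integral_cong) (auto simp: quot_def indicator_def)
    then show "(\<integral>\<^sup>+x\<in>X - \<Omega>. quot x y \<partial>N) * indicator (X - \<Omega>) y = 0" by (auto simp: indicator_def)
  qed
  finally have energy: "energy s test = J quot \<Omega> + 2 * J quot (X - \<Omega>)" by simp
  have double: "a \<le> a + 2 * b" "b \<le> a + 2 * b" for a b :: ennreal
    by (simp_all add: mult_2 add_increasing add_increasing2)
  have fe: "J error \<Omega> < \<infinity>" "J error (X - \<Omega>) < \<infinity>"
    by (rule le_less_trans[OF double(1) le_less_trans[OF error fE]],
        rule le_less_trans[OF double(2) le_less_trans[OF error fE]])
  then obtain b1 b2 where b: "J error \<Omega> = ennreal b1" "J error (X - \<Omega>) = ennreal b2" "0 \<le> b1" "0 \<le> b2"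
    using that[of "enn2real (J error \<Omega>)" "enn2real (J error (X - \<Omega>))"] fe by simp
  have ft: "J quot \<Omega> < \<infinity>" "J quot (X - \<Omega>) < \<infinity>"
    by (rule le_less_trans[OF double(1) energy_finite[unfolded energy]],
        rule le_less_trans[OF double(2) energy_finite[unfolded energy]])
  then obtain a1 a2 where a: "J quot \<Omega> = ennreal a1" "J quot (X - \<Omega>) = ennreal a2" "0 \<le> a1" "0 \<le> a2"
    using that[of "enn2real (J quot \<Omega>)" "enn2real (J quot (X - \<Omega>))"] ft by simp
  have 1: "ereal a1 \<le> E \<Omega> + ereal b1" "ereal a2 \<le> E (X - \<Omega>) + ereal b2"
    using JE[of \<Omega>] JE[of "X - \<Omega>"] a b by (auto simp: enn2ereal_ennreal)
  \<comment> \<open>The bounds in \<open>1\<close> exclude the value \<open>-\<infinity>\<close> for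
    both blocks, and \<open>F'\<close> then excludes \<open>\<infinity>\<close>; what remains is
    real arithmetic.\<close>
  have "a1 + 2 * a2 \<le> b1 + 2 * b2"
    using 1 F' by (cases "E \<Omega>"; cases "E (X - \<Omega>)") auto
  then have "energy s test \<le> J error \<Omega> + 2 * J error (X - \<Omega>)"
    unfolding energy a b using a b by (simp add: ennreal_plus[symmetric] ennreal_mult[symmetric] ennreal_leI
      del: ennreal_plus flip: ennreal_numeral)
  also note error
  finally show ?thesis .
qed

lemma caccioppoli:
  assumes sol: "subminimizer m \<mu> s \<Omega> u \<or> (\<exists>\<psi>. (AE y in N. y \<in> B x0 r2 \<longrightarrow> \<psi> y \<le> ereal k) \<and> obstacle_solution m \<mu> s \<Omega> \<psi> (\<lambda>_. 0) u)"
    and sub: "B x0 r2 \<subseteq> \<Omega>" and \<Omega>: "openin (mtopology_of m) \<Omega>"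
    and fin: "(\<integral>\<^sup>+x. ennreal (excess x) \<partial>N) < \<infinity>"
  shows "energy s test \<le> ennreal (16 * C / (s * (1 - s)) * (r2 - r1) powr (- s)) * (\<integral>\<^sup>+x. ennreal (excess x) \<partial>N)"
  using sol caccioppoli_subminimizer[OF _ sub \<Omega> fin] caccioppoli_obstacle[OF _ sub _ fin] error_total
  by (meson order_trans)

end

section \<open>De Giorgi iteration\<close>

lemma ereal_le_of_forall_gt_real:
  fixes e :: ereal
  assumes "\<And>x. a < x \<Longrightarrow> e \<le> ereal x" shows "e \<le> ereal a"
proof (rule ereal_le_epsilon2)
  fix \<epsilon> :: real assume "0 < \<epsilon>"
  then show "e \<le> ereal a + ereal \<epsilon>" using assms[of "a + \<epsilon>"] by simp
qed

context doubling_mms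
begin

text \<open>An infinite value of \<open>u\<close> becomes 0 here, so a bound for
  \<open>pospart\<close> bounds \<open>u\<close> only where \<open>u\<close> is known to be
  different from \<open>\<infinity>\<close>.\<close>

definition pospart :: "('a \<Rightarrow> ereal) \<Rightarrow> real \<Rightarrow> 'a \<Rightarrow> real" where
  "pospart u k x = real_of_ereal (max (u x - ereal k) 0)"

text \<open>An interface that lets one iteration serve both parts of the theorem. The factor
  \<open>1 - s\<close> is kept visible to cancel the one in the Caccioppoli estimate.\<close>

definition small_support_const :: "real \<Rightarrow> real \<Rightarrow> bool" where
  "small_support_const s K \<longleftrightarrow> (\<forall>\<Phi> \<rho>. integrable N \<Phi> \<longrightarrow> (\<forall>x\<in>X. 0 \<le> \<Phi> x) \<longrightarrow> 0 < \<rho> \<longrightarrow>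
    (\<forall>x\<in>X. B x \<rho> \<inter> {x \<in> X. 0 < \<Phi> x} \<noteq> {} \<longrightarrow>
      2 * emeasure N {x \<in> X. 0 < \<Phi> x} \<le> emeasure N (B x \<rho>)) \<longrightarrow>
    (\<integral>\<^sup>+x. ennreal (\<Phi> x) \<partial>N) \<le> ennreal (K * (1 - s) * \<rho> powr s) * energy s \<Phi>)"

lemma small_support_const_doubling:
  assumes "0 < s" "s < 1" shows "small_support_const s (2 * C / (1 - s))"
  unfolding small_support_const_def
proof (intro allI impI)
  fix \<Phi> :: "'a \<Rightarrow> real" and \<rho> :: real
  assume "integrable N \<Phi>" "\<forall>x\<in>X. 0 \<le> \<Phi> x" "0 < \<rho>"
    "\<forall>x\<in>X. B x \<rho> \<inter> {x \<in> X. 0 < \<Phi> x} \<noteq> {} \<longrightarrow> 2 * emeasure N {x \<in> X. 0 < \<Phi> x} \<le> emeasure N (B x \<rho>)"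
  then have "(\<integral>\<^sup>+x. ennreal (\<Phi> x) \<partial>N) \<le> ennreal (2 * C * \<rho> powr s) * energy s \<Phi>"
    using assms by (intro small_support_ineq) auto
  then show "(\<integral>\<^sup>+x. ennreal (\<Phi> x) \<partial>N) \<le> ennreal (2 * C / (1 - s) * (1 - s) * \<rho> powr s) * energy s \<Phi>"
    using assms by simp
qed

text \<open>For \<open>s \<le> 1 / 2\<close> the doubling bound is good enough, as
  \<open>1 - s\<close> is then at least 1 / 2; this is the summand \<open>4 * C\<close>. The other
  summand is the constant from the sum over scales for larger \<open>s\<close>.\<close>

lemma small_support_const_poincare:
  assumes P: "poincare m \<mu> CP lam" and n: "2 * lam \<le> 2 ^ n" and s: "0 < s" "s < 1"
  shows "small_support_const s (4 * C + 24 * C * (2 * C ^ 6 + 6 * CP * C ^ (n + 11)))"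
  unfolding small_support_const_def
proof (intro allI impI)
  fix \<Phi> :: "'a \<Rightarrow> real" and \<rho> :: real
  assume i: "integrable N \<Phi>" and pos: "\<forall>x\<in>X. 0 \<le> \<Phi> x" and \<rho>: "0 < \<rho>"
    and small: "\<forall>x\<in>X. B x \<rho> \<inter> {x \<in> X. 0 < \<Phi> x} \<noteq> {} \<longrightarrow> 2 * emeasure N {x \<in> X. 0 < \<Phi> x} \<le> emeasure N (B x \<rho>)"
  define K where "K = 24 * C * (2 * C ^ 6 + 6 * CP * C ^ (n + 11))"
  have CP: "CP > 0" using P by (simp add: poincare_def)
  have K: "0 \<le> K" unfolding K_def using C_pos CP by simp
  show "(\<integral>\<^sup>+x. ennreal (\<Phi> x) \<partial>N) \<le> ennreal ((4 * C + 24 * C * (2 * C ^ 6 + 6 * CP * C ^ (n + 11))) * (1 - s) * \<rho> powr s) * energy s \<Phi>"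
    unfolding K_def[symmetric]
  proof (cases "s \<le> 1 / 2")
    case True
    have "(\<integral>\<^sup>+x. ennreal (\<Phi> x) \<partial>N) \<le> ennreal (2 * C * \<rho> powr s) * energy s \<Phi>"
      using i pos small \<rho> s by (intro small_support_ineq) auto
    also have "\<dots> \<le> ennreal ((4 * C + K) * (1 - s) * \<rho> powr s) * energy s \<Phi>"
    proof (intro mult_right_mono ennreal_leI)
      have "2 * C \<le> 4 * C * (1 - s)" using mult_left_mono[OF True, of "4 * C"] C_pos by (simp add: algebra_simps)
      also have "\<dots> \<le> (4 * C + K) * (1 - s)" using K s by (intro mult_right_mono) auto
      finally show "2 * C \<le> (4 * C + K) * (1 - s)" .
    qed auto
    finally show "(\<integral>\<^sup>+x. ennreal (\<Phi> x) \<partial>N) \<le> ennreal ((4 * C + K) * (1 - s) * \<rho> powr s) * energy s \<Phi>" .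
  next
    case False
    interpret integrable_fun m \<mu> C \<Phi> by unfold_locales (rule i)
    have "(\<integral>\<^sup>+x. ennreal (\<Phi> x) \<partial>N) \<le> ennreal (K * (1 - s) * \<rho> powr s) * energy s \<Phi>"
      unfolding K_def using P n \<rho> False s pos small by (intro poincare_small_support_ineq) auto
    also have "\<dots> \<le> ennreal ((4 * C + K) * (1 - s) * \<rho> powr s) * energy s \<Phi>"
      using C_pos s by (intro mult_right_mono ennreal_leI) auto
    finally show "(\<integral>\<^sup>+x. ennreal (\<Phi> x) \<partial>N) \<le> ennreal ((4 * C + K) * (1 - s) * \<rho> powr s) * energy s \<Phi>" .
  qed
qed

lemma doubling_dimension_v:
  assumes "doubling_dimension m \<mu> Q c" "x \<in> X" "0 < r" "r < R"
  shows "c * (r / R) powr Q * v x R \<le> v x r"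
proof -
  have c: "c > 0" using assms by (simp add: doubling_dimension_def)
  have v: "v x R > 0" "v x r > 0" using assms by (auto intro!: v_pos)
  have "ennreal (c * (r / R) powr Q) \<le> \<mu> (B x r) / \<mu> (B x R)"
    using assms by (auto simp: doubling_dimension_def)
  also have "\<dots> = ennreal (v x r / v x R)"
    using v assms by (simp add: emeasure_N[symmetric] emeasure_ball' divide_ennreal)
  finally show ?thesis using c v by (simp add: pos_le_divide_eq)
qed

lemma doubling_dimension_mono:
  assumes "doubling_dimension m \<mu> Q c" "0 < c'" "c' \<le> c"
  shows "doubling_dimension m \<mu> Q c'"
proof -
  have "ennreal (c' * (r / R) powr Q) \<le> ennreal (c * (r / R) powr Q)" for r R
    using assms by (intro ennreal_leI mult_right_mono) auto
  then show ?thesis using assms unfolding doubling_dimension_def by (meson order_trans)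
qed

text \<open>With \<open>i\<close> the number of whole doublings in \<open>R / r\<close>, one has
  \<open>C ^ i = (2 ^ i) powr (log 2 C)\<close>, and the incomplete last doubling gives the constant
  \<open>1 / C\<close>. The maximum with 1 keeps the dimension above every
  \<open>s < 1\<close>.\<close>

lemma doubling_dimension_log:
  "doubling_dimension m \<mu> (max 1 (log 2 C)) (1 / C)"
  unfolding doubling_dimension_def
proof (intro conjI ballI allI impI)
  fix x r R assume x: "x \<in> X" and rR: "0 < r \<and> r < (R::real)"
  let ?Q = "max 1 (log 2 C)"
  obtain i where i: "2 ^ i \<le> R / r" "R / r < 2 ^ Suc i"
    using ex_dyadic_up[of "R / r"] rR by (auto simp: field_simps)
  have v: "v x R > 0" "v x r > 0" using x rR by (auto intro!: v_pos)
  have "R \<le> 2 ^ Suc i * r" using i rR by (simp add: field_simps)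
  then have "v x R \<le> C ^ Suc i * v x r" using x rR by (intro v_doubling) auto
  also have "C ^ Suc i = C * 2 powr (log 2 C * real i)"
    using C_pos by (simp add: powr_powr[symmetric] powr_realpow)
  also have "\<dots> = C * (2 ^ i) powr (log 2 C)"
    by (simp add: powr_realpow[symmetric] powr_powr mult.commute)
  also have "\<dots> * v x r \<le> C * (R / r) powr ?Q * v x r"
  proof (intro mult_right_mono mult_left_mono)
    have "(2 ^ i) powr (log 2 C) \<le> (2 ^ i) powr ?Q" by (intro powr_mono) auto
    also have "\<dots> \<le> (R / r) powr ?Q" using i by (intro powr_mono2) auto
    finally show "(2 ^ i) powr (log 2 C) \<le> (R / r) powr ?Q" .
  qed (use C_pos in auto)
  finally have "v x R \<le> C * (R / r) powr ?Q * v x r" .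
  then have "1 / C * (r / R) powr ?Q \<le> v x r / v x R"
    using v C_pos rR by (simp add: powr_divide field_simps)
  then show "ennreal (1 / C * (r / R) powr ?Q) \<le> \<mu> (B x r) / \<mu> (B x R)"
    using v x by (simp add: emeasure_N[symmetric] emeasure_ball' divide_ennreal ennreal_leI)
qed (use C_pos in auto)

lemma pospart_nonneg [simp]: "0 \<le> pospart u k x"
  by (simp add: pospart_def real_of_ereal_pos)

lemma pospart_ereal: assumes "u x = ereal a" shows "pospart u k x = max (a - k) 0"
proof -
  have "max (ereal (a - k)) 0 = ereal (max (a - k) 0)" by (simp add: max_def)
  then show ?thesis unfolding pospart_def assms by (simp only: ereal_minus real_of_ereal.simps)
qed

lemma pospart_pos: assumes "0 < pospart u k x" obtains a where "u x = ereal a" "k < a" "pospart u k x = a - k"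
proof -
  obtain a where a: "u x = ereal a" using assms by (cases "u x") (auto simp: pospart_def max_def)
  then have "pospart u k x = max (a - k) 0" by (rule pospart_ereal)
  then show ?thesis using assms a that by auto
qed

lemma pospart_antimono: assumes "k \<le> k'" shows "pospart u k' x \<le> pospart u k x"
proof (cases "0 < pospart u k' x")
  case True
  then obtain a where a: "u x = ereal a" "k' < a" "pospart u k' x = a - k'" by (rule pospart_pos)
  have "pospart u k x = max (a - k) 0" using a(1) by (rule pospart_ereal)
  then show ?thesis using a assms by simp
qed (use pospart_nonneg[of u k' x] in \<open>auto intro: order_trans\<close>)

text \<open>The De Giorgi iteration on the balls of radius \<open>r + (R - r) / 2 ^ j\<close> at the levels
  \<open>k0 + \<kappa> * (1 - 1 / 2 ^ j)\<close>. The scale \<open>\<rho>\<close> at which the small support inequality is applied is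
  a fixed multiple of the gap between consecutive radii; the factor \<open>A\<close> makes the excess decay
  like \<open>2 powr (- (Q + 1) * j)\<close>.\<close>

lemma de_giorgi_iteration:
  fixes s Q c K r R k0 \<kappa> :: real
  assumes s: "0 < s" "s < 1" and dim: "doubling_dimension m \<mu> Q c" "s < Q" 
    and K: "0 < K" "small_support_const s K"
    and \<Omega>: "openin (mtopology_of m) \<Omega>" and x0: "x0 \<in> X" and r: "0 < r" "r < R" and sub: "B x0 R \<subseteq> \<Omega>"
    and u [measurable]: "u \<in> borel_measurable N"
    and sol: "subminimizer m \<mu> s \<Omega> u \<or> (\<exists>\<psi>. (AE y in N. y \<in> B x0 R \<longrightarrow> \<psi> y \<le> ereal k0) \<and> obstacle_solution m \<mu> s \<Omega> \<psi> (\<lambda>_. 0) u)"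
    and M: "3 \<le> M" "96 * K * C / s \<le> M" and \<kappa>: "0 < \<kappa>"
  defines "A \<equiv> 2 powr (Q + 1) * M"
  defines "\<theta> \<equiv> c / 4 * A powr (- (Q / s)) * (R / (R - r)) powr (- Q)"
  assumes start: "(\<integral>\<^sup>+x. ennreal (pospart u k0 x * indicator (B x0 R) x) \<partial>N) \<le> ennreal (\<theta> * \<kappa> * v x0 R)"
  shows "(\<integral>\<^sup>+x. ennreal (pospart u (k0 + \<kappa> * (1 - 1 / 2 ^ j)) x * indicator (B x0 (r + (R - r) / 2 ^ j)) x) \<partial>N)
    \<le> ennreal (\<theta> * \<kappa> * v x0 R * (2 powr (- (Q + 1))) ^ j)"
proof (induction j)
  case 0
  then show ?case using start by simp
next
  case (Suc j)
  define q :: real where "q = 2 powr (- (Q + 1))"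
  define L where "L = R / (R - r)"
  define V where "V = v x0 R"
  define a where "a i = (\<integral>\<^sup>+x. ennreal (pospart u (k0 + \<kappa> * (1 - 1 / 2 ^ i)) x * indicator (B x0 (r + (R - r) / 2 ^ i)) x) \<partial>N)" for i :: nat
  define r1 where "r1 = r + (R - r) / 2 ^ Suc j"
  define r2 where "r2 = r + (R - r) / 2 ^ j"
  define k where "k = k0 + \<kappa> * (1 - 1 / 2 ^ Suc j)"
  define k' where "k' = k0 + \<kappa> * (1 - 1 / 2 ^ j)"
  have c: "c > 0" and Q: "Q > 0" using dim by (auto simp: doubling_dimension_def)
  have V: "V > 0" unfolding V_def using x0 r by (intro v_pos) auto
  have L: "L > 1" unfolding L_def using r by (simp add: field_simps)
  have A3: "3 \<le> A"
  proof -
    have "1 * 3 \<le> A" unfolding A_def using M Q by (intro mult_mono ge_one_powr_ge_zero) auto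
    then show ?thesis by simp
  qed
  have q: "0 < q" by (simp add: q_def)
  have \<theta>: "0 < \<theta>" unfolding \<theta>_def using c A3 r by (intro mult_pos_pos) auto
  have IH: "a j \<le> ennreal (\<theta> * \<kappa> * V * q ^ j)" using Suc by (simp add: a_def V_def q_def)
  have gap: "r2 - r1 = (R - r) / 2 ^ Suc j" by (simp add: r1_def r2_def field_simps)
  have "(R - r) / 2 ^ j \<le> (R - r) / 1" using r by (intro divide_left_mono) auto
  moreover have "0 < r2 - r1" unfolding gap using r by simp
  ultimately have rr: "r1 < r2" "r2 \<le> R" by (auto simp: r2_def)
  have kk: "k - k' = \<kappa> / 2 ^ Suc j" by (simp add: k_def k'_def field_simps)
  have "0 \<le> \<kappa> * (1 - 1 / 2 ^ Suc j)"
    using \<kappa> one_le_power[of "2::real" "Suc j"] by (intro mult_nonneg_nonneg) (auto simp del: power_Suc)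
  moreover have "0 \<le> \<kappa> / 2 ^ Suc j" using \<kappa> by simp
  ultimately have k0k: "k0 \<le> k" "k' \<le> k" using kk by (auto simp only: k_def)
  interpret T: truncation m \<mu> C u x0 r1 r2 k s
    by unfold_locales (use u x0 rr s in auto)
  have excess: "T.excess x = pospart u k x * indicator (B x0 r2) x" for x by (simp add: T.excess_def pospart_def)
  have excess_a: "(\<integral>\<^sup>+x. ennreal (T.excess x) \<partial>N) \<le> a j"
    unfolding a_def excess r2_def[symmetric] k'_def[symmetric]
    using pospart_antimono[OF k0k(2)] by (intro nn_integral_mono ennreal_leI mult_right_mono) auto
  have fin: "(\<integral>\<^sup>+x. ennreal (T.excess x) \<partial>N) < \<infinity>"
    using order_trans[OF excess_a IH] by (auto elim: le_less_trans)
  have subB: "B x0 r2 \<subseteq> B x0 R" using rr by auto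
  have caccio: "energy s T.test \<le> ennreal (16 * C / (s * (1 - s)) * (r2 - r1) powr (- s)) * (\<integral>\<^sup>+x. ennreal (T.excess x) \<partial>N)"
  proof (rule T.caccioppoli[OF _ order.trans[OF subB sub] \<Omega> fin])
    show "subminimizer m \<mu> s \<Omega> u \<or> (\<exists>\<psi>. (AE y in N. y \<in> B x0 r2 \<longrightarrow> \<psi> y \<le> ereal k) \<and> obstacle_solution m \<mu> s \<Omega> \<psi> (\<lambda>_. 0) u)"
      using sol
    proof (elim disjE exE conjE)
      fix \<psi> assume "AE y in N. y \<in> B x0 R \<longrightarrow> \<psi> y \<le> ereal k0" "obstacle_solution m \<mu> s \<Omega> \<psi> (\<lambda>_. 0) u"
      moreover have "AE y in N. y \<in> B x0 r2 \<longrightarrow> \<psi> y \<le> ereal k"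
        using calculation(1)
      proof eventually_elim
        case (elim y)
        then show ?case using subB k0k(1) by (auto intro: order_trans)
      qed
      ultimately show ?thesis by blast
    qed simp
  qed
  have a_Suc: "a (Suc j) \<le> (\<integral>\<^sup>+x. ennreal (T.test x) \<partial>N)"
    unfolding a_def r1_def[symmetric] k_def[symmetric]
  proof (intro nn_integral_mono ennreal_leI)
    fix x assume "x \<in> space N"
    show "pospart u k x * indicator (B x0 r1) x \<le> T.test x"
    proof (cases "x \<in> B x0 r1")
      case True
      then have "T.cutoff x = 1" "x \<in> B x0 r2" using rr by (auto intro!: T.cutoff_1)
      then show ?thesis using True by (simp add: T.test_def excess)
    qed simp
  qed
  define S where "S = {x \<in> X. 0 < T.test x}"
  have [measurable]: "S \<in> sets N" unfolding S_def by measurable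
  have SB: "x \<in> B x0 r2" "0 < pospart u k x" if "x \<in> S" for x
    using that pospart_nonneg[of u k x] by (auto simp: S_def T.test_def excess indicator_def less_le split: if_splits)
  \<comment> \<open>Chebyshev: on \<open>S\<close> the function exceeds the new level, hence the old
    level by at least \<open>\<kappa> / 2 ^ Suc j\<close>.\<close>
  have \<mu>S: "emeasure N S \<le> ennreal (2 ^ Suc j * \<theta> * V * q ^ j)"
  proof -
    have "ennreal (\<kappa> / 2 ^ Suc j) * emeasure N S = (\<integral>\<^sup>+x. ennreal (\<kappa> / 2 ^ Suc j) * indicator S x \<partial>N)"
      by (subst nn_integral_cmult_indicator) auto
    also have "\<dots> \<le> a j"
      unfolding a_def r2_def[symmetric] k'_def[symmetric]
    proof (intro nn_integral_mono)
      fix x assume "x \<in> space N"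
      show "ennreal (\<kappa> / 2 ^ Suc j) * indicator S x \<le> ennreal (pospart u k' x * indicator (B x0 r2) x)"
      proof (cases "x \<in> S")
        case True
        then obtain b where b: "u x = ereal b" "k < b" "pospart u k x = b - k" using pospart_pos[OF SB(2)] by blast
        have "pospart u k' x = max (b - k') 0" using b(1) by (rule pospart_ereal)
        then have "\<kappa> / 2 ^ Suc j \<le> pospart u k' x" using b kk by simp
        then show ?thesis using True SB(1)[OF True] by (auto intro!: ennreal_leI)
      qed simp
    qed
    also note IH
    finally have "ennreal (2 ^ Suc j / \<kappa>) * (ennreal (\<kappa> / 2 ^ Suc j) * emeasure N S) \<le> ennreal (2 ^ Suc j / \<kappa>) * ennreal (\<theta> * \<kappa> * V * q ^ j)"
      by (intro mult_left_mono) auto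
    moreover have "ennreal (2 ^ Suc j / \<kappa>) * (ennreal (\<kappa> / 2 ^ Suc j) * emeasure N S) = emeasure N S"
      using \<kappa> by (simp add: mult.assoc[symmetric] ennreal_mult[symmetric] del: power_Suc)
    moreover have "ennreal (2 ^ Suc j / \<kappa>) * ennreal (\<theta> * \<kappa> * V * q ^ j) = ennreal (2 ^ Suc j * \<theta> * V * q ^ j)"
      using \<kappa> \<theta> V q by (simp add: ennreal_mult[symmetric] del: power_Suc)
    ultimately show ?thesis by simp
  qed
  \<comment> \<open>This is \<open>\<rho> / (3 * R)\<close>. The factor \<open>1 / L / 2 ^ j\<close>
    ties \<open>\<rho>\<close> to the gap between the radii, and the power of \<open>A\<close> is
    what the contraction costs. The choice of \<open>\<theta>\<close> makes
    \<open>c * t powr Q\<close> exactly twice the relative bound for the measure of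
    \<open>S\<close>.\<close>
  define t where "t = A powr (- (1 / s)) / L / 2 ^ j"
  have t: "0 < t" using A3 L by (simp add: t_def)
  have Ainv: "A powr (- (1 / s)) \<le> 1 / 3"
  proof -
    have "A powr (- (1 / s)) \<le> A powr (- 1)" using A3 s by (intro powr_mono) (auto simp: field_simps)
    also have "\<dots> \<le> 1 / 3" using A3 by (simp add: powr_minus field_simps)
    finally show ?thesis .
  qed
  have t3: "t \<le> 1 / 3"
  proof -
    have "A powr (- (1 / s)) / L / 2 ^ j \<le> A powr (- (1 / s)) / 1 / 1"
      using L A3 by (intro frac_le) auto
    then have "t \<le> A powr (- (1 / s))" by (simp only: t_def div_by_1)
    then show ?thesis using Ainv by linarith
  qed
  define \<rho> where "\<rho> = 3 * R * t"
  have R: "R > 0" using r by simp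
  have \<rho>: "0 < \<rho>" "\<rho> \<le> R" using t t3 R by (auto simp: \<rho>_def field_simps)
  have tQ: "c * t powr Q = 2 * (2 ^ Suc j * \<theta> * q ^ j)"
  proof -
    have "t powr Q = (A powr (- (1 / s))) powr Q / L powr Q / (2 ^ j) powr Q"
      unfolding t_def using A3 L by (subst powr_divide, simp, simp, subst powr_divide) auto
    also have "\<dots> = A powr (- (Q / s)) * L powr (- Q) * (2 ^ j) powr (- Q)"
      unfolding powr_powr powr_minus_divide[of L] powr_minus_divide[of "2 ^ j"] by simp
    \<comment> \<open>This identity dictates \<open>q\<close>: the volume at scale
      \<open>\<rho>\<close> decays like \<open>2 powr (- Q * j)\<close> and has to match
      \<open>q ^ j\<close> times the factor \<open>2 ^ j\<close> lost in Chebyshev's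
      inequality.\<close>
    also have "(2 ^ j :: real) powr (- Q) = 2 ^ j * q ^ j"
    proof -
      have "(2::real) ^ j * q ^ j = (2 * q) ^ j" by (simp add: power_mult_distrib)
      also have "2 * q = 2 powr (- Q)" by (simp add: q_def powr_add[symmetric] powr_diff powr_minus field_simps)
      also have "(2 powr (- Q)) ^ j = (2 ^ j) powr (- Q)"
        by (simp add: powr_realpow[symmetric] powr_powr mult.commute)
      finally show ?thesis by simp
    qed
    finally show ?thesis by (simp add: \<theta>_def L_def)
  qed
  have itst: "integrable N T.test"
  proof (rule integrableI_bounded)
    have "(\<integral>\<^sup>+x. ennreal (norm (T.test x)) \<partial>N) \<le> (\<integral>\<^sup>+x. ennreal (T.excess x) \<partial>N)"
      using T.test_le_excess by (intro nn_integral_mono ennreal_leI) auto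
    then show "(\<integral>\<^sup>+x. ennreal (norm (T.test x)) \<partial>N) < \<infinity>" using fin by (rule le_less_trans)
  qed measurable
  have small: "\<forall>x\<in>X. B x \<rho> \<inter> {x \<in> X. 0 < T.test x} \<noteq> {} \<longrightarrow>
      2 * emeasure N {x \<in> X. 0 < T.test x} \<le> emeasure N (B x \<rho>)"
  proof (intro ballI impI)
    fix x assume x: "x \<in> X" and ne: "B x \<rho> \<inter> {x \<in> X. 0 < T.test x} \<noteq> {}"
    from ne obtain z where "z \<in> B x \<rho>" "z \<in> S" unfolding S_def by blast
    then have z: "z \<in> S" "d x z < \<rho>" by auto
    then have zX: "z \<in> X" "d x0 z < R" using SB(1)[OF z(1)] rr by auto
    \<comment> \<open>A ball that meets the support has its center within \<open>2 * R\<close> of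
      \<open>x0\<close>, since \<open>\<rho> \<le> R\<close>. Thus \<open>B x (3 * R)\<close>
      contains \<open>B x0 R\<close>, and the dimension bound at \<open>x\<close> can be compared
      with \<open>V\<close>.\<close>
    have "d x0 x \<le> d x0 z + d z x" using x x0 zX by (intro d_triangle)
    then have "d x0 x + R \<le> 3 * R" using z zX \<rho> by (simp add: mdist_commute[of m z])
    then have V3: "V \<le> v x (3 * R)" unfolding V_def using x x0 by (intro v_le)
    have "\<rho> < 3 * R" using \<rho> R by simp
    have "2 * (2 ^ Suc j * \<theta> * q ^ j) * V = c * t powr Q * V" by (simp only: tQ)
    also have "\<dots> \<le> c * t powr Q * v x (3 * R)" using V3 c by (intro mult_left_mono) auto
    also have "\<dots> = c * (\<rho> / (3 * R)) powr Q * v x (3 * R)" using R by (simp add: \<rho>_def)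
    also have "\<dots> \<le> v x \<rho>"
      using dim(1) x \<rho>(1) \<open>\<rho> < 3 * R\<close> by (rule doubling_dimension_v)
    finally have "2 * (2 ^ Suc j * \<theta> * q ^ j) * V \<le> v x \<rho>" .
    then have le: "2 * (2 ^ Suc j * \<theta> * V * q ^ j) \<le> v x \<rho>" by (simp add: algebra_simps)
    have "2 * emeasure N S \<le> 2 * ennreal (2 ^ Suc j * \<theta> * V * q ^ j)"
      using \<mu>S by (rule mult_left_mono) simp
    also have "\<dots> = ennreal (2 * (2 ^ Suc j * \<theta> * V * q ^ j))"
      using \<theta> V q by (subst ennreal_mult) auto
    also have "\<dots> \<le> ennreal (v x \<rho>)" using le by (rule ennreal_leI)
    finally show "2 * emeasure N {x \<in> X. 0 < T.test x} \<le> emeasure N (B x \<rho>)"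
      using x by (simp add: S_def emeasure_ball')
  qed
  have "(\<integral>\<^sup>+x. ennreal (T.test x) \<partial>N) \<le> ennreal (K * (1 - s) * \<rho> powr s) * energy s T.test"
    using K(2) itst T.test_nonneg \<rho>(1) small unfolding small_support_const_def by blast
  also have "\<dots> \<le> ennreal (K * (1 - s) * \<rho> powr s) * (ennreal (16 * C / (s * (1 - s)) * (r2 - r1) powr (- s)) * ennreal (\<theta> * \<kappa> * V * q ^ j))"
    using order_trans[OF excess_a IH] by (intro mult_left_mono order_trans[OF caccio]) auto
  also have "\<dots> = ennreal (K * (1 - s) * \<rho> powr s * (16 * C / (s * (1 - s)) * (r2 - r1) powr (- s)) * (\<theta> * \<kappa> * V * q ^ j))"
  proof -
    have abe: "ennreal a * (ennreal b * ennreal e) = ennreal (a * b * e)" if "0 \<le> a" "0 \<le> b" "0 \<le> e" for a b e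
      using that by (simp add: ennreal_mult mult.assoc)
    show ?thesis by (rule abe) (use K s C_pos \<theta> \<kappa> V q in auto)
  qed
  also have "\<dots> \<le> ennreal (q * (\<theta> * \<kappa> * V * q ^ j))"
  proof (intro ennreal_leI mult_right_mono)
    \<comment> \<open>The ratio of scale to gap is the same in every step; the numeral 96 in
      \<open>M\<close> is this 6 times the 16 of the Caccioppoli estimate.\<close>
    have quot: "\<rho> / (r2 - r1) = 6 * A powr (- (1 / s))"
      unfolding gap \<rho>_def t_def L_def using r by (simp add: field_simps)
    have "\<rho> powr s * (r2 - r1) powr (- s) = (\<rho> / (r2 - r1)) powr s"
      using \<rho> rr by (simp add: powr_divide powr_minus field_simps)
    also have "\<dots> = 6 powr s * A powr (- 1)"
      unfolding quot using s A3 by (simp add: powr_mult powr_powr)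
    also have "\<dots> \<le> 6 powr 1 * A powr (- 1)"
      using s by (intro mult_right_mono powr_mono) auto
    also have "\<dots> = 6 / A" using A3 by (simp add: powr_minus field_simps)
    finally have 1: "\<rho> powr s * (r2 - r1) powr (- s) \<le> 6 / A" .
    have "K * (1 - s) * \<rho> powr s * (16 * C / (s * (1 - s)) * (r2 - r1) powr (- s)) =
      16 * K * C / s * (\<rho> powr s * (r2 - r1) powr (- s))"
      using s by (simp add: field_simps)
    also have "\<dots> \<le> 16 * K * C / s * (6 / A)"
      using 1 K s C_pos by (intro mult_left_mono) auto
    also have "\<dots> = (96 * K * C / s) / A" by simp
    also have "\<dots> \<le> M / A" using M(2) A3 by (intro divide_right_mono) auto
    also have "\<dots> = q" using M unfolding A_def q_def powr_minus_divide by simp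
    finally show "K * (1 - s) * \<rho> powr s * (16 * C / (s * (1 - s)) * (r2 - r1) powr (- s)) \<le> q" .
  qed (use \<theta> \<kappa> V q in auto)
  finally have "a (Suc j) \<le> ennreal (q * (\<theta> * \<kappa> * V * q ^ j))" using a_Suc by (rule order_trans[rotated])
  then show ?case by (simp add: a_def V_def q_def algebra_simps)
qed


text \<open>Any positive \<open>\<kappa>\<close> above \<open>y / (\<theta> * V)\<close> starts the
  iteration, where \<open>y\<close> is the integral of the positive part. In the limit
  \<open>u \<le> k0 + \<kappa>\<close> almost everywhere on the smaller ball, so
  \<open>1 / \<theta>\<close> times the mean is the bound; the rest is to bring
  \<open>1 / \<theta>\<close> into the stated form.\<close>

lemma local_bound:
  fixes s Q c K r R k0 :: real
  assumes s: "0 < s" "s < 1" and dim: "doubling_dimension m \<mu> Q c" "s < Q" and c1: "c \<le> 1" and Q0: "Q \<le> Q0"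
    and K: "0 < K" "small_support_const s K"
    and \<Omega>: "openin (mtopology_of m) \<Omega>" and x0: "x0 \<in> X" and r: "0 < r" "r < R" and sub: "B x0 R \<subseteq> \<Omega>"
    and sol: "subminimizer m \<mu> s \<Omega> u \<or> (\<exists>\<psi>. (AE y in N. y \<in> B x0 R \<longrightarrow> \<psi> y \<le> ereal k0) \<and> obstacle_solution m \<mu> s \<Omega> \<psi> (\<lambda>_. 0) u)"
  shows "ess_sup_on m \<mu> (B x0 r) (\<lambda>y. u y - ereal k0) \<le>
    ereal ((4 / c * 2 powr (Q0 + 1) * max 3 (96 * K * C) / s) powr (Q / s) * (R / (R - r)) powr Q) *
      enn2ereal (mean_pos_part m \<mu> (B x0 R) (\<lambda>y. u y - ereal k0))"
proof -
  define D where "D = 4 / c * 2 powr (Q0 + 1) * max 3 (96 * K * C)"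
  define L where "L = R / (R - r)"
  define V where "V = v x0 R"
  define Y where "Y = (\<integral>\<^sup>+y\<in>B x0 R. e2ennreal (max (u y - ereal k0) 0) \<partial>N)"
  have c: "c > 0" and Q: "Q > 0" using dim by (auto simp: doubling_dimension_def)
  have V: "V > 0" unfolding V_def using x0 r by (intro v_pos) auto
  have L: "L > 0" unfolding L_def using r by simp
  have D: "D > 0" unfolding D_def using c by (intro mult_pos_pos) auto
  have mean: "mean_pos_part m \<mu> (B x0 R) (\<lambda>y. u y - ereal k0) = Y / ennreal V"
    using x0 by (simp add: mean_pos_part_def Y_def V_def emeasure_N[symmetric] emeasure_ball')
  have u [measurable]: "u \<in> borel_measurable N"
    using sol
  proof (elim disjE exE conjE)
    fix \<psi> assume "obstacle_solution m \<mu> s \<Omega> \<psi> (\<lambda>_. 0) u"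
    then have "u \<in> borel_measurable (restrict_space N X)"
      by (simp add: obstacle_solution_def obstacle_class_def dot_Ws1_def)
    then have "(\<lambda>x. if x \<in> X then u x else 0) \<in> borel_measurable N"
      using measurable_restrict_space_iff[of X N 0 borel u] by simp
    then show ?thesis by (rule measurable_cong[THEN iffD1, rotated]) simp
  qed (simp add: subminimizer_def)
  define Z where "Z = (D / s) powr (Q / s) * L powr Q"
  have Z: "Z > 0" using D s L by (simp add: Z_def)
  have "ess_sup_on m \<mu> (B x0 r) (\<lambda>y. u y - ereal k0) \<le> ereal Z * enn2ereal (Y / ennreal V)"
  proof (cases "Y = top")
    case True
    then have "Y / ennreal V = top" using V by (simp add: ennreal_top_divide)
    then show ?thesis using Z by (simp add: top_ereal_def)
  next
    case False
    then obtain y where y: "Y = ennreal y" "0 \<le> y" by (cases Y) auto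
    define M where "M = max 3 (96 * K * C) / s"
    have M: "3 \<le> M" "96 * K * C / s \<le> M"
    proof -
      have "3 * s \<le> max 3 (96 * K * C)" using s by auto
      then show "3 \<le> M" using s by (simp add: M_def pos_le_divide_eq)
      show "96 * K * C / s \<le> M" unfolding M_def using s by (intro divide_right_mono) auto
    qed
    define A where "A = 2 powr (Q + 1) * M"
    define \<theta> where "\<theta> = c / 4 * A powr (- (Q / s)) * L powr (- Q)"
    have A: "A > 0" using M by (simp add: A_def)
    have \<theta>: "\<theta> > 0" using c A L by (simp add: \<theta>_def)
    have Zth: "1 / \<theta> \<le> Z"
    proof -
      have "1 / \<theta> = 4 / c * A powr (Q / s) * L powr Q"
        using A c L by (simp add: \<theta>_def powr_minus field_simps)
      \<comment> \<open>Since \<open>c \<le> 1\<close> and \<open>s < Q\<close>, the factor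
        \<open>4 / c\<close> only grows when raised to the power \<open>Q / s\<close>; afterwards it
        merges with the other base.\<close>
      also have "\<dots> \<le> (4 / c) powr (Q / s) * (D / s * c / 4) powr (Q / s) * L powr Q"
      proof (intro mult_right_mono mult_mono)
        have "(4 / c) powr 1 \<le> (4 / c) powr (Q / s)" using c c1 dim s by (intro powr_mono) auto
        then show "4 / c \<le> (4 / c) powr (Q / s)" using c by simp
        have "A \<le> 2 powr (Q0 + 1) * M" unfolding A_def using Q0 M by (intro mult_right_mono powr_mono) auto
        also have "\<dots> = D / s * c / 4" using c by (simp add: D_def M_def)
        finally show "A powr (Q / s) \<le> (D / s * c / 4) powr (Q / s)" using A Q s by (intro powr_mono2) auto
      qed auto
      also have "(4 / c) powr (Q / s) * (D / s * c / 4) powr (Q / s) = (D / s) powr (Q / s)"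
        using c D s by (subst powr_mult[symmetric]) auto
      finally show ?thesis by (simp add: Z_def)
    qed
    \<comment> \<open>The iteration sees only \<open>pospart\<close>, hence not the points where
      \<open>u\<close> is \<open>\<infinity>\<close>. They form a null set in the large ball because
      the integral \<open>Y\<close> is finite.\<close>
    have "AE x in N. e2ennreal (max (u x - ereal k0) 0) * indicator (B x0 R) x \<noteq> \<infinity>"
      using False unfolding Y_def by (intro nn_integral_PInf_AE) auto
    then have finu: "AE x in N. x \<in> B x0 R \<longrightarrow> u x \<noteq> \<infinity>"
      by eventually_elim (auto simp: max_def)
    \<comment> \<open>The strict inequality makes \<open>\<kappa>\<close> positive even if
      \<open>y = 0\<close>; the boundary value is reached afterwards by a limit.\<close>
    have bound: "ess_sup_on m \<mu> (B x0 r) (\<lambda>y. u y - ereal k0) \<le> ereal \<kappa>" if \<kappa>: "y / (\<theta> * V) < \<kappa>" for \<kappa>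
    proof -
      have \<kappa>0: "0 < \<kappa>" using \<kappa> y \<theta> V by (auto intro: le_less_trans[rotated])
      define q :: real where "q = 2 powr (- (Q + 1))"
      have q: "0 < q" "q < 1" using Q powr_less_cancel_iff[of 2 "- (Q + 1)" 0] by (auto simp: q_def)
      have "(\<integral>\<^sup>+x. ennreal (pospart u k0 x * indicator (B x0 R) x) \<partial>N) \<le> Y"
        unfolding Y_def
      proof (intro nn_integral_mono)
        fix x
        have "ennreal (pospart u k0 x) \<le> e2ennreal (max (u x - ereal k0) 0)"
          unfolding pospart_def by (cases "max (u x - ereal k0) 0") auto
        then show "ennreal (pospart u k0 x * indicator (B x0 R) x) \<le> e2ennreal (max (u x - ereal k0) 0) * indicator (B x0 R) x"
          by (auto simp: indicator_def)
      qed
      also have "Y \<le> ennreal (\<theta> * \<kappa> * V)"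
        unfolding y(1) using \<kappa> \<theta> V by (intro ennreal_leI) (simp add: field_simps)
      finally have start: "(\<integral>\<^sup>+x. ennreal (pospart u k0 x * indicator (B x0 R) x) \<partial>N) \<le> ennreal (\<theta> * \<kappa> * V)" .
      define I where "I = (\<integral>\<^sup>+x. ennreal (pospart u (k0 + \<kappa>) x * indicator (B x0 r) x) \<partial>N)"
      have "I \<le> ennreal (\<theta> * \<kappa> * V * q ^ j)" for j
      proof -
        have "I \<le> (\<integral>\<^sup>+x. ennreal (pospart u (k0 + \<kappa> * (1 - 1 / 2 ^ j)) x * indicator (B x0 (r + (R - r) / 2 ^ j)) x) \<partial>N)"
          unfolding I_def
        proof (intro nn_integral_mono ennreal_leI mult_mono)
          fix x
          have "\<kappa> * (1 - 1 / 2 ^ j) \<le> \<kappa> * 1" using \<kappa>0 by (intro mult_left_mono) auto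
          then show "pospart u (k0 + \<kappa>) x \<le> pospart u (k0 + \<kappa> * (1 - 1 / 2 ^ j)) x" by (intro pospart_antimono) simp
          have "0 < (R - r) / 2 ^ j" using r by simp
          then have "B x0 r \<subseteq> B x0 (r + (R - r) / 2 ^ j)" by auto
          then show "(indicator (B x0 r) x :: real) \<le> indicator (B x0 (r + (R - r) / 2 ^ j)) x"
            by (auto simp: indicator_def)
        qed auto
        also have "\<dots> \<le> ennreal (\<theta> * \<kappa> * V * q ^ j)"
          unfolding \<theta>_def A_def L_def V_def q_def
          using s dim K \<Omega> x0 r sub u sol M \<kappa>0 start[unfolded \<theta>_def A_def L_def V_def]
          by (intro de_giorgi_iteration) auto
        finally show ?thesis .
      qed
      moreover have "(\<lambda>j. ennreal (\<theta> * \<kappa> * V * q ^ j)) \<longlonglongrightarrow> ennreal (\<theta> * \<kappa> * V * 0)"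
        using q by (intro tendsto_ennrealI tendsto_mult tendsto_const LIMSEQ_realpow_zero) auto
      ultimately have "I \<le> ennreal (\<theta> * \<kappa> * V * 0)"
        by (intro LIMSEQ_le_const) auto
      then have "I = 0" by simp
      have [measurable]: "pospart u k \<in> borel_measurable N" for k unfolding pospart_def by measurable
      from \<open>I = 0\<close> have "AE x in N. ennreal (pospart u (k0 + \<kappa>) x * indicator (B x0 r) x) = 0"
        unfolding I_def by (subst (asm) nn_integral_0_iff_AE) auto
      with finu have "AE x in N. x \<in> B x0 r \<longrightarrow> u x - ereal k0 \<le> ereal \<kappa>"
      proof eventually_elim
        case (elim x)
        show ?case
        proof
          assume x: "x \<in> B x0 r"
          then have "u x \<noteq> \<infinity>" using elim r by auto
          moreover have "pospart u (k0 + \<kappa>) x \<le> 0" using elim(2) x by (simp add: ennreal_eq_0_iff)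
          then have p0: "pospart u (k0 + \<kappa>) x = 0" using pospart_nonneg[of u "k0 + \<kappa>" x] by linarith
          ultimately consider a where "u x = ereal a" | "u x = -\<infinity>" by (cases "u x") auto
          then show "u x - ereal k0 \<le> ereal \<kappa>"
          proof cases
            case 1
            have "max (a - (k0 + \<kappa>)) 0 = 0" using pospart_ereal[of u x a "k0 + \<kappa>"] 1 p0 by simp
            then have "a - k0 \<le> \<kappa>" by linarith
            then show ?thesis by (simp add: 1)
          qed simp
        qed
      qed
      then have "AE x in restrict_space N (B x0 r). u x - ereal k0 \<le> ereal \<kappa>"
        by (subst AE_restrict_space_iff) auto
      moreover have "(\<lambda>y. u y - ereal k0) \<in> borel_measurable (restrict_space N (B x0 r))"
        by (intro measurable_restrict_space1) measurable
      ultimately show ?thesis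
        unfolding ess_sup_on_def by (intro esssup_I)
    qed
    have "ess_sup_on m \<mu> (B x0 r) (\<lambda>y. u y - ereal k0) \<le> ereal (y / (\<theta> * V))"
      using bound by (rule ereal_le_of_forall_gt_real)
    also have "\<dots> \<le> ereal (Z * (y / V))"
    proof -
      have "y / (\<theta> * V) = 1 / \<theta> * (y / V)" by simp
      also have "\<dots> \<le> Z * (y / V)" using Zth y V by (intro mult_right_mono) auto
      finally show ?thesis by simp
    qed
    also have "\<dots> = ereal Z * enn2ereal (Y / ennreal V)"
      using y V by (simp add: divide_ennreal enn2ereal_ennreal)
    finally show ?thesis .
  qed
  then show ?thesis unfolding mean Z_def D_def L_def .
qed

text \<open>The constant must not depend on \<open>Q\<close>: a large \<open>Q\<close> is replaced by the dimension
  \<open>max 1 (log 2 C)\<close> coming from the doubling constant.\<close>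

lemma local_bound_uniform:
  fixes s Q c K r R k0 :: real
  defines "Q0 \<equiv> max 1 (log 2 C)"
  defines "D \<equiv> 4 / min c (1 / C) * 2 powr (Q0 + 1) * max 3 (96 * K * C)"
  assumes s: "0 < s" "s < 1" and dim: "doubling_dimension m \<mu> Q c" "s < Q"
    and K: "0 < K" "small_support_const s K"
    and \<Omega>: "openin (mtopology_of m) \<Omega>" and x0: "x0 \<in> \<Omega>" and r: "0 < r" "r < R" and sub: "B x0 R \<subseteq> \<Omega>"
    and sol: "subminimizer m \<mu> s \<Omega> u \<or> (\<exists>\<psi>. (\<forall>x\<in>\<Omega>. \<psi> x < \<infinity>) \<and> (AE y in N. y \<in> B x0 R \<longrightarrow> \<psi> y \<le> ereal k0) \<and> obstacle_solution m \<mu> s \<Omega> \<psi> (\<lambda>_. 0) u)"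
  shows "1 \<le> D / s"
    and "ess_sup_on m \<mu> (B x0 r) (\<lambda>y. u y - ereal k0) \<le>
      ereal ((D / s) powr (min Q Q0 / s) * (R / (R - r)) powr Q) * enn2ereal (mean_pos_part m \<mu> (B x0 R) (\<lambda>y. u y - ereal k0))"
proof -
  \<comment> \<open>One constant valid for both candidate dimensions \<open>Q\<close> and
    \<open>Q0\<close>, and at most 1 as \<open>local_bound\<close> requires.\<close>
  define c' where "c' = min c (1 / C)"
  have c: "c > 0" using dim by (auto simp: doubling_dimension_def)
  have c': "0 < c'" "c' \<le> 1" "c' \<le> c" "c' \<le> 1 / C" using c C_ge_1 by (auto simp: c'_def min_le_iff_disj)
  have dim': "doubling_dimension m \<mu> (min Q Q0) c'"
  proof (cases "Q \<le> Q0")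
    case True
    then show ?thesis using doubling_dimension_mono[OF dim(1) c'(1,3)] by simp
  next
    case False
    then show ?thesis
      using doubling_dimension_mono[OF doubling_dimension_log c'(1,4)] by (simp add: Q0_def min_def)
  qed
  have Q0: "1 \<le> Q0" by (simp add: Q0_def)
  have x0X: "x0 \<in> X" using x0 openin_subset[OF \<Omega>] by auto
  \<comment> \<open>A base \<open>D / s\<close> of at least 1 allows the exponent to be enlarged
    later: to \<open>Q0 / s\<close> for a constant free of \<open>Q\<close>, and to
    \<open>Q / s\<close> under a Poincare inequality.\<close>
  have "1 * 1 * 3 \<le> D"
    unfolding D_def c'_def[symmetric] using c' Q0 by (intro mult_mono ge_one_powr_ge_zero) auto
  then show D: "1 \<le> D / s" using s by simp
  have RR: "1 \<le> R / (R - r)" using r by simp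
  let ?E = "enn2ereal (mean_pos_part m \<mu> (B x0 R) (\<lambda>y. u y - ereal k0))"
  have "ess_sup_on m \<mu> (B x0 r) (\<lambda>y. u y - ereal k0) \<le>
    ereal ((4 / c' * 2 powr (Q0 + 1) * max 3 (96 * K * C) / s) powr (min Q Q0 / s) * (R / (R - r)) powr (min Q Q0)) * ?E"
    using s dim' dim(2) Q0 c' K \<Omega> x0X r sub sol by (intro local_bound) auto
  also have "\<dots> \<le> ereal ((D / s) powr (min Q Q0 / s) * (R / (R - r)) powr Q) * ?E"
  proof (intro ereal_mult_right_mono)
    have "(R / (R - r)) powr (min Q Q0) \<le> (R / (R - r)) powr Q" using RR by (intro powr_mono) auto
    then show "ereal ((4 / c' * 2 powr (Q0 + 1) * max 3 (96 * K * C) / s) powr (min Q Q0 / s) * (R / (R - r)) powr (min Q Q0)) \<le>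
      ereal ((D / s) powr (min Q Q0 / s) * (R / (R - r)) powr Q)"
      unfolding D_def c'_def[symmetric] by (simp add: mult_left_mono)
  qed simp
  finally show "ess_sup_on m \<mu> (B x0 r) (\<lambda>y. u y - ereal k0) \<le>
      ereal ((D / s) powr (min Q Q0 / s) * (R / (R - r)) powr Q) * ?E" .
qed

end

theorem theorem3p1:
  fixes C\<mu> c :: real
  assumes "C\<mu> > 0" and "c > 0"
  shows
    "(\<forall>s. 0 < s \<longrightarrow> s < 1 \<longrightarrow> (\<exists>C3>0.
       (\<forall>(m :: 'a metric) \<mu> Q \<Omega> x0 r R k0 u.
         metric_measure_space m \<mu> \<longrightarrow> mcomplete_of m \<longrightarrow> connected_space (mtopology_of m) \<longrightarrow>
         doubling m \<mu> C\<mu> \<longrightarrow> doubling_dimension m \<mu> Q c \<longrightarrow> s < Q \<longrightarrow>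
         openin (mtopology_of m) \<Omega> \<longrightarrow> \<Omega> \<noteq> {} \<longrightarrow>
         x0 \<in> \<Omega> \<longrightarrow> 0 < r \<longrightarrow> r < R \<longrightarrow> mball_of m x0 R \<subseteq> \<Omega> \<longrightarrow>
         (subminimizer m \<mu> s \<Omega> u \<or>
          (\<exists>\<psi>. (\<forall>x\<in>\<Omega>. \<psi> x < \<infinity>) \<and>
               (AE y in meas m \<mu>. y \<in> mball_of m x0 R \<longrightarrow> \<psi> y \<le> ereal k0) \<and>
               obstacle_solution m \<mu> s \<Omega> \<psi> (\<lambda>_. 0) u)) \<longrightarrow>
         ess_sup_on m \<mu> (mball_of m x0 r) (\<lambda>y. u y - ereal k0)
         \<le> ereal (C3 * (R / (R - r)) powr Q) *
           enn2ereal (mean_pos_part m \<mu> (mball_of m x0 R) (\<lambda>y. u y - ereal k0))))) \<and>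
     (\<forall>CP>0. \<forall>lam\<ge>1. \<exists>C3'>0. \<forall>s. 0 < s \<longrightarrow> s < 1 \<longrightarrow>
       (\<forall>(m :: 'a metric) \<mu> Q \<Omega> x0 r R k0 u.
         metric_measure_space m \<mu> \<longrightarrow> mcomplete_of m \<longrightarrow> connected_space (mtopology_of m) \<longrightarrow>
         doubling m \<mu> C\<mu> \<longrightarrow> doubling_dimension m \<mu> Q c \<longrightarrow> s < Q \<longrightarrow> poincare m \<mu> CP lam \<longrightarrow>
         openin (mtopology_of m) \<Omega> \<longrightarrow> \<Omega> \<noteq> {} \<longrightarrow>
         x0 \<in> \<Omega> \<longrightarrow> 0 < r \<longrightarrow> r < R \<longrightarrow> mball_of m x0 R \<subseteq> \<Omega> \<longrightarrow>
         (subminimizer m \<mu> s \<Omega> u \<or>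
          (\<exists>\<psi>. (\<forall>x\<in>\<Omega>. \<psi> x < \<infinity>) \<and>
               (AE y in meas m \<mu>. y \<in> mball_of m x0 R \<longrightarrow> \<psi> y \<le> ereal k0) \<and>
               obstacle_solution m \<mu> s \<Omega> \<psi> (\<lambda>_. 0) u)) \<longrightarrow>
         ess_sup_on m \<mu> (mball_of m x0 r) (\<lambda>y. u y - ereal k0)
         \<le> ereal ((C3' / s) powr (Q / s) * (R / (R - r)) powr Q) *
           enn2ereal (mean_pos_part m \<mu> (mball_of m x0 R) (\<lambda>y. u y - ereal k0))))"
proof -
  define Q0 where "Q0 = max 1 (log 2 C\<mu>)"
  define D where "D K = 4 / min c (1 / C\<mu>) * 2 powr (Q0 + 1) * max 3 (96 * K * C\<mu>)" for K
  have D: "D K > 0" for K unfolding D_def using assms by (intro mult_pos_pos) auto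
  show ?thesis
  proof (intro conjI allI impI, goal_cases)
    case (1 s)
    then have s: "0 < s" "s < 1" .
    \<comment> \<open>The division by \<open>1 - s\<close> is harmless in this part, where the
      constant may depend on \<open>s\<close> in any way.\<close>
    define K where "K = 2 * C\<mu> / (1 - s)"
    have K: "K > 0" using assms s by (simp add: K_def)
    show ?case
    \<comment> \<open>The constant is chosen before the space and \<open>Q\<close> are given, hence
      the exponent \<open>Q0 / s\<close> in place of \<open>min Q Q0 / s\<close>.\<close>
    proof (intro exI[of _ "(D K / s) powr (Q0 / s)"] conjI allI impI)
      show "0 < (D K / s) powr (Q0 / s)" using D[of K] s by simp
      fix m :: "'a metric" and \<mu> Q \<Omega> x0 r R k0 u
      assume hyp: "metric_measure_space m \<mu>" "doubling m \<mu> C\<mu>" "doubling_dimension m \<mu> Q c" "s < Q"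
        "openin (mtopology_of m) \<Omega>" "x0 \<in> \<Omega>" "0 < r" "r < R" "mball_of m x0 R \<subseteq> \<Omega>"
        "subminimizer m \<mu> s \<Omega> u \<or>
          (\<exists>\<psi>. (\<forall>x\<in>\<Omega>. \<psi> x < \<infinity>) \<and>
               (AE y in meas m \<mu>. y \<in> mball_of m x0 R \<longrightarrow> \<psi> y \<le> ereal k0) \<and>
               obstacle_solution m \<mu> s \<Omega> \<psi> (\<lambda>_. 0) u)"
      interpret doubling_mms m \<mu> C\<mu> using hyp by unfold_locales
      note bd = local_bound_uniform[OF s hyp(3,4) K small_support_const_doubling[OF s, folded K_def] hyp(5-10),
        folded Q0_def, folded D_def]
      note bd(2)
      also have "ereal ((D K / s) powr (min Q Q0 / s) * (R / (R - r)) powr Q) *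
          enn2ereal (mean_pos_part m \<mu> (mball_of m x0 R) (\<lambda>y. u y - ereal k0)) \<le>
        ereal ((D K / s) powr (Q0 / s) * (R / (R - r)) powr Q) *
          enn2ereal (mean_pos_part m \<mu> (mball_of m x0 R) (\<lambda>y. u y - ereal k0))"
        using bd(1) s by (intro ereal_mult_right_mono) (auto intro!: mult_right_mono powr_mono divide_right_mono)
      finally show "ess_sup_on m \<mu> (mball_of m x0 r) (\<lambda>y. u y - ereal k0)
         \<le> ereal ((D K / s) powr (Q0 / s) * (R / (R - r)) powr Q) *
           enn2ereal (mean_pos_part m \<mu> (mball_of m x0 R) (\<lambda>y. u y - ereal k0))" .
    qed
  next
    case (2 CP lam)
    then have CP: "CP > 0" by simp
    \<comment> \<open>The number of doublings that absorb the dilation factor depends on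
      \<open>lam\<close> alone, so \<open>D K\<close> can be fixed before \<open>s\<close> and the
      space.\<close>
    obtain n :: nat where n: "2 * lam \<le> 2 ^ n"
      using real_arch_pow[of 2 "2 * lam"] by (auto intro: less_imp_le)
    define K where "K = 4 * C\<mu> + 24 * C\<mu> * (2 * C\<mu> ^ 6 + 6 * CP * C\<mu> ^ (n + 11))"
    have K: "K > 0" unfolding K_def using assms CP by (intro add_pos_pos mult_pos_pos) auto
    show ?case
    proof (intro exI[of _ "D K"] conjI allI impI)
      show "0 < D K" by (rule D)
      fix s and m :: "'a metric" and \<mu> Q \<Omega> x0 r R k0 u
      assume s: "0 < s" "s < (1::real)" and P: "poincare m \<mu> CP lam"
        and hyp: "metric_measure_space m \<mu>" "doubling m \<mu> C\<mu>" "doubling_dimension m \<mu> Q c" "s < Q"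
        "openin (mtopology_of m) \<Omega>" "x0 \<in> \<Omega>" "0 < r" "r < R" "mball_of m x0 R \<subseteq> \<Omega>"
        "subminimizer m \<mu> s \<Omega> u \<or>
          (\<exists>\<psi>. (\<forall>x\<in>\<Omega>. \<psi> x < \<infinity>) \<and>
               (AE y in meas m \<mu>. y \<in> mball_of m x0 R \<longrightarrow> \<psi> y \<le> ereal k0) \<and>
               obstacle_solution m \<mu> s \<Omega> \<psi> (\<lambda>_. 0) u)"
      interpret doubling_mms m \<mu> C\<mu> using hyp by unfold_locales
      note bd = local_bound_uniform[OF s hyp(3,4) K small_support_const_poincare[OF P n s, folded K_def] hyp(5-10),
        folded Q0_def, folded D_def]
      note bd(2)
      also have "ereal ((D K / s) powr (min Q Q0 / s) * (R / (R - r)) powr Q) *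
          enn2ereal (mean_pos_part m \<mu> (mball_of m x0 R) (\<lambda>y. u y - ereal k0)) \<le>
        ereal ((D K / s) powr (Q / s) * (R / (R - r)) powr Q) *
          enn2ereal (mean_pos_part m \<mu> (mball_of m x0 R) (\<lambda>y. u y - ereal k0))"
        using bd(1) s by (intro ereal_mult_right_mono) (auto intro!: mult_right_mono powr_mono divide_right_mono)
      finally show "ess_sup_on m \<mu> (mball_of m x0 r) (\<lambda>y. u y - ereal k0)
         \<le> ereal ((D K / s) powr (Q / s) * (R / (R - r)) powr Q) *
           enn2ereal (mean_pos_part m \<mu> (mball_of m x0 R) (\<lambda>y. u y - ereal k0))" .
    qed
  qed
qed

end
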